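(* Let $\mathcal{E}=(L|K,v)$ be a Galois defect extension of prime degree $p$. If $\operatorname{char} K=0$, then assume that $K$ contains all $p$-th roots of unity. Then $\mathcal{E}$ has a unique (nonzero) ramification ideal $I_{\mathcal{E}}$, and there is an $\mathcal{O}_L$-module isomorphism $$\Omega_{\mathcal{O}_L|\mathcal{O}_K}\cong I_{\mathcal{E}}/I_{\mathcal{E}}^p .$$
   Context: $(L|K,v)$ denotes a field extension $L|K$ with a (Krull) valuation $v$ on $L$ of arbitrary rank (written additively), $K$ being endowed with the restriction of $v$. $\mathcal{O}_L,\mathcal{O}_K$ are the valuation rings, $vL,vK$ the value groups, $Lv,Kv$ the residue fields. $\Omega_{B|A}$ is the module of Kähler differentials. $(L|K,v)$ is unibranched if the extension of $v$ from $K$ to $L$ is unique. For a finite unibranched extension, $[L:K]=\tilde p^{\,\nu}(vL:vK)[Lv:Kv]$ with an integer $\nu\ge0$, where $\tilde p=\operatorname{char}Kv$ if this is positive and $\tilde p=1$ otherwise; it is a defect extension if $\tilde p^{\,\nu}>1$. A defect extension of prime degree is always tacitly assumed to be unibranched; hence its degree is $p=\operatorname{char}Kv$, $vL=vK$ and $Lv=Kv$. Let $G=\operatorname{Gal}(L|K)$. For a final segment (upward closed subset) $\Sigma$ of $vL^{>0}=\{\gamma\in vL\mid\gamma>0\}$ put $I_\Sigma=\{a\in L\mid va\in\Sigma\}\cup\{0\}$ (an $\mathcal{O}_L$-ideal) and $$G_\Sigma=\Big\{\sigma\in G\;\Big|\; v\Big(\frac{\sigma b-b}{b}\Big)\in\Sigma\cup\{\infty\}\text{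 for all }b\in L^\times\Big\}.$$ A nonempty final segment $\Sigma$ is a ramification jump if $\Sigma'\subsetneq\Sigma$ implies $G_{\Sigma'}\subsetneq G_\Sigma$ for all final segments $\Sigma'$ of $vL^{>0}$ (including $\Sigma'=\emptyset$). A ramification ideal is an ideal $I_\Sigma$ for a ramification jump $\Sigma$. *)

theory Defs
  imports "HOL-Algebra.Algebra" "HOL-Algebra.Algebraic_Closure_Type"
begin

section \<open>Quotient modules, ideals as modules, and Kaehler differentials\<close>

text \<open>The multiplicative fields of the library's module records are irrelevant for modules;
  they are left unspecified below.\<close>

definition free_module :: "('a, 'm) ring_scheme \<Rightarrow> 's set \<Rightarrow> ('a, 's \<Rightarrow> 'a) module" where
  "free_module R S =
    \<lparr>carrier = {f. (\<forall>s. f s \<in> carrier R) \<and> finite {s. f s \<noteq> \<zero>\<^bsub>R\<^esub>} \<and> (\<forall>s. s \<notin> S \<longrightarrow> f s = \<zero>\<^bsub>R\<^esub>)},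
     monoid.mult = undefined, monoid.one = undefined,
     ring.zero = (\<lambda>s. \<zero>\<^bsub>R\<^esub>), ring.add = (\<lambda>f g s. f s \<oplus>\<^bsub>R\<^esub> g s),
     module.smult = (\<lambda>r f s. r \<otimes>\<^bsub>R\<^esub> f s)\<rparr>"

definition ideal_module :: "('a, 'm) ring_scheme \<Rightarrow> 'a set \<Rightarrow> ('a, 'a) module" where
  "ideal_module R I =
    \<lparr>carrier = I, monoid.mult = undefined, monoid.one = undefined,
     ring.zero = \<zero>\<^bsub>R\<^esub>, ring.add = (\<oplus>\<^bsub>R\<^esub>), module.smult = (\<otimes>\<^bsub>R\<^esub>)\<rparr>"

text \<open>Elements are cosets \<open>N + x\<close>; \<open>r\<close> maps \<open>N + x\<close> to \<open>N + rx\<close>.\<close>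

definition quotient_module ::
    "('a, 'b, 'm) module_scheme \<Rightarrow> 'b set \<Rightarrow> ('a, 'b set) module" where
  "quotient_module M N =
    \<lparr>carrier = a_rcosets\<^bsub>M\<^esub> N, monoid.mult = undefined, monoid.one = undefined,
     ring.zero = N, ring.add = set_add M,
     module.smult = (\<lambda>r C. \<Union>x\<in>C. N +>\<^bsub>M\<^esub> (r \<odot>\<^bsub>M\<^esub> x))\<rparr>"

definition generated_submodule ::
    "('a, 'r) ring_scheme \<Rightarrow> ('a, 'b, 'm) module_scheme \<Rightarrow> 'b set \<Rightarrow> 'b set" where
  "generated_submodule R M G = \<Inter>{N. submodule N R M \<and> G \<subseteq> N}"

definition module_isomorphic ::
    "('a, 'r) ring_scheme \<Rightarrow> ('a, 'b, 'm) module_scheme \<Rightarrow> ('a, 'c, 'n) module_scheme \<Rightarrow> bool" where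
  "module_isomorphic R M N \<longleftrightarrow>
    (\<exists>h. bij_betw h (carrier M) (carrier N) \<and>
         (\<forall>x\<in>carrier M. \<forall>y\<in>carrier M. h (x \<oplus>\<^bsub>M\<^esub> y) = h x \<oplus>\<^bsub>N\<^esub> h y) \<and>
         (\<forall>r\<in>carrier R. \<forall>x\<in>carrier M. h (r \<odot>\<^bsub>M\<^esub> x) = r \<odot>\<^bsub>N\<^esub> h x))"

text \<open>The module of Kaehler differentials of a commutative ring \<open>B\<close> over a subring \<open>A\<close>: the free
  \<open>B\<close>-module on symbols \<open>db\<close> (\<open>b \<in> B\<close>) modulo \<open>d(b + c) = db + dc\<close>, \<open>d(bc) = b dc + c db\<close>, and
  \<open>da = 0\<close> for \<open>a \<in> A\<close>; the last two give \<open>A\<close>-linearity of \<open>d\<close>.\<close>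

definition free_gen :: "('a, 'm) ring_scheme \<Rightarrow> 's \<Rightarrow> ('s \<Rightarrow> 'a)" where
  "free_gen R s = (\<lambda>t. if t = s then \<one>\<^bsub>R\<^esub> else \<zero>\<^bsub>R\<^esub>)"

definition kaehler_relations :: "('a, 'm) ring_scheme \<Rightarrow> 'a set \<Rightarrow> ('a \<Rightarrow> 'a) set" where
  "kaehler_relations B A =
    (let F = free_module B (carrier B); d = free_gen B in
      {d (b \<oplus>\<^bsub>B\<^esub> c) \<ominus>\<^bsub>F\<^esub> (d b \<oplus>\<^bsub>F\<^esub> d c) | b c. b \<in> carrier B \<and> c \<in> carrier B} \<union>
      {d (b \<otimes>\<^bsub>B\<^esub> c) \<ominus>\<^bsub>F\<^esub> ((b \<odot>\<^bsub>F\<^esub> d c) \<oplus>\<^bsub>F\<^esub> (c \<odot>\<^bsub>F\<^esub> d b)) | b c.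
          b \<in> carrier B \<and> c \<in> carrier B} \<union>
      d ` A)"

definition kaehler_differentials ::
    "('a, 'm) ring_scheme \<Rightarrow> 'a set \<Rightarrow> ('a, ('a \<Rightarrow> 'a) set) module" where
  "kaehler_differentials B A =
    (let F = free_module B (carrier B) in
      quotient_module F (generated_submodule B F (kaehler_relations B A)))"


section \<open>Valued field extensions\<close>

text \<open>The field \<open>L\<close> is a type of class \<open>field\<close>, \<open>K\<close> is a subfield of it, given as a set, and the
  valuation of \<open>K\<close> is the restriction of \<open>v\<close>.\<close>

abbreviation ambient_field :: "'l::field ring" where
  "ambient_field \<equiv> ring_of_type_algebra"

text \<open>The value \<open>v 0 = \<infinity>\<close> is not represented: \<open>v 0\<close> is arbitrary and never referred to. The ordered
  group \<open>'g\<close> may be larger than the value group, which is \<open>v ` (UNIV - {0})\<close>.\<close>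

definition krull_valuation :: "('l::field \<Rightarrow> 'g::linordered_ab_group_add) \<Rightarrow> bool" where
  "krull_valuation v \<longleftrightarrow>
    (\<forall>x y. x \<noteq> 0 \<longrightarrow> y \<noteq> 0 \<longrightarrow> v (x * y) = v x + v y) \<and>
    (\<forall>x y. x \<noteq> 0 \<longrightarrow> y \<noteq> 0 \<longrightarrow> x + y \<noteq> 0 \<longrightarrow> min (v x) (v y) \<le> v (x + y))"

definition value_set :: "('l::field \<Rightarrow> 'g::linordered_ab_group_add) \<Rightarrow> 'l set \<Rightarrow> 'g set" where
  "value_set v F = v ` (F - {0})"

definition value_group :: "('l::field \<Rightarrow> 'g::linordered_ab_group_add) \<Rightarrow> 'l set \<Rightarrow> 'g monoid" where
  "value_group v F = \<lparr>carrier = value_set v F, monoid.mult = (+), monoid.one = 0\<rparr>"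

definition val_ring :: "('l::field \<Rightarrow> 'g::linordered_ab_group_add) \<Rightarrow> 'l set \<Rightarrow> 'l ring" where
  "val_ring v F = ambient_field\<lparr>carrier := {x \<in> F. x = 0 \<or> 0 \<le> v x}\<rparr>"

definition val_ideal :: "('l::field \<Rightarrow> 'g::linordered_ab_group_add) \<Rightarrow> 'l set \<Rightarrow> 'l set" where
  "val_ideal v F = {x \<in> F. x = 0 \<or> 0 < v x}"

definition residue_field ::
    "('l::field \<Rightarrow> 'g::linordered_ab_group_add) \<Rightarrow> 'l set \<Rightarrow> 'l set ring" where
  "residue_field v F = val_ring v F Quot val_ideal v F"

text \<open>The image of \<open>Kv\<close> under the canonical embedding into \<open>Lv\<close>.\<close>

definition residue_subfield ::
    "('l::field \<Rightarrow> 'g::linordered_ab_group_add) \<Rightarrow> 'l set \<Rightarrow> 'l set set" where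
  "residue_subfield v K =
    (\<lambda>x. val_ideal v UNIV +>\<^bsub>val_ring v UNIV\<^esub> x) ` carrier (val_ring v K)"

text \<open>The library's \<open>ord\<close> is 0 for elements of infinite order.\<close>

definition ring_char :: "('a, 'm) ring_scheme \<Rightarrow> nat" where
  "ring_char R = group.ord (add_monoid R) \<one>\<^bsub>R\<^esub>"

definition field_degree :: "('a, 'm) ring_scheme \<Rightarrow> 'a set \<Rightarrow> nat" where
  "field_degree R F = ring.dim R F (carrier R)"

definition ramification_index ::
    "'l set \<Rightarrow> ('l::field \<Rightarrow> 'g::linordered_ab_group_add) \<Rightarrow> nat" where
  "ramification_index K v = card (rcosets\<^bsub>value_group v UNIV\<^esub> (value_set v K))"

definition inertia_degree ::
    "'l set \<Rightarrow> ('l::field \<Rightarrow> 'g::linordered_ab_group_add) \<Rightarrow> nat" where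
  "inertia_degree K v = field_degree (residue_field v UNIV) (residue_subfield v K)"

definition char_exponent ::
    "'l set \<Rightarrow> ('l::field \<Rightarrow> 'g::linordered_ab_group_add) \<Rightarrow> nat" where
  "char_exponent K v =
    (let c = ring_char (residue_field v K) in if c > 0 then c else 1)"

text \<open>Extensions of \<open>v\<close> from \<open>K\<close> to \<open>L\<close> may take values in ordered groups other than \<open>'g\<close>, and are
  identified if they are equivalent. They are therefore represented by their valuation rings: the
  valuation rings of \<open>L\<close> are the subrings \<open>V\<close> such that each nonzero \<open>x\<close> satisfies \<open>x \<in> V\<close> or
  \<open>1/x \<in> V\<close>, and the corresponding valuation restricts to (an equivalent of) \<open>v\<close> on \<open>K\<close> iff
  \<open>V\<close> meets \<open>K\<close> in the valuation ring of \<open>(K, v)\<close>.\<close>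

definition is_valuation_ring :: "'l::field set \<Rightarrow> bool" where
  "is_valuation_ring V \<longleftrightarrow>
    subring V ambient_field \<and> (\<forall>x. x \<noteq> 0 \<longrightarrow> x \<in> V \<or> inverse x \<in> V)"

definition unibranched :: "'l set \<Rightarrow> ('l::field \<Rightarrow> 'g::linordered_ab_group_add) \<Rightarrow> bool" where
  "unibranched K v \<longleftrightarrow>
    (\<forall>V. is_valuation_ring V \<and> V \<inter> K = carrier (val_ring v K)
       \<longrightarrow> V = carrier (val_ring v UNIV))"

definition finite_extension :: "'l::field set \<Rightarrow> bool" where
  "finite_extension K \<longleftrightarrow> ring.finite_dimension ambient_field K (UNIV :: 'l set)"

definition defect_extension ::
    "'l set \<Rightarrow> ('l::field \<Rightarrow> 'g::linordered_ab_group_add) \<Rightarrow> bool" where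
  "defect_extension K v \<longleftrightarrow>
    finite_extension K \<and> unibranched K v \<and>
    (\<exists>n::nat. field_degree (ambient_field :: 'l ring) K =
          char_exponent K v ^ n * ramification_index K v * inertia_degree K v
        \<and> char_exponent K v ^ n > 1)"

definition galois_group :: "'l::field set \<Rightarrow> ('l \<Rightarrow> 'l) set" where
  "galois_group K = {\<sigma> \<in> ring_iso ambient_field ambient_field. \<forall>x\<in>K. \<sigma> x = x}"

definition galois_extension :: "'l::field set \<Rightarrow> bool" where
  "galois_extension K \<longleftrightarrow>
    (\<forall>x::'l. \<not> ring.transcendental ambient_field K x) \<and>
    {x. \<forall>\<sigma>\<in>galois_group K. \<sigma> x = x} = K"


section \<open>Ramification ideals\<close>

definition final_segment :: "('l::field \<Rightarrow> 'g::linordered_ab_group_add) \<Rightarrow> 'g set \<Rightarrow> bool" where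
  "final_segment v S \<longleftrightarrow>
    S \<subseteq> {\<gamma> \<in> value_set v UNIV. 0 < \<gamma>} \<and>
    (\<forall>\<gamma>\<in>S. \<forall>\<delta>\<in>value_set v UNIV. \<gamma> \<le> \<delta> \<longrightarrow> \<delta> \<in> S)"

definition segment_ideal :: "('l::field \<Rightarrow> 'g::linordered_ab_group_add) \<Rightarrow> 'g set \<Rightarrow> 'l set" where
  "segment_ideal v S = {a. a \<noteq> 0 \<and> v a \<in> S} \<union> {0}"

definition ramification_subgroup ::
    "'l set \<Rightarrow> ('l::field \<Rightarrow> 'g::linordered_ab_group_add) \<Rightarrow> 'g set \<Rightarrow> ('l \<Rightarrow> 'l) set" where
  "ramification_subgroup K v S =
    {\<sigma> \<in> galois_group K. \<forall>b. b \<noteq> 0 \<longrightarrow> \<sigma> b - b = 0 \<or> v ((\<sigma> b - b) / b) \<in> S}"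

definition ramification_jump ::
    "'l set \<Rightarrow> ('l::field \<Rightarrow> 'g::linordered_ab_group_add) \<Rightarrow> 'g set \<Rightarrow> bool" where
  "ramification_jump K v S \<longleftrightarrow>
    final_segment v S \<and> S \<noteq> {} \<and>
    (\<forall>S'. final_segment v S' \<longrightarrow> S' \<subset> S \<longrightarrow>
       ramification_subgroup K v S' \<subset> ramification_subgroup K v S)"

definition ramification_ideal ::
    "'l set \<Rightarrow> ('l::field \<Rightarrow> 'g::linordered_ab_group_add) \<Rightarrow> 'l set \<Rightarrow> bool" where
  "ramification_ideal K v I \<longleftrightarrow> (\<exists>S. ramification_jump K v S \<and> I = segment_ideal v S)"

end

theory Submission
  imports Defs
begin

text \<open>Let \<open>v\<close> be the valuation and \<open>p\<close> the degree. As \<open>p\<close> is prime, the defect equals \<open>p\<close>, so \<open>L|K\<close> is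
immediate: \<open>vL = vK\<close> and \<open>Lv = Kv\<close>. Fix some \<open>a\<close> in \<open>L\<close> outside \<open>K\<close>. By
immediacy, there is no largest value \<open>v (a - c)\<close> with \<open>c \<in> K\<close>; say that something holds near \<open>a\<close> if
it holds for all \<open>c \<in> K\<close> with \<open>v (a - c)\<close> sufficiently large.

The heart of the matter is that a nonzero polynomial \<open>f\<close> over \<open>K\<close> of degree less than \<open>p\<close> has a
stable value: near \<open>a\<close>, \<open>v (f c) = v (f a)\<close>, and all higher terms of the Taylor expansion of \<open>f a\<close>
at \<open>c\<close> have larger value (\<open>stable_if_small_degree\<close>). By induction on the degree this may be used
for the derivative of \<open>f\<close>. It makes the linear term of the Taylor expansion dominate the other
nonconstant terms, and the only way in which \<open>f\<close> can fail to be stable is that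
\<open>v (f c) = v (f' a) + v (a - c)\<close> near \<open>a\<close>. Suppose that, and let \<open>n\<close> be the degree of \<open>f\<close>; \<open>n = 1\<close>
is impossible, as \<open>f a\<close> is then a multiple of \<open>a - c0\<close> for the zero \<open>c0 \<in> K\<close> of \<open>f\<close>, and near \<open>a\<close> the
value of \<open>a - c\<close> exceeds that of \<open>a - c0\<close>. So \<open>n \<ge> 2\<close>. The minimal polynomial \<open>g\<close> of \<open>a\<close> has an expansion
in powers of \<open>f\<close> whose coefficients have degree less than \<open>n\<close> and hence are stable. It yields
\<open>v (g c) = \<kappa> + i v (a - c)\<close> near \<open>a\<close> with a constant \<open>\<kappa>\<close> and some \<open>i \<le> p / n < p\<close>.
But \<open>v\<close> is invariant under the Galois group, so all \<open>p\<close> conjugates of \<open>a\<close> have the same distance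
from \<open>c\<close>, and \<open>v (g c) = p v (a - c)\<close>. The two are incompatible.

Consequently every element of \<open>\<O>_L\<close> is, for all \<open>c\<close> near \<open>a\<close>, a polynomial over \<open>\<O>_K\<close> in the unit
\<open>\<alpha> = (a - c) / d\<close>, where \<open>d \<in> K\<close> has the value of \<open>a - c\<close>: the ring \<open>\<O>_L\<close> is the directed
union of the rings \<open>\<O>_K[\<alpha>]\<close>. Everything else is a computation in these rings.

Ramification: the Galois group has prime order, so \<open>v (\<sigma> a - a)\<close> is one and the same value \<open>v e\<close>
for all \<open>\<sigma> \<noteq> id\<close>. Writing a unit \<open>b\<close> as a polynomial in \<open>\<alpha>\<close> shows that
\<open>v ((\<sigma> b - b) / b) \<ge> v e - v (a - c)\<close> for some \<open>c\<close>, with equality for \<open>b = a - c\<close>. Hence the only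
ramification jump is the final segment generated by the values \<open>v e - v (a - c)\<close>; the ideal \<open>I\<close> is
the union of the principal ideals generated by the elements \<open>e / d\<close>, and the power \<open>I^n\<close> is the
union of those generated by \<open>(e / d)^n\<close>.

Differentials: the minimal polynomial of \<open>\<alpha>\<close> lies in \<open>\<O>_K[X]\<close>, and its derivative at \<open>\<alpha>\<close>
has the value of \<open>(e / d)^(p - 1)\<close>. So the differentials of \<open>\<O>_K[\<alpha>]\<close>, extended to \<open>\<O>_L\<close>, are
generated by \<open>d\<alpha>\<close> with annihilator \<open>(e / d)^(p - 1) \<O>_L\<close>, and \<open>d\<alpha> \<mapsto> e / d\<close> identifies
them with \<open>(e / d) \<O>_L\<close> modulo \<open>(e / d)^p \<O>_L\<close>. In terms of \<open>a\<close> this map is differentiation with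
respect to \<open>a\<close> followed by multiplication by \<open>e\<close>, which does not involve \<open>c\<close>; in the union over
all \<open>c\<close> it becomes the isomorphism with \<open>I / I^p\<close>. In the formal proof that map is \<open>D\<close>. It is a
derivation modulo \<open>I^p\<close>, and its linear extension \<open>\<Phi>\<close> from the free module is onto \<open>I\<close> and maps into
\<open>I^p\<close> precisely the submodule of relations (\<open>kernel_in_relations\<close>).\<close>

section \<open>Polynomials with coefficients in a subring\<close>

definition poly_over :: "'a::field set \<Rightarrow> 'a poly \<Rightarrow> bool" where
  "poly_over A h \<longleftrightarrow> (\<forall>i. coeff h i \<in> A)"

lemma subring_ambientD:
  assumes "subring A ambient_field"
  shows "0 \<in> A" "1 \<in> A" "\<And>x y. x \<in> A \<Longrightarrow> y \<in> A \<Longrightarrow> x + y \<in> A"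
    "\<And>x y. x \<in> A \<Longrightarrow> y \<in> A \<Longrightarrow> x * y \<in> A" "\<And>x. x \<in> A \<Longrightarrow> - x \<in> A"
    "\<And>x y. x \<in> A \<Longrightarrow> y \<in> A \<Longrightarrow> x - y \<in> A"
proof -
  interpret cring "ambient_field :: 'a ring" by (rule cring_from_type_algebra)
  note A = subringE[OF assms]
  show "0 \<in> A" "1 \<in> A" and add: "\<And>x y. x \<in> A \<Longrightarrow> y \<in> A \<Longrightarrow> x + y \<in> A"
    and "\<And>x y. x \<in> A \<Longrightarrow> y \<in> A \<Longrightarrow> x * y \<in> A"
    using A(2,3,6,7) by (simp_all add: ring_of_type_algebra_def)
  show neg: "- x \<in> A" if "x \<in> A" for x
  proof -
    have "\<ominus>\<^bsub>ambient_field\<^esub> x = - x"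
      by (rule minus_equality) (simp_all add: ring_of_type_algebra_def)
    then show ?thesis using A(5)[OF that] by simp
  qed
  show "x - y \<in> A" if "x \<in> A" "y \<in> A" for x y
    using add[OF that(1) neg[OF that(2)]] by simp
qed

context
  fixes A :: "'a::field set"
  assumes A: "subring A ambient_field"
begin

lemmas closed = subring_ambientD[OF A]

lemma subring_sum: "(\<And>i. i \<in> I \<Longrightarrow> f i \<in> A) \<Longrightarrow> sum f I \<in> A"
  by (induction I rule: infinite_finite_induct) (auto intro: closed)

lemma subring_power: "x \<in> A \<Longrightarrow> x ^ n \<in> A"
  by (induction n) (auto intro: closed)

lemma subring_of_nat: "of_nat n \<in> A"
  by (induction n) (auto intro: closed)

lemma poly_over_0: "poly_over A 0"
  by (simp add: poly_over_def closed)

lemma poly_over_1: "poly_over A 1"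
  by (simp add: poly_over_def closed coeff_1)

lemma poly_over_pCons: "poly_over A (pCons x h) \<longleftrightarrow> x \<in> A \<and> poly_over A h"
  unfolding poly_over_def by (metis coeff_pCons_0 coeff_pCons_Suc not0_implies_Suc)

lemma poly_over_add: "poly_over A f \<Longrightarrow> poly_over A h \<Longrightarrow> poly_over A (f + h)"
  by (simp add: poly_over_def closed)

lemma poly_over_diff: "poly_over A f \<Longrightarrow> poly_over A h \<Longrightarrow> poly_over A (f - h)"
  by (simp add: poly_over_def closed)

lemma poly_over_mult: "poly_over A f \<Longrightarrow> poly_over A h \<Longrightarrow> poly_over A (f * h)"
  unfolding poly_over_def coeff_mult by (blast intro: subring_sum closed)

lemma poly_over_smult: "x \<in> A \<Longrightarrow> poly_over A h \<Longrightarrow> poly_over A (smult x h)"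
  by (simp add: poly_over_def closed)

lemma poly_over_monom: "x \<in> A \<Longrightarrow> poly_over A (Polynomial.monom x n)"
  by (simp add: poly_over_def closed)

lemma poly_over_prod: "(\<And>i. i \<in> I \<Longrightarrow> poly_over A (f i)) \<Longrightarrow> poly_over A (prod f I)"
  by (induction I rule: infinite_finite_induct) (auto intro: poly_over_mult poly_over_1)

lemma poly_over_pderiv: "poly_over A h \<Longrightarrow> poly_over A (pderiv h)"
  unfolding poly_over_def coeff_pderiv by (metis closed(4) subring_of_nat)

lemma poly_over_pcompose: "poly_over A f \<Longrightarrow> poly_over A h \<Longrightarrow> poly_over A (pcompose f h)"
  by (induction f)
     (auto simp: pcompose_pCons poly_over_pCons intro!: poly_over_add poly_over_mult closed poly_over_0)

lemma poly_over_eval: "poly_over A h \<Longrightarrow> x \<in> A \<Longrightarrow> poly h x \<in> A"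
  unfolding poly_over_def poly_altdef by (blast intro: subring_sum closed subring_power)

text \<open>Only the leading coefficient of the divisor has to be inverted, so this covers a subfield as well
as monic divisors over a valuation ring.\<close>
lemma poly_over_division:
  assumes "poly_over A g" "g \<noteq> 0" "inverse (lead_coeff g) \<in> A" "poly_over A h"
  shows "\<exists>q r. poly_over A q \<and> poly_over A r \<and> h = q * g + r \<and> (r = 0 \<or> degree r < degree g)"
  using assms(4)
proof (induction "degree h" arbitrary: h rule: less_induct)
  case less
  show ?case
  proof (cases "h = 0 \<or> degree h < degree g")
    case True
    then show ?thesis
      using less.prems by (intro exI[of _ 0] exI[of _ h]) (auto simp: poly_over_0)
  next
    case False
    define m where "m = Polynomial.monom (lead_coeff h * inverse (lead_coeff g)) (degree h - degree g)"
    have m: "poly_over A m"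
      unfolding m_def using less.prems assms(3) by (intro poly_over_monom closed) (auto simp: poly_over_def)
    have "m \<noteq> 0" using False assms(2) by (simp add: m_def)
    have dm: "degree (m * g) = degree h"
      using False assms(2) \<open>m \<noteq> 0\<close> by (simp add: degree_mult_eq m_def degree_monom_eq)
    have lc: "coeff (m * g) (degree h) = lead_coeff h"
    proof -
      have "coeff (m * g) (degree h) = lead_coeff m * lead_coeff g"
        unfolding dm[symmetric] by (rule lead_coeff_mult)
      also have "lead_coeff m = lead_coeff h * inverse (lead_coeff g)"
        unfolding m_def by (rule lead_coeff_monom)
      finally show ?thesis using assms(2) by simp
    qed
    show ?thesis
    proof (cases "h - m * g = 0")
      case True
      then show ?thesis
        using m by (intro exI[of _ m] exI[of _ 0]) (auto simp: poly_over_0)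
    next
      case nz: False
      have "degree (h - m * g) < degree h"
      proof (rule ccontr)
        assume "\<not> ?thesis"
        then have "degree (h - m * g) = degree h"
          using degree_diff_le_max[of h "m * g"] dm by simp
        then have "coeff (h - m * g) (degree h) = lead_coeff (h - m * g)" by simp
        moreover have "coeff (h - m * g) (degree h) = 0" using lc by simp
        ultimately show False using nz by (metis leading_coeff_0_iff)
      qed
      moreover have "poly_over A (h - m * g)"
        using less.prems m assms(1) by (intro poly_over_diff poly_over_mult)
      ultimately obtain q r where qr: "poly_over A q" "poly_over A r" "h - m * g = q * g + r"
        "r = 0 \<or> degree r < degree g" using less.hyps by blast
      then have "h = (q + m) * g + r" by (simp add: algebra_simps)
      then show ?thesis using qr m poly_over_add by blast
    qed
  qed
qed

lemma poly_over_div_mod: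
  assumes "poly_over A g" "g \<noteq> 0" "inverse (lead_coeff g) \<in> A" "poly_over A h"
  shows "poly_over A (h div g)" "poly_over A (h mod g)"
proof -
  obtain q r where qr: "poly_over A q" "poly_over A r" "h = q * g + r" "r = 0 \<or> degree r < degree g"
    using poly_over_division[OF assms] by blast
  have "h mod g = r" using qr(3,4) mod_poly_less[of r g] by (auto simp: mod_mult_self4)
  moreover from this qr(3) have "h div g * g = q * g"
    using div_mult_mod_eq[of h g] by (metis add_right_cancel)
  then have "h div g = q" using assms(2) by simp
  ultimately show "poly_over A (h div g)" "poly_over A (h mod g)" using qr by simp_all
qed

end

section \<open>Valuations\<close>

locale valuation =
  fixes v :: "'l::field \<Rightarrow> 'g::linordered_ab_group_add"
  assumes kv: "krull_valuation v"
begin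

text \<open>The value of 0 is left arbitrary, so bounds for values are stated by predicates that
admit 0, which plays the part of an element of infinite value.\<close>
definition val_ge :: "'g \<Rightarrow> 'l \<Rightarrow> bool" where "val_ge \<gamma> x \<longleftrightarrow> x = 0 \<or> \<gamma> \<le> v x"
definition val_gt :: "'g \<Rightarrow> 'l \<Rightarrow> bool" where "val_gt \<gamma> x \<longleftrightarrow> x = 0 \<or> \<gamma> < v x"

lemma v_mult: "x \<noteq> 0 \<Longrightarrow> y \<noteq> 0 \<Longrightarrow> v (x * y) = v x + v y"
  using kv unfolding krull_valuation_def by blast

lemma v_1 [simp]: "v 1 = 0"
  using v_mult[of 1 1] by simp

lemma double_zero: "x + x = (0::'g) \<Longrightarrow> x = 0"
  by (metis add_neg_neg add_pos_pos less_irrefl linorder_neqE)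

lemma v_neg1: "v (- 1) = 0"
  using v_mult[of "-1" "-1"] double_zero by simp

lemma v_minus [simp]: "v (- x) = v x"
  by (cases "x = 0") (use v_mult[of "-1" x] v_neg1 in auto)

lemma v_diff_commute: "v (x - y) = v (y - x)"
  using v_minus[of "x - y"] by simp

lemma v_inverse: "x \<noteq> 0 \<Longrightarrow> v (inverse x) = - v x"
  using v_mult[of x "inverse x"] by (simp add: eq_neg_iff_add_eq_0 add.commute)

lemma v_divide: "x \<noteq> 0 \<Longrightarrow> y \<noteq> 0 \<Longrightarrow> v (x / y) = v x - v y"
  by (simp add: divide_inverse v_mult v_inverse)

lemma v_power_cong: "x \<noteq> 0 \<Longrightarrow> y \<noteq> 0 \<Longrightarrow> v x = v y \<Longrightarrow> v (x ^ n) = v (y ^ n)"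
  by (induction n) (auto simp: v_mult)

lemma v_power_mono: "x \<noteq> 0 \<Longrightarrow> y \<noteq> 0 \<Longrightarrow> v x \<le> v y \<Longrightarrow> v (x ^ n) \<le> v (y ^ n)"
  by (induction n) (auto simp: v_mult add_mono)

lemma v_power_strict_mono:
  "x \<noteq> 0 \<Longrightarrow> y \<noteq> 0 \<Longrightarrow> v x < v y \<Longrightarrow> n > 0 \<Longrightarrow> v (x ^ n) < v (y ^ n)"
  using v_power_mono[of x y "n - 1"] by (cases n) (auto simp: v_mult add_less_le_mono)

lemma v_prod:
  "finite S \<Longrightarrow> (\<And>i. i \<in> S \<Longrightarrow> f i \<noteq> 0 \<and> v (f i) = v x) \<Longrightarrow> x \<noteq> 0 \<Longrightarrow> v (prod f S) = v (x ^ card S)"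
  by (induction S rule: finite_induct) (auto simp: v_mult)

lemma val_ge_0 [simp]: "val_ge \<gamma> 0" and val_gt_0 [simp]: "val_gt \<gamma> 0"
  by (simp_all add: val_ge_def val_gt_def)

lemma val_gt_imp_ge: "val_gt \<gamma> x \<Longrightarrow> val_ge \<gamma> x"
  by (auto simp: val_ge_def val_gt_def)

lemma val_ge_self [simp]: "val_ge (v x) x"
  by (simp add: val_ge_def)

lemma val_ge_trans: "val_ge \<gamma> x \<Longrightarrow> \<delta> \<le> \<gamma> \<Longrightarrow> val_ge \<delta> x"
  by (auto simp: val_ge_def)

lemma v_add: "x \<noteq> 0 \<Longrightarrow> y \<noteq> 0 \<Longrightarrow> x + y \<noteq> 0 \<Longrightarrow> min (v x) (v y) \<le> v (x + y)"
  using kv unfolding krull_valuation_def by blast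

lemma val_ge_add: "val_ge \<gamma> x \<Longrightarrow> val_ge \<gamma> y \<Longrightarrow> val_ge \<gamma> (x + y)"
  using v_add[of x y] by (cases "x = 0"; cases "y = 0"; cases "x + y = 0") (auto simp: val_ge_def min_def split: if_splits)

lemma val_gt_add: "val_gt \<gamma> x \<Longrightarrow> val_gt \<gamma> y \<Longrightarrow> val_gt \<gamma> (x + y)"
  using v_add[of x y] by (cases "x = 0"; cases "y = 0"; cases "x + y = 0") (auto simp: val_gt_def min_def split: if_splits)

lemma val_ge_minus [simp]: "val_ge \<gamma> (- x) \<longleftrightarrow> val_ge \<gamma> x"
  by (simp add: val_ge_def)

lemma val_gt_minus [simp]: "val_gt \<gamma> (- x) \<longleftrightarrow> val_gt \<gamma> x"
  by (simp add: val_gt_def)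

lemma val_ge_diff: "val_ge \<gamma> x \<Longrightarrow> val_ge \<gamma> y \<Longrightarrow> val_ge \<gamma> (x - y)"
  using val_ge_add[of \<gamma> x "- y"] by simp

lemma val_gt_sum: "(\<And>i. i \<in> I \<Longrightarrow> val_gt \<gamma> (f i)) \<Longrightarrow> val_gt \<gamma> (sum f I)"
  by (induction I rule: infinite_finite_induct) (auto intro: val_gt_add)

lemma val_ge_mult: "val_ge \<gamma> x \<Longrightarrow> val_ge \<delta> y \<Longrightarrow> val_ge (\<gamma> + \<delta>) (x * y)"
  by (cases "x = 0"; cases "y = 0"; simp add: val_ge_def v_mult add_mono)

lemma val_ge_cancel: "y \<noteq> 0 \<Longrightarrow> val_ge (\<gamma> + v y) (x * y) \<longleftrightarrow> val_ge \<gamma> x"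
  by (cases "x = 0"; simp add: val_ge_def v_mult)

lemma val_ge_of_nat: "val_ge 0 (of_nat n)"
  by (induction n) (auto intro: val_ge_add simp: val_ge_def[of _ 1])

lemma v_add_dominant:
  assumes "x \<noteq> 0" "val_gt (v x) y"
  shows "x + y \<noteq> 0" "v (x + y) = v x"
proof -
  show nz: "x + y \<noteq> 0"
    using assms by (auto simp: val_gt_def add_eq_0_iff)
  have "val_ge (v x) (x + y)"
    using assms(2) by (intro val_ge_add val_ge_self val_gt_imp_ge)
  moreover have "\<not> v x < v (x + y)"
  proof
    assume "v x < v (x + y)"
    then have "val_gt (v x) (x + y + (- y))"
      using assms by (intro val_gt_add[of _ "x + y" "- y"]) (simp_all add: val_gt_def)
    then show False using assms(1) by (simp add: val_gt_def)
  qed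
  ultimately show "v (x + y) = v x" using nz by (auto simp: val_ge_def)
qed

lemma subring_val_ring: "subring {x. val_ge 0 x} ambient_field"
proof -
  interpret cring "ambient_field :: 'l ring" by (rule cring_from_type_algebra)
  have neg: "\<ominus>\<^bsub>ambient_field\<^esub> x = - x" for x :: 'l
    by (rule minus_equality) (simp_all add: ring_of_type_algebra_def)
  show ?thesis
    using val_ge_mult[of 0 _ 0]
    by (intro subringI; simp only: neg mem_Collect_eq)
       (auto simp: ring_of_type_algebra_def val_ge_def[of _ 1] intro: val_ge_add)
qed

end


section \<open>Values of polynomials near a generator of an immediate extension\<close>

lemma subfield_ambientD:
  assumes "subfield K ambient_field"
  shows "subring K ambient_field" "\<And>x. x \<in> K \<Longrightarrow> inverse x \<in> K"
    "\<And>x y. x \<in> K \<Longrightarrow> y \<in> K \<Longrightarrow> x / y \<in> K"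
proof -
  interpret Field: field "ambient_field :: 'a ring" by (rule field_from_type_algebra)
  show sub: "subring K ambient_field" using subfieldE(1)[OF assms] .
  show inv: "inverse x \<in> K" if "x \<in> K" for x
  proof (cases "x = 0")
    case False
    then have "inv\<^bsub>ambient_field\<^esub> x \<in> K"
      using Field.subfield_m_inv(1)[OF assms] that by (simp add: ring_of_type_algebra_def)
    moreover have "inv\<^bsub>ambient_field\<^esub> x = inverse x"
      using False by (intro Field.comm_inv_char) (simp_all add: ring_of_type_algebra_def)
    ultimately show ?thesis by simp
  qed (use that in simp)
  show "x / y \<in> K" if "x \<in> K" "y \<in> K" for x y
    using subring_ambientD(4)[OF sub that(1) inv[OF that(2)]] by (simp add: divide_inverse)
qed

text \<open>An immediate extension together with an element \<open>a\<close> of degree at least \<open>p\<close> outside \<open>K\<close>. The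
polynomial \<open>g\<close> stands for the minimal polynomial of \<open>a\<close>; its values on \<open>K\<close> are as they must be if all
conjugates of \<open>a\<close> have the same distance from each \<open>c \<in> K\<close>. The assumption on \<open>of_nat n\<close> says that the residue
characteristic is 0 or at least \<open>p\<close>.\<close>
locale immediate_generator = valuation v
  for v :: "'l::field \<Rightarrow> 'g::linordered_ab_group_add" +
  fixes K :: "'l set" and p :: nat and a :: 'l and g :: "'l poly"
  assumes K: "subfield K ambient_field"
    and v_of_nat: "0 < n \<Longrightarrow> n < p \<Longrightarrow> of_nat n \<noteq> (0::'l) \<and> v (of_nat n) = 0"
    and same_values: "x \<noteq> 0 \<Longrightarrow> \<exists>k\<in>K. k \<noteq> 0 \<and> v k = v x"
    and same_residues: "x \<noteq> 0 \<Longrightarrow> v x = 0 \<Longrightarrow> \<exists>k\<in>K. val_gt 0 (x - k)"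
    and a_notin_K: "a \<notin> K"
    and no_small_root: "poly_over K h \<Longrightarrow> h \<noteq> 0 \<Longrightarrow> degree h < p \<Longrightarrow> poly h a \<noteq> 0"
    and g_over_K: "poly_over K g"
    and g_monic: "lead_coeff g = 1"
    and g_degree: "degree g = p"
    and g_value: "c \<in> K \<Longrightarrow> poly g c \<noteq> 0 \<and> v (poly g c) = v ((a - c) ^ p)"
begin

lemmas subring_K = subfield_ambientD(1)[OF K]
lemmas K_closed = subring_ambientD[OF subring_K] subfield_ambientD(2,3)[OF K]

text \<open>The values \<open>v (a - c)\<close> have no largest element, so they behave like a limit in which \<open>c\<close> tends to
\<open>a\<close>; with a filter, finitely many such conditions can be imposed at once.\<close>
definition near_a :: "'l filter" where
  "near_a = (INF c0\<in>K. principal {c\<in>K. v (a - c0) \<le> v (a - c)})"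

lemma a_minus_nz: "c \<in> K \<Longrightarrow> a - c \<noteq> 0"
  using a_notin_K by auto

lemma a_neq: "c \<in> K \<Longrightarrow> a \<noteq> c" "c \<in> K \<Longrightarrow> c \<noteq> a"
  using a_notin_K by auto

lemma eventually_near_a:
  "eventually P near_a \<longleftrightarrow> (\<exists>c0\<in>K. \<forall>c\<in>K. v (a - c0) \<le> v (a - c) \<longrightarrow> P c)"
  unfolding near_a_def
proof (subst eventually_INF_base)
  show "K \<noteq> {}" using K_closed(1) by blast
  show "\<exists>x\<in>K. principal {c \<in> K. v (a - x) \<le> v (a - c)}
      \<le> inf (principal {c \<in> K. v (a - c1) \<le> v (a - c)}) (principal {c \<in> K. v (a - c2) \<le> v (a - c)})"
    if "c1 \<in> K" "c2 \<in> K" for c1 c2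
  proof (cases "v (a - c1) \<le> v (a - c2)")
    case True
    then show ?thesis by (intro bexI[OF _ that(2)]) (auto intro: order_trans)
  next
    case False
    then have "v (a - c2) \<le> v (a - c1)" by simp
    then show ?thesis by (intro bexI[OF _ that(1)]) (auto intro: order_trans)
  qed
qed (auto simp: eventually_principal)

text \<open>Where immediacy enters: scale \<open>a - c\<close> to a unit by an element of \<open>K\<close> of the same value, then remove
the residue of that unit by subtracting another element of \<open>K\<close>.\<close>
lemma no_closest:
  assumes "c \<in> K"
  obtains c' where "c' \<in> K" "v (a - c) < v (a - c')"
proof -
  note nz = a_minus_nz[OF assms]
  obtain k where k: "k \<in> K" "k \<noteq> 0" "v k = v (a - c)"
    using same_values[OF nz] by blast
  obtain u where u: "u \<in> K" "val_gt 0 ((a - c) / k - u)"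
    using same_residues[of "(a - c) / k"] nz k by (auto simp: v_divide)
  have c': "c + k * u \<in> K"
    using assms k u by (intro K_closed)
  have eq: "a - (c + k * u) = k * ((a - c) / k - u)"
    using k by (simp add: field_simps)
  have "(a - c) / k - u \<noteq> 0"
    using a_minus_nz[OF c'] eq by auto
  then have "v (a - c) < v (a - (c + k * u))"
    using u k unfolding eq by (simp add: v_mult val_gt_def)
  with c' show thesis by (rule that)
qed

lemma near_a_not_bot: "near_a \<noteq> bot"
  unfolding trivial_limit_def eventually_near_a by auto

lemma eventually_in_K: "eventually (\<lambda>c. c \<in> K) near_a"
  unfolding eventually_near_a using K_closed(1) by blast

lemma eventually_closer:
  assumes "c0 \<in> K"
  shows "eventually (\<lambda>c. v (a - c0) < v (a - c)) near_a"
proof -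
  obtain c' where "c' \<in> K" "v (a - c0) < v (a - c')" using no_closest[OF assms] .
  then show ?thesis unfolding eventually_near_a by (auto intro!: bexI[of _ c'])
qed

lemma near_a_not_constant:
  assumes "i > 0"
  shows "\<not> eventually (\<lambda>c. v ((a - c) ^ i) = \<gamma>) near_a"
proof
  assume "eventually (\<lambda>c. v ((a - c) ^ i) = \<gamma>) near_a"
  then obtain c0 where c0: "c0 \<in> K" "\<forall>c\<in>K. v (a - c0) \<le> v (a - c) \<longrightarrow> v ((a - c) ^ i) = \<gamma>"
    unfolding eventually_near_a by blast
  obtain c' where "c' \<in> K" "v (a - c0) < v (a - c')" using no_closest[OF c0(1)] .
  with c0 v_power_strict_mono[of "a - c0" "a - c'" i] assms show False
    by (simp add: a_neq)
qed

text \<open>A value that is not exceeded by \<open>v k + i v (a - c)\<close> for any \<open>c\<close> is not even attained, since these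
values have no largest element.\<close>
lemma eventually_less_or_greater:
  assumes "x \<noteq> 0" "k \<noteq> 0" "i > 0"
  shows "eventually (\<lambda>c. v x < v (k * (a - c) ^ i)) near_a \<or>
         eventually (\<lambda>c. v (k * (a - c) ^ i) < v x) near_a"
proof (cases "\<exists>c1\<in>K. v x < v (k * (a - c1) ^ i)")
  case True
  then obtain c1 where c1: "c1 \<in> K" "v x < v (k * (a - c1) ^ i)" by blast
  have "eventually (\<lambda>c. v x < v (k * (a - c) ^ i)) near_a"
    using eventually_closer[OF c1(1)] eventually_in_K
  proof eventually_elim
    case (elim c)
    then have "v ((a - c1) ^ i) < v ((a - c) ^ i)"
      using c1 assms by (intro v_power_strict_mono) (auto simp: a_neq)
    then have "v (k * (a - c1) ^ i) < v (k * (a - c) ^ i)"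
      using c1 assms elim by (auto simp: v_mult a_neq)
    with c1(2) show ?case by (rule order.strict_trans)
  qed
  then show ?thesis ..
next
  case False
  have "eventually (\<lambda>c. v (k * (a - c) ^ i) < v x) near_a"
    using eventually_in_K
  proof eventually_elim
    case (elim c)
    obtain c' where c': "c' \<in> K" "v (a - c) < v (a - c')" using no_closest[OF elim] .
    then have "v ((a - c) ^ i) < v ((a - c') ^ i)"
      using elim assms by (intro v_power_strict_mono) (auto simp: a_neq)
    then have "v (k * (a - c) ^ i) < v (k * (a - c') ^ i)"
      using elim c' assms by (auto simp: v_mult a_neq)
    then show ?case using False c' by fastforce
  qed
  then show ?thesis ..
qed

text \<open>The coefficient with index \<open>i\<close> of \<open>f \<circ>\<^sub>p [:c, 1:]\<close> is the \<open>i\<close>-th Taylor coefficient of \<open>f\<close>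
at \<open>c\<close>, that is \<open>1 / i!\<close> times the derivative of order \<open>i\<close> wherever \<open>i!\<close> can be inverted.\<close>
definition stable :: "'l poly \<Rightarrow> bool" where
  "stable f \<longleftrightarrow> eventually (\<lambda>c. poly f c \<noteq> 0 \<and> v (poly f c) = v (poly f a) \<and>
     (\<forall>i\<ge>1. val_gt (v (poly f a)) (coeff (f \<circ>\<^sub>p [:c, 1:]) i * (a - c) ^ i))) near_a"

lemma stable_constant_value:
  "stable f \<Longrightarrow> eventually (\<lambda>c. poly f c \<noteq> 0 \<and> v (poly f c) = v (poly f a)) near_a"
  unfolding stable_def by (rule eventually_mono, assumption) simp

lemma taylor:
  "poly f a - poly f c = (\<Sum>i=1..degree f. coeff (f \<circ>\<^sub>p [:c, 1:]) i * (a - c) ^ i)"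
proof -
  let ?t = "f \<circ>\<^sub>p [:c, 1:]"
  have "poly f a = poly ?t (a - c)" by (simp add: poly_pcompose)
  also have "\<dots> = (\<Sum>i\<le>degree f. coeff ?t i * (a - c) ^ i)"
    by (simp add: poly_altdef degree_pcompose)
  also have "\<dots> = coeff ?t 0 + (\<Sum>i=1..degree f. coeff ?t i * (a - c) ^ i)"
    by (simp add: sum.atMost_shift sum.atLeast1_atMost_eq lessThan_Suc_atMost)
  also have "coeff ?t 0 = poly f c"
    using poly_pcompose[of f "[:c, 1:]" 0] by (simp add: poly_0_coeff_0)
  finally show ?thesis by simp
qed

lemma coeff_taylor_pderiv:
  "coeff (pderiv f \<circ>\<^sub>p [:c, 1:]) i = of_nat (Suc i) * coeff (f \<circ>\<^sub>p [:c, 1:]) (Suc i)"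
  using coeff_pderiv[of "f \<circ>\<^sub>p [:c, 1:]" i] by (simp add: pderiv_pcompose pderiv_pCons)

text \<open>The Taylor coefficients of the derivative are those of \<open>f\<close> multiplied by \<open>i\<close>, and \<open>i\<close> is a unit for
\<open>0 < i < p\<close>. Stability of the derivative therefore bounds the terms of index at least 2 in the
expansion of \<open>f\<close> from below by the linear term.\<close>
lemma linear_term_dominates:
  assumes f: "0 < degree f" "degree f < p" and f': "stable (pderiv f)" "poly (pderiv f) a \<noteq> 0"
  shows "eventually (\<lambda>c. poly f a \<noteq> poly f c \<and> v (poly f a - poly f c) = v (poly (pderiv f) a * (a - c)) \<and>
    (\<forall>i\<ge>1. val_ge (v (poly (pderiv f) a * (a - c))) (coeff (f \<circ>\<^sub>p [:c, 1:]) i * (a - c) ^ i))) near_a"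
  using f'(1)[unfolded stable_def] eventually_in_K
proof eventually_elim
  case (elim c)
  let ?t = "coeff (f \<circ>\<^sub>p [:c, 1:])" and ?d = "poly (pderiv f) a"
  note nz = a_minus_nz[OF elim(2)]
  have t1: "?t 1 = poly (pderiv f) c"
    using coeff_taylor_pderiv[of f c 0] poly_pcompose[of "pderiv f" "[:c, 1:]" 0]
    by (simp add: poly_0_coeff_0)
  have first: "?t 1 \<noteq> 0" "v (?t 1 * (a - c)) = v (?d * (a - c))"
    using elim(1) nz f'(2) t1 by (auto simp: v_mult)
  have higher: "val_gt (v (?d * (a - c))) (?t i * (a - c) ^ i)" if "i \<ge> 2" for i
  proof (cases "?t i = 0")
    case False
    define j where "j = i - 1"
    have ij: "i = Suc j" "j \<ge> 1" using that by (auto simp: j_def)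
    have "i \<le> degree f"
      using False le_degree[of "f \<circ>\<^sub>p [:c, 1:]" i] by (simp add: degree_pcompose)
    then have i: "of_nat i \<noteq> (0::'l)" "v (of_nat i) = 0"
      using v_of_nat[of i] f that by auto
    have "val_gt (v ?d) (of_nat i * ?t i * (a - c) ^ j)"
      using elim(1) ij(2) unfolding coeff_taylor_pderiv[of f c j, symmetric, folded ij(1)] by blast
    then have "v ?d < v (?t i * (a - c) ^ j)"
      using i False nz by (simp add: val_gt_def v_mult mult.assoc)
    then show ?thesis
      using ij nz f'(2) False by (simp add: val_gt_def v_mult add.commute)
  qed simp
  have split: "poly f a - poly f c = ?t 1 * (a - c) + (\<Sum>i=2..degree f. ?t i * (a - c) ^ i)"
    using f(1) taylor[of f c] by (simp add: sum.atLeast_Suc_atMost numeral_2_eq_2)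
  have tail: "val_gt (v (?t 1 * (a - c))) (\<Sum>i=2..degree f. ?t i * (a - c) ^ i)"
    unfolding first(2) using higher by (intro val_gt_sum) auto
  have "val_ge (v (?d * (a - c))) (?t i * (a - c) ^ i)" if "i \<ge> 1" for i
  proof (cases "i = 1")
    case True
    then show ?thesis using first(2) by (simp add: val_ge_def)
  qed (use that higher[of i] val_gt_imp_ge in auto)
  with v_add_dominant[OF _ tail] first nz show ?case
    unfolding split[symmetric] by auto
qed

text \<open>The expansion of \<open>h\<close> in powers of \<open>f\<close>, digit by digit: each division by \<open>f\<close> adds a digit of degree
less than that of \<open>f\<close>, hence of constant value near \<open>a\<close>, and each factor \<open>f\<close> adds \<open>v (a - c)\<close> up to
a constant. Of two summands whose values grow at different rates, one dominates near \<open>a\<close>.\<close>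
lemma expansion_growth:
  assumes f: "poly_over K f" "0 < degree f" and e: "e \<noteq> 0"
    and smaller: "\<And>r. poly_over K r \<Longrightarrow> r \<noteq> 0 \<Longrightarrow> degree r < degree f \<Longrightarrow> poly r a \<noteq> 0 \<and> stable r"
    and growth: "eventually (\<lambda>c. poly f c \<noteq> 0 \<and> v (poly f c) = v (e * (a - c))) near_a"
    and h: "poly_over K h" "h \<noteq> 0"
  shows "\<exists>k i. k \<noteq> 0 \<and> i * degree f \<le> degree h \<and>
    eventually (\<lambda>c. poly h c \<noteq> 0 \<and> v (poly h c) = v (k * (a - c) ^ i)) near_a"
  using h
proof (induction "degree h" arbitrary: h rule: less_induct)
  case less
  show ?case
  proof (cases "degree h < degree f")
    case True
    with smaller[OF less.prems] stable_constant_value[of h] show ?thesis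
      by (intro exI[of _ "poly h a"] exI[of _ 0]) auto
  next
    case False
    define q r where "q = h div f" and "r = h mod f"
    have f0: "f \<noteq> 0" using f by auto
    have "inverse (lead_coeff f) \<in> K"
      using f(1) by (auto simp: poly_over_def intro: K_closed)
    note qr = poly_over_div_mod[OF subring_K f(1) f0 this less.prems(1), folded q_def r_def]
    have hqr: "h = q * f + r" by (simp add: q_def r_def)
    have r: "r = 0 \<or> degree r < degree f" using f0 by (auto simp: r_def degree_mod_less)
    have q0: "q \<noteq> 0"
    proof
      assume "q = 0"
      then have "h = r" using hqr by simp
      then show False using r less.prems(2) False by auto
    qed
    have "degree r < degree (q * f)" if "r \<noteq> 0"
      using r that q0 f0 by (auto simp: degree_mult_eq)
    then have dq: "degree h = degree q + degree f"
      using q0 f0 unfolding hqr by (cases "r = 0") (auto simp: degree_mult_eq degree_add_eq_left)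
    obtain k i where ki: "k \<noteq> 0" "i * degree f \<le> degree q"
      "eventually (\<lambda>c. poly q c \<noteq> 0 \<and> v (poly q c) = v (k * (a - c) ^ i)) near_a"
      using less.hyps[of q] dq f(2) qr q0 by auto
    have qf: "eventually (\<lambda>c. poly (q * f) c \<noteq> 0 \<and> v (poly (q * f) c) = v (k * e * (a - c) ^ Suc i)) near_a"
      using ki(3) growth eventually_in_K
      by eventually_elim (use ki(1) e in \<open>auto simp: v_mult a_neq add_ac\<close>)
    have bound: "Suc i * degree f \<le> degree h" using ki(2) dq by simp
    show ?thesis
    proof (cases "r = 0")
      case True
      then show ?thesis
        using qf hqr bound ki(1) e by (intro exI[of _ "k * e"] exI[of _ "Suc i"]) auto
    next
      case False
      with smaller[OF qr(2) False] r have ra: "poly r a \<noteq> 0" and "stable r" by auto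
      note rc = stable_constant_value[OF \<open>stable r\<close>]
      consider "eventually (\<lambda>c. v (poly r a) < v (k * e * (a - c) ^ Suc i)) near_a"
        | "eventually (\<lambda>c. v (k * e * (a - c) ^ Suc i) < v (poly r a)) near_a"
        using eventually_less_or_greater[OF ra, of "k * e" "Suc i"] ki(1) e by auto
      then show ?thesis
      proof cases
        case 1
        have "eventually (\<lambda>c. poly h c \<noteq> 0 \<and> v (poly h c) = v (poly r a * (a - c) ^ 0)) near_a"
          using 1 qf rc
        proof eventually_elim
          case (elim c)
          then have "val_gt (v (poly r c)) (poly (q * f) c)" by (simp add: val_gt_def)
          from v_add_dominant[OF _ this] elim show ?case by (simp add: hqr add.commute)
        qed
        then show ?thesis using ra by (intro exI[of _ "poly r a"] exI[of _ 0]) auto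
      next
        case 2
        have "eventually (\<lambda>c. poly h c \<noteq> 0 \<and> v (poly h c) = v (k * e * (a - c) ^ Suc i)) near_a"
          using 2 qf rc
        proof eventually_elim
          case (elim c)
          then have "val_gt (v (poly (q * f) c)) (poly r c)" by (simp add: val_gt_def)
          from v_add_dominant[OF _ this] elim show ?case by (simp add: hqr)
        qed
        then show ?thesis
          using bound ki(1) e by (intro exI[of _ "k * e"] exI[of _ "Suc i"]) auto
      qed
    qed
  qed
qed

text \<open>If \<open>f\<close> is not stable, then \<open>f c\<close> has the value of its linear term, so the values of \<open>f\<close> grow like
\<open>v (a - c)\<close>. In degree 1 this contradicts that no element of \<open>K\<close> is closest to \<open>a\<close>. In degree at
least 2 it makes the values of \<open>g\<close> on \<open>K\<close> grow like \<open>i v (a - c)\<close> for some \<open>i < p\<close>, whereas they are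
exactly \<open>p v (a - c)\<close>.\<close>
theorem stable_if_small_degree:
  assumes "poly_over K f" "f \<noteq> 0" "degree f < p"
  shows "stable f"
  using assms
proof (induction "degree f" arbitrary: f rule: less_induct)
  case less
  show ?case
  proof (cases "degree f = 0")
    case True
    then obtain k where "f = [:k:]" by (metis degree_eq_zeroE)
    then have "poly f c \<noteq> 0 \<and> v (poly f c) = v (poly f a) \<and>
        (\<forall>i\<ge>1. val_gt (v (poly f a)) (coeff (f \<circ>\<^sub>p [:c, 1:]) i * (a - c) ^ i))" for c
      using less.prems(2) by (auto simp: coeff_pCons split: nat.split)
    then show ?thesis unfolding stable_def by simp
  next
    case False
    define n where "n = degree f"
    have n: "0 < n" "n < p" using False less.prems by (auto simp: n_def)
    have "coeff (pderiv f) (n - 1) \<noteq> 0"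
      using n v_of_nat[of n] less.prems(2) by (simp add: coeff_pderiv n_def)
    then have f'0: "pderiv f \<noteq> 0" by auto
    have f'K: "poly_over K (pderiv f)" by (rule poly_over_pderiv[OF subring_K less.prems(1)])
    have f'd: "degree (pderiv f) < n"
      using n by (intro degree_lessI) (auto simp: coeff_pderiv n_def coeff_eq_0)
    define e where "e = poly (pderiv f) a"
    have e: "e \<noteq> 0" unfolding e_def using no_small_root[OF f'K f'0] f'd n by simp
    have "stable (pderiv f)" using less.hyps[of "pderiv f"] f'K f'0 f'd n by (simp add: n_def)
    then have lin: "eventually (\<lambda>c. poly f a \<noteq> poly f c \<and> v (poly f a - poly f c) = v (e * (a - c)) \<and>
      (\<forall>i\<ge>1. val_ge (v (e * (a - c))) (coeff (f \<circ>\<^sub>p [:c, 1:]) i * (a - c) ^ i))) near_a"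
      using linear_term_dominates[of f] n e unfolding n_def e_def by auto
    have fa: "poly f a \<noteq> 0" using no_small_root less.prems by blast
    consider "eventually (\<lambda>c. v (poly f a) < v (e * (a - c))) near_a"
      | "eventually (\<lambda>c. v (e * (a - c)) < v (poly f a)) near_a"
      using eventually_less_or_greater[OF fa e, of 1] by auto
    then show ?thesis
    proof cases
      case 1
      show ?thesis unfolding stable_def using lin 1
      proof eventually_elim
        case (elim c)
        then have "val_gt (v (poly f a)) (- (poly f a - poly f c))" 
          unfolding val_gt_minus by (simp add: val_gt_def)
        from v_add_dominant[OF fa this] elim show ?case
          by (auto simp: val_gt_def val_ge_def)
      qed
    next
      case 2
      have growth: "eventually (\<lambda>c. poly f c \<noteq> 0 \<and> v (poly f c) = v (e * (a - c))) near_a"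
        using lin 2
      proof eventually_elim
        case (elim c)
        then have "val_gt (v (poly f c - poly f a)) (poly f a)"
          by (simp add: val_gt_def v_diff_commute)
        moreover have "poly f c - poly f a \<noteq> 0" using elim by auto
        ultimately show ?case
          using v_add_dominant[of "poly f c - poly f a" "poly f a"] elim
          by (simp add: v_diff_commute[of "poly f c"])
      qed
      \<comment> \<open>The zero of a linear polynomial lies in \<open>K\<close>, and \<open>v (e * (a - c)) < v (poly f a)\<close> fails for \<open>c\<close> closer to \<open>a\<close> than it.\<close>
      have "n \<noteq> 1"
      proof
        assume "n = 1"
        then obtain f0 f1 where f01: "f = [:f0, f1:]" "f1 \<noteq> 0"
          using degree1_coeffs[of f] unfolding n_def by metis
        then have K01: "f0 \<in> K" "f1 \<in> K"
          using less.prems(1) by (simp_all add: poly_over_pCons[OF subring_K])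
        then have c: "- f0 / f1 \<in> K" by (intro K_closed)
        have "e = f1" by (simp add: e_def f01 pderiv_pCons)
        have "f1 * (a - - f0 / f1) = poly f a" using f01 by (simp add: field_simps)
        then have fa_val: "v (poly f a) = v e + v (a - - f0 / f1)"
          using v_mult[OF f01(2) a_minus_nz[OF c]] \<open>e = f1\<close> by metis
        have "eventually (\<lambda>c. False) near_a"
          using 2 eventually_closer[OF c] eventually_in_K
        proof eventually_elim
          case (elim c')
          then show ?case using fa_val e a_minus_nz[OF elim(3)] by (simp add: v_mult)
        qed
        then show False using near_a_not_bot by (simp add: trivial_limit_def)
      qed
      then have "n \<ge> 2" using n by linarith
      have smaller: "poly r a \<noteq> 0 \<and> stable r"
        if "poly_over K r" "r \<noteq> 0" "degree r < degree f" for r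
        using no_small_root[of r] less.hyps[of r] that less.prems(3) by auto
      have "g \<noteq> 0" using g_monic by auto
      then obtain k i where ki: "k \<noteq> 0" "i * n \<le> p"
        "eventually (\<lambda>c. poly g c \<noteq> 0 \<and> v (poly g c) = v (k * (a - c) ^ i)) near_a"
        using expansion_growth[OF less.prems(1) _ e smaller growth g_over_K] n g_degree
        unfolding n_def by blast
      have "i < p"
      proof -
        have "i * 2 \<le> i * n" using \<open>n \<ge> 2\<close> by simp
        then show ?thesis using ki(2) n by linarith
      qed
      have "eventually (\<lambda>c. v ((a - c) ^ (p - i)) = v k) near_a"
        using ki(3) eventually_in_K
      proof eventually_elim
        case (elim c)
        note nz = a_minus_nz[OF elim(2)]
        have "v ((a - c) ^ (p - i) * (a - c) ^ i) = v (k * (a - c) ^ i)"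
          using elim g_value[of c] \<open>i < p\<close> by (simp flip: power_add)
        then show ?case using nz ki(1) by (simp add: v_mult)
      qed
      then show ?thesis using near_a_not_constant[of "p - i"] \<open>i < p\<close> by simp
    qed
  qed
qed

end


section \<open>Valuation rings and residue fields\<close>

lemma field_ambient: "field (ambient_field :: 'l::field ring)"
  by (rule field_from_type_algebra)

lemma ambient_simps [simp]:
  "carrier ambient_field = UNIV" "x \<oplus>\<^bsub>ambient_field\<^esub> y = x + y" "x \<otimes>\<^bsub>ambient_field\<^esub> y = x * y"
  "\<zero>\<^bsub>ambient_field\<^esub> = 0" "\<one>\<^bsub>ambient_field\<^esub> = 1"
  by (simp_all add: ring_of_type_algebra_def)

lemma ambient_pow [simp]: "x [^]\<^bsub>ambient_field\<^esub> (n::nat) = x ^ n"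
proof -
  interpret field "ambient_field :: 'a ring" by (rule field_ambient)
  show ?thesis by (induction n) (simp_all add: mult.commute)
qed

lemma ambient_combine:
  "ring.combine ambient_field Ks Us = sum_list (map2 (*) Ks Us)"
proof -
  interpret field "ambient_field :: 'a ring" by (rule field_ambient)
  show ?thesis by (induction Ks Us rule: combine.induct) simp_all
qed

context valuation
begin

lemma val_ring_simps [simp]:
  "x \<oplus>\<^bsub>val_ring v F\<^esub> y = x + y" "x \<otimes>\<^bsub>val_ring v F\<^esub> y = x * y"
  "\<zero>\<^bsub>val_ring v F\<^esub> = 0" "\<one>\<^bsub>val_ring v F\<^esub> = 1"
  "carrier (val_ring v F) = {x\<in>F. val_ge 0 x}"
  by (simp_all add: val_ring_def val_ge_def ring_of_type_algebra_def)

lemma val_ideal_eq: "val_ideal v F = {x\<in>F. val_gt 0 x}"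
  by (simp add: val_ideal_def val_gt_def)

lemma val_ge_1 [simp]: "val_ge 0 1" by (simp add: val_ge_def)

lemma val_ge_mult_0: "val_ge 0 x \<Longrightarrow> val_ge 0 y \<Longrightarrow> val_ge 0 (x * y)"
  using val_ge_mult[of 0 x 0 y] by simp

lemma val_gt_mult_0: "val_ge 0 x \<Longrightarrow> val_gt 0 y \<Longrightarrow> val_gt 0 (x * y)"
  by (cases "x = 0"; cases "y = 0"; simp add: val_ge_def val_gt_def v_mult add_nonneg_pos)

lemma val_gt_mult_0': "val_gt 0 y \<Longrightarrow> val_ge 0 x \<Longrightarrow> val_gt 0 (y * x)"
  using val_gt_mult_0[of x y] by (simp add: mult.commute)

lemma subring_val_ring_sub:
  assumes "subring F ambient_field"
  shows "subring {x\<in>F. val_ge 0 x} ambient_field"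
proof -
  interpret field "ambient_field :: 'l ring" by (rule field_ambient)
  show ?thesis using subring_inter[OF assms subring_val_ring] by (simp add: Int_def)
qed

context
  fixes F :: "'l set"
  assumes F: "subfield F ambient_field"
begin

lemmas F_closed = subring_ambientD[OF subfield_ambientD(1)[OF F]] subfield_ambientD(2,3)[OF F]

lemma cring_val_ring: "cring (val_ring v F)"
proof (rule cringI)
  show "abelian_group (val_ring v F)"
  proof (rule abelian_groupI)
    fix x assume "x \<in> carrier (val_ring v F)"
    then show "\<exists>y\<in>carrier (val_ring v F). y \<oplus>\<^bsub>val_ring v F\<^esub> x = \<zero>\<^bsub>val_ring v F\<^esub>"
      by (intro bexI[of _ "- x"]) (auto intro: F_closed)
  qed (auto intro: F_closed val_ge_add)
  show "Group.comm_monoid (val_ring v F)"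
    by (rule comm_monoidI) (auto intro: F_closed val_ge_mult_0)
qed (auto simp: algebra_simps)

lemma val_ring_minus: "x \<in> F \<Longrightarrow> val_ge 0 x \<Longrightarrow> \<ominus>\<^bsub>val_ring v F\<^esub> x = - x"
proof -
  interpret cring "val_ring v F" by (rule cring_val_ring)
  show "x \<in> F \<Longrightarrow> val_ge 0 x \<Longrightarrow> \<ominus>\<^bsub>val_ring v F\<^esub> x = - x"
    by (rule minus_equality) (auto intro: F_closed)
qed

lemma val_ideal_maximal: "maximalideal (val_ideal v F) (val_ring v F)"
proof -
  interpret R: cring "val_ring v F" by (rule cring_val_ring)
  have inv: "inv\<^bsub>add_monoid (val_ring v F)\<^esub> x = - x" if "x \<in> F" "val_ge 0 x" for x
    using val_ring_minus[OF that] by (simp add: a_inv_def)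
  have ideal: "ideal (val_ideal v F) (val_ring v F)"
  proof (rule idealI)
    show "subgroup (val_ideal v F) (add_monoid (val_ring v F))"
    proof (rule subgroup.intro)
      show "inv\<^bsub>add_monoid (val_ring v F)\<^esub> x \<in> val_ideal v F" if "x \<in> val_ideal v F" for x
        using that inv[of x] val_gt_imp_ge[of 0 x] by (auto simp: val_ideal_eq intro: F_closed)
    qed (auto simp: val_ideal_eq intro: F_closed val_gt_imp_ge val_gt_add)
  qed (auto simp: val_ideal_eq R.ring_axioms intro: F_closed val_gt_mult_0 val_gt_mult_0')
  show ?thesis
  proof (rule maximalidealI[OF ideal])
    show "carrier (val_ring v F) \<noteq> val_ideal v F"
      using F_closed(2) by (auto simp: val_ideal_eq val_gt_def dest!: equalityD1)
    fix J assume J: "ideal J (val_ring v F)" "val_ideal v F \<subseteq> J" "J \<subseteq> carrier (val_ring v F)"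
    interpret J: ideal J "val_ring v F" by (rule J(1))
    show "J = val_ideal v F \<or> J = carrier (val_ring v F)"
    proof (cases "J = val_ideal v F")
      case False
      then obtain x where x: "x \<in> J" "x \<in> F" "val_ge 0 x" "\<not> val_gt 0 x"
        using J(2,3) by (auto simp: val_ideal_eq)
      then have "x \<noteq> 0" "v x = 0" by (auto simp: val_ge_def val_gt_def)
      then have "inverse x \<in> carrier (val_ring v F)"
        using x(2) by (auto simp: val_ge_def v_inverse intro: F_closed)
      then have "inverse x \<otimes>\<^bsub>val_ring v F\<^esub> x \<in> J" using x(1) J.I_l_closed by blast
      then have "\<one>\<^bsub>val_ring v F\<^esub> \<in> J" using \<open>x \<noteq> 0\<close> by simp
      then show ?thesis using J.one_imp_carrier by blast
    qed simp
  qed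
qed

lemma field_residue: "field (residue_field v F)"
  unfolding residue_field_def
  by (rule maximalideal.quotient_is_field[OF val_ideal_maximal cring_val_ring])

lemma residue_hom: "ring_hom_ring (val_ring v F) (residue_field v F) (\<lambda>x. val_ideal v F +>\<^bsub>val_ring v F\<^esub> x)"
  unfolding residue_field_def
  by (rule ideal.rcos_ring_hom_ring[OF maximalideal.axioms(1)[OF val_ideal_maximal]])

lemma residue_eq_iff:
  assumes "x \<in> F" "val_ge 0 x" "y \<in> F" "val_ge 0 y"
  shows "val_ideal v F +>\<^bsub>val_ring v F\<^esub> x = val_ideal v F +>\<^bsub>val_ring v F\<^esub> y \<longleftrightarrow> val_gt 0 (x - y)"
proof -
  interpret R: cring "val_ring v F" by (rule cring_val_ring)
  have "x \<ominus>\<^bsub>val_ring v F\<^esub> y = x - y"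
    using assms by (simp add: a_minus_def val_ring_minus)
  then show ?thesis
    using R.quotient_eq_iff_same_a_r_cos[OF maximalideal.axioms(1)[OF val_ideal_maximal], of x y] assms
    by (auto simp: val_ideal_eq intro: F_closed)
qed

lemma residue_carrier: "carrier (residue_field v F) = (\<lambda>x. val_ideal v F +>\<^bsub>val_ring v F\<^esub> x) ` {x\<in>F. val_ge 0 x}"
  unfolding residue_field_def by (auto simp: FactRing_def A_RCOSETS_def')

end

text \<open>The residue of \<open>of_nat n\<close> is \<open>n\<close> times the unity of the residue field, whose additive order is \<open>p\<close>.\<close>
lemma residue_char_unit:
  assumes K: "subfield K ambient_field" and char: "ring_char (residue_field v K) = p"
    and n: "0 < n" "n < p"
  shows "of_nat n \<noteq> (0::'l) \<and> v (of_nat n) = 0"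
proof -
  let ?R = "residue_field v K" and ?h = "\<lambda>x. val_ideal v K +>\<^bsub>val_ring v K\<^esub> x"
  interpret h: ring_hom_ring "val_ring v K" ?R ?h by (rule residue_hom[OF K])
  note Kc = subring_of_nat[OF subfield_ambientD(1)[OF K]] F_closed[OF K]
  have pow: "[m] \<cdot>\<^bsub>?R\<^esub> \<one>\<^bsub>?R\<^esub> = ?h (of_nat m)" for m :: nat
  proof (induction m)
    case 0
    then show ?case using h.hom_zero by simp
  next
    case (Suc m)
    have "?h (of_nat m + 1) = ?h (of_nat m) \<oplus>\<^bsub>?R\<^esub> ?h 1"
      using h.hom_add[of "of_nat m" 1] by (simp add: val_ge_of_nat Kc)
    then show ?case using Suc h.hom_one by (simp add: add.commute)
  qed
  have "\<not> p dvd n" using n by (simp add: nat_dvd_not_less)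
  then have "[n] \<cdot>\<^bsub>?R\<^esub> \<one>\<^bsub>?R\<^esub> \<noteq> \<zero>\<^bsub>?R\<^esub>"
    using h.S.add.pow_eq_id[of "\<one>\<^bsub>?R\<^esub>" n] char by (simp add: ring_char_def)
  then have "?h (of_nat n) \<noteq> ?h 0" using pow h.hom_zero by simp
  then have "\<not> val_gt 0 (of_nat n)"
    using residue_eq_iff[OF K, of "of_nat n" 0] by (simp add: val_ge_of_nat Kc)
  then show ?thesis using val_ge_of_nat[of n] by (auto simp: val_gt_def val_ge_def)
qed

end


section \<open>Extensions with defect of prime degree are immediate\<close>

lemma subfield_UNIV: "subfield (UNIV :: 'l::field set) ambient_field"
proof -
  interpret field "ambient_field :: 'l ring" by (rule field_ambient)
  show ?thesis using carrier_is_subfield by simp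
qed

lemma (in ring) infinite_dimension_independent:
  assumes "K \<subseteq> carrier R" "infinite_dimension K (carrier R)"
  shows "\<exists>Us. independent K Us \<and> length Us = n"
proof (induction n)
  case 0
  have "independent K []" by (rule li_Nil)
  then show ?case by blast
next
  case (Suc n)
  then obtain Us where Us: "independent K Us" "length Us = n" by blast
  have "Span K Us \<noteq> carrier R"
    using assms(2) finite_dimensionI[OF dimension_independent[OF Us(1)]] by metis
  moreover have "Span K Us \<subseteq> carrier R"
    using Span_in_carrier[OF assms(1) independent_in_carrier[OF Us(1)]] .
  ultimately
  obtain u where "u \<in> carrier R" "u \<notin> Span K Us" by blast
  then have "independent K (u # Us)" using Us(1) by (intro li_Cons)
  then show ?case using Us(2) by (intro exI[of _ "u # Us"]) simp
qed

context valuation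
begin

lemma exists_min_value:
  assumes "finite S" "S \<noteq> {}"
  shows "\<exists>x\<in>S. \<forall>y\<in>S. v x \<le> (v y :: 'g)"
  using ex_is_arg_min_if_finite[OF assms, of v] unfolding is_arg_min_linorder by blast

abbreviation residue :: "'l \<Rightarrow> 'l set" where
  "residue x \<equiv> val_ideal v UNIV +>\<^bsub>val_ring v UNIV\<^esub> x"

lemma residue_subfield_is_subfield:
  assumes K: "subfield K ambient_field"
  shows "subfield (residue_subfield v K) (residue_field v UNIV)"
proof -
  interpret R: field "residue_field v UNIV" by (rule field_residue[OF subfield_UNIV])
  interpret h: ring_hom_ring "val_ring v UNIV" "residue_field v UNIV" residue
    by (rule residue_hom[OF subfield_UNIV])
  note Kc = F_closed[OF K]
  have "subring (carrier (val_ring v K)) (val_ring v UNIV)"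
    by (intro h.R.subringI) (auto simp: val_ring_minus[OF subfield_UNIV] intro: Kc val_ge_add val_ge_mult_0)
  then have sub: "subring (residue_subfield v K) (residue_field v UNIV)"
    unfolding residue_subfield_def by (rule h.img_is_subring)
  show ?thesis
  proof (rule R.subfieldI'[OF sub])
    fix k assume "k \<in> residue_subfield v K - {\<zero>\<^bsub>residue_field v UNIV\<^esub>}"
    then obtain x where x: "x \<in> K" "val_ge 0 x" "k = residue x" "residue x \<noteq> residue 0"
      using h.hom_zero by (auto simp: residue_subfield_def)
    then have "\<not> val_gt 0 x" using residue_eq_iff[OF subfield_UNIV, of x 0] by auto
    then have u: "x \<noteq> 0" "v x = 0" using x(2) by (auto simp: val_ge_def val_gt_def)
    then have ge: "val_ge 0 (inverse x)" by (simp add: val_ge_def v_inverse)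
    have "k \<otimes>\<^bsub>residue_field v UNIV\<^esub> residue (inverse x) = residue (x * inverse x)"
      using h.hom_mult[of x "inverse x"] x ge by simp
    also have "\<dots> = \<one>\<^bsub>residue_field v UNIV\<^esub>"
      using u h.hom_one by simp
    finally have "inv\<^bsub>residue_field v UNIV\<^esub> k = residue (inverse x)"
      using x ge by (intro R.comm_inv_char) auto
    then show "inv\<^bsub>residue_field v UNIV\<^esub> k \<in> residue_subfield v K"
      using x(1) ge Kc(7) by (auto simp: residue_subfield_def)
  qed
qed

lemma residue_combine:
  assumes "set Ks \<subseteq> {x. val_ge 0 x}" "set us \<subseteq> {x. val_ge 0 x}"
  shows "val_ge 0 (sum_list (map2 (*) Ks us)) \<and>
    ring.combine (residue_field v UNIV) (map residue Ks) (map residue us) = residue (sum_list (map2 (*) Ks us))"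
proof -
  interpret h: ring_hom_ring "val_ring v UNIV" "residue_field v UNIV" residue
    by (rule residue_hom[OF subfield_UNIV])
  show ?thesis using assms
  proof (induction Ks us rule: list_induct2')
    case (4 k Ks u us)
    then show ?case
      using h.hom_mult[of k u] h.hom_add[of "k * u" "sum_list (map2 (*) Ks us)"]
      by (auto intro: val_ge_add val_ge_mult_0)
  qed (use h.hom_zero in simp_all)
qed

text \<open>A dependence relation between lifts can be divided by a coefficient of least value. It then has
integral coefficients, one of which is 1, and reduces to a nontrivial relation between the residues.\<close>
lemma lift_independent:
  assumes K: "subfield K ambient_field" and us: "set us \<subseteq> {x. val_ge 0 x}"
    and ind: "ring.independent (residue_field v UNIV) (residue_subfield v K) (map residue us)"
  shows "ring.independent ambient_field K us"
proof -
  interpret L: field "ambient_field :: 'l ring" by (rule field_ambient)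
  interpret R: field "residue_field v UNIV" by (rule field_residue[OF subfield_UNIV])
  interpret h: ring_hom_ring "val_ring v UNIV" "residue_field v UNIV" residue
    by (rule residue_hom[OF subfield_UNIV])
  show ?thesis
  proof (rule L.trivial_combine_imp_independent[OF K])
    fix Ks0 assume Ks0: "set Ks0 \<subseteq> K" "L.combine Ks0 us = \<zero>\<^bsub>ambient_field\<^esub>"
    define Ks where "Ks = take (length us) Ks0"
    have Ks: "set Ks \<subseteq> K" "L.combine Ks us = 0"
      using Ks0 set_take_subset[of "length us" Ks0] L.combine_take[of us Ks0] by (auto simp: Ks_def)
    show "set (take (length us) Ks0) \<subseteq> {\<zero>\<^bsub>ambient_field\<^esub>}"
    proof (rule ccontr)
      assume "\<not> ?thesis"
      then have "set Ks - {0} \<noteq> {}" by (auto simp: Ks_def)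
      then obtain k where k: "k \<in> set Ks" "k \<noteq> 0" "\<And>k'. k' \<in> set Ks - {0} \<Longrightarrow> v k \<le> v k'"
        using exists_min_value[of "set Ks - {0}"] by auto
      define Ls where "Ls = map (\<lambda>x. inverse k * x) Ks"
      have Ls: "set Ls \<subseteq> {x\<in>K. val_ge 0 x}"
      proof
        fix y assume "y \<in> set Ls"
        then obtain k' where k': "k' \<in> set Ks" "y = inverse k * k'" by (auto simp: Ls_def)
        then have "y \<in> K" using Ks(1) k(1) by (auto intro: F_closed[OF K])
        moreover have "val_ge 0 y"
          using k' k by (cases "k' = 0") (simp_all add: val_ge_def v_mult v_inverse)
        ultimately show "y \<in> {x\<in>K. val_ge 0 x}" by simp
      qed
      have "L.combine Ls us = inverse k * L.combine Ks us"
      proof -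
        have "(\<otimes>\<^bsub>ambient_field\<^esub>) (inverse k) = (\<lambda>x. inverse k * x)" by (rule ext) simp
        then show ?thesis using L.combine_r_distr[of Ks us "inverse k"] by (simp add: Ls_def)
      qed
      then have "R.combine (map residue Ls) (map residue us) = residue 0"
        using residue_combine[of Ls us] Ls us Ks(2) ambient_combine[of Ls us] by auto
      moreover have "set (map residue Ls) \<subseteq> residue_subfield v K"
        using Ls by (auto simp: residue_subfield_def)
      ultimately have "set (take (length us) (map residue Ls)) \<subseteq> {residue 0}"
        using R.independent_imp_trivial_combine[OF residue_subfield_is_subfield[OF K] ind, of "map residue Ls"]
          h.hom_zero by simp
      moreover have "1 \<in> set Ls" using k(1,2) by (auto simp: Ls_def image_iff intro!: bexI[of _ k])
      moreover have "length Ls \<le> length us" by (simp add: Ls_def Ks_def)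
      ultimately have "residue 1 = residue 0" by auto
      then show False
        using h.hom_one h.hom_zero by simp
    qed
  qed simp
qed

text \<open>This is needed before the inertia degree can be used at all: the dimension of a space that is not
finite-dimensional is an unspecified number, which might be 1.\<close>
lemma residue_finite_dimension:
  assumes K: "subfield K ambient_field" and fin: "finite_extension K"
  shows "ring.finite_dimension (residue_field v UNIV) (residue_subfield v K) (carrier (residue_field v UNIV))"
proof (rule ccontr)
  interpret L: field "ambient_field :: 'l ring" by (rule field_ambient)
  interpret R: field "residue_field v UNIV" by (rule field_residue[OF subfield_UNIV])
  assume "\<not> ?thesis"
  from R.infinite_dimension_independent[OF subfieldE(3)[OF residue_subfield_is_subfield[OF K]] this]
  have *: "\<exists>Us. R.independent (residue_subfield v K) Us \<and> length Us = n" for n .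
  obtain n where n: "L.dimension n K UNIV"
    using fin unfolding finite_extension_def by (rule L.finite_dimensionE')
  obtain Us where Us: "R.independent (residue_subfield v K) Us" "length Us = Suc n" using * by blast
  have "set Us \<subseteq> residue ` {x. val_ge 0 x}"
    using R.independent_in_carrier[OF Us(1)] residue_carrier[OF subfield_UNIV] by auto
  then have "\<forall>U\<in>set Us. \<exists>x. val_ge 0 x \<and> residue x = U" by blast
  then obtain r where r: "\<And>U. U \<in> set Us \<Longrightarrow> val_ge 0 (r U) \<and> residue (r U) = U" by metis
  have "map residue (map r Us) = Us" using r by (simp add: map_idI)
  then have "L.independent K (map r Us)"
    using lift_independent[OF K, of "map r Us"] r Us(1) by auto
  from L.independent_length_le_dimension[OF K n this] Us(2) show False by simp
qed

lemma inertia_degree_1_residues: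
  assumes K: "subfield K ambient_field" and fin: "finite_extension K" and f: "inertia_degree K v = 1"
    and x: "val_ge 0 x"
  shows "\<exists>k\<in>K. val_ge 0 k \<and> val_gt 0 (x - k)"
proof -
  interpret R: field "residue_field v UNIV" by (rule field_residue[OF subfield_UNIV])
  let ?k = "residue_subfield v K" and ?E = "carrier (residue_field v UNIV)"
  note k = residue_subfield_is_subfield[OF K]
  have "R.dimension 1 ?k ?E"
    using R.finite_dimensionE[OF k residue_finite_dimension[OF K fin]] f
    by (simp add: inertia_degree_def field_degree_def over_def)
  moreover obtain Vs where Vs: "set Vs \<subseteq> ?E" "R.independent ?k Vs" "length Vs = 1" "R.Span ?k Vs = ?k"
    using R.exists_base[OF k R.dimension_one[OF k]] by blast
  ultimately have "?k = ?E"
    using R.independent_length_eq_dimension[OF k _ Vs(2,1)] by auto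
  moreover have "residue x \<in> ?E" using x residue_carrier[OF subfield_UNIV] by auto
  ultimately have "residue x \<in> ?k" by simp
  then obtain y where "y \<in> K" "val_ge 0 y" "residue x = residue y"
    by (auto simp: residue_subfield_def)
  then show ?thesis using residue_eq_iff[OF subfield_UNIV, of x y] x by auto
qed

lemma ramification_index_1_values:
  assumes e: "ramification_index K v = 1" and x: "x \<noteq> 0" and one: "1 \<in> K"
  shows "\<exists>k\<in>K. k \<noteq> 0 \<and> v k = v x"
proof -
  let ?V = "value_group v (UNIV :: 'l set)" and ?H = "value_set v K"
  obtain C where C: "rcosets\<^bsub>?V\<^esub> ?H = {C}"
    using e unfolding ramification_index_def by (auto simp: card_1_singleton_iff)
  have mem: "?H #>\<^bsub>?V\<^esub> v y \<in> rcosets\<^bsub>?V\<^esub> ?H" if "y \<noteq> 0" for y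
    using that by (auto simp: RCOSETS_def value_group_def value_set_def)
  have "v x \<in> ?H #>\<^bsub>?V\<^esub> v x"
    using one v_1 unfolding r_coset_def value_group_def value_set_def
    by (auto intro!: bexI[of _ 1])
  also have "?H #>\<^bsub>?V\<^esub> v x = ?H #>\<^bsub>?V\<^esub> v 1"
    using mem[OF x] mem[of 1] unfolding C by simp
  finally show ?thesis
    by (auto simp: r_coset_def value_group_def value_set_def)
qed

end

text \<open>In the formula for the degree, a nontrivial power of the characteristic exponent divides the prime
\<open>p\<close>, which leaves nothing for the ramification index and the inertia degree.\<close>
lemma defect_prime_degree:
  fixes K :: "'l::field set" and v :: "'l \<Rightarrow> 'g::linordered_ab_group_add"
  assumes "defect_extension K v" and p: "Factorial_Ring.prime p"
    and deg: "field_degree (ambient_field :: 'l ring) K = p"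
  shows "finite_extension K" "unibranched K v" "ring_char (residue_field v K) = p"
    "ramification_index K v = 1" "inertia_degree K v = 1"
proof -
  show "finite_extension K" "unibranched K v"
    using assms(1) by (auto simp: defect_extension_def)
  obtain n where n: "p = char_exponent K v ^ n * ramification_index K v * inertia_degree K v"
    "char_exponent K v ^ n > 1"
    using assms(1) deg by (auto simp: defect_extension_def)
  have "char_exponent K v ^ n dvd p" using n(1) by (simp add: mult.assoc)
  then have q: "char_exponent K v ^ n = p"
    using p n(2) by (auto simp: prime_nat_iff)
  then have "ramification_index K v * inertia_degree K v = 1"
    using n(1) prime_gt_0_nat[OF p] unfolding q mult.assoc by simp
  then show "ramification_index K v = 1" "inertia_degree K v = 1" by auto
  have "n = 1" using q p by (metis prime_power_iff One_nat_def)
  then have "char_exponent K v = p" using q by simp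
  then show "ring_char (residue_field v K) = p"
    using prime_gt_1_nat[OF p] by (auto simp: char_exponent_def Let_def split: if_splits)
qed


section \<open>Generators of extensions of prime degree\<close>

lemma sum_list_exp_base:
  fixes a :: "'l::field"
  shows "sum_list (map2 (*) (map f (rev [0..<n])) (ring.exp_base ambient_field a n)) = (\<Sum>i<n. f i * a ^ i)"
proof -
  interpret L: field "ambient_field :: 'l ring" by (rule field_ambient)
  have "map2 (*) (map f (rev [0..<n])) (L.exp_base a n) = map (\<lambda>i. f i * a ^ i) (rev [0..<n])"
    by (simp add: L.exp_base_def zip_map_map zip_same_conv_map)
  moreover have "(\<Sum>i\<leftarrow>rev [0..<n]. f i * a ^ i) = (\<Sum>i<n. f i * a ^ i)"
    by (simp add: sum_list_distinct_conv_sum_set atLeast0LessThan)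
  ultimately show ?thesis by simp
qed

text \<open>By the tower law, a subfield strictly above \<open>K\<close> has degree \<open>p\<close> over \<open>K\<close>, so \<open>1, a, \<dots>, a^(p - 1)\<close> is
a basis of the whole field.\<close>
lemma prime_degree_generator:
  fixes K :: "'l::field set"
  assumes K: "subfield K ambient_field" and fin: "finite_extension K"
    and p: "Factorial_Ring.prime p" and deg: "field_degree (ambient_field :: 'l ring) K = p"
    and a: "a \<notin> K"
  shows "poly_over K h \<Longrightarrow> h \<noteq> 0 \<Longrightarrow> degree h < p \<Longrightarrow> poly h a \<noteq> 0"
    and "\<exists>h. poly_over K h \<and> degree h < p \<and> poly h a = b"
proof -
  interpret L: field "ambient_field :: 'l ring" by (rule field_ambient)
  have fin: "L.finite_dimension K UNIV" using fin by (simp add: finite_extension_def)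
  have dimL: "L.dimension p K UNIV"
    using L.finite_dimensionE[OF K fin] deg by (simp add: field_degree_def over_def)
  have alg: "L.algebraic K a"
    using L.finite_dimension_imp_algebraic[OF K _ fin, of a] subfieldE(1)[OF subfield_UNIV]
    by (simp add: over_def)
  let ?F = "L.simple_extension K a" and ?n = "length (L.Irr K a) - 1"
  have alg': "(L.algebraic over K) a" using alg by (simp add: over_def)
  have F: "subfield ?F ambient_field" using L.simple_extension_is_subfield[OF K, of a] alg' by simp
  have dimF: "L.dimension ?n K ?F" using L.dimension_simple_extension[OF K _ alg'] by simp
  have KF: "K \<subseteq> ?F" using L.simple_extension_incl[of K a] by simp
  have aF: "a \<in> ?F" using L.simple_extension_mem[OF subfieldE(1)[OF K], of a] by simp
  obtain Us where Us: "L.independent K Us" "L.Span K Us = UNIV"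
    using L.exists_base[OF K dimL] by blast
  \<comment> \<open>A basis over \<open>K\<close> spans over the larger field \<open>?F\<close>, so the degree over \<open>?F\<close> is finite and the tower law applies.\<close>
  have "L.Span K Us \<subseteq> L.Span ?F Us"
  proof (rule L.subalgebra_Span_incl[OF K])
    have "subalgebra ?F (L.Span ?F Us) ambient_field" by (rule L.Span_is_subalgebra[OF F]) simp
    then show "subalgebra K (L.Span ?F Us) ambient_field"
      using KF by (auto simp: subalgebra_def subalgebra_axioms_def)
    show "set Us \<subseteq> L.Span ?F Us" using L.Span_base_incl[OF F, of Us] by simp
  qed
  then have "L.finite_dimension ?F UNIV"
    using L.Span_finite_dimension[OF F, of Us] Us(2) by (simp add: top.extremum_unique)
  then obtain m where m: "L.dimension m ?F UNIV" by (rule L.finite_dimensionE')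
  have "?n * m = p"
    using L.dimension_is_inj[OF K L.telescopic_base[OF K F dimF m] dimL] .
  moreover have "?n \<noteq> 1"
  proof
    assume n1: "?n = 1"
    obtain Vs where Vs: "L.independent K Vs" "length Vs = 1" "L.Span K Vs = K"
      using L.exists_base[OF K L.dimension_one[OF K]] by blast
    then have "set Vs \<subseteq> ?F" using KF L.Span_base_incl[OF K, of Vs] by auto
    then have "L.Span K Vs = ?F"
      using L.independent_length_eq_dimension[OF K dimF Vs(1)] Vs(2) n1 by simp
    then show False using Vs(3) aF a by simp
  qed
  ultimately have n: "?n = p"
    using p by (metis dvd_triv_left prime_nat_iff)
  have ind: "L.independent K (L.exp_base a p)"
    using L.exp_base_independent[OF K _ alg'] n by simp
  have len: "length (L.exp_base a p) = p" by (simp add: L.exp_base_def)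
  show "poly h a \<noteq> 0" if h: "poly_over K h" "h \<noteq> 0" "degree h < p"
  proof
    assume "poly h a = 0"
    let ?Ks = "map (coeff h) (rev [0..<p])"
    have "poly h a = (\<Sum>i<p. coeff h i * a ^ i)"
      unfolding poly_altdef using h(3) by (intro sum.mono_neutral_left) (auto simp: coeff_eq_0)
    then have "L.combine ?Ks (L.exp_base a p) = \<zero>\<^bsub>ambient_field\<^esub>"
      using \<open>poly h a = 0\<close> by (simp add: ambient_combine sum_list_exp_base)
    moreover have "set ?Ks \<subseteq> K" using h(1) by (auto simp: poly_over_def)
    ultimately have "set (take (length (L.exp_base a p)) ?Ks) \<subseteq> {\<zero>\<^bsub>ambient_field\<^esub>}"
      by (intro L.independent_imp_trivial_combine[OF K ind])
    then have "coeff h i = 0" if "i < p" for i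
      using that len by (force simp: image_subset_iff)
    then show False using h(2,3) by (metis leading_coeff_0_iff)
  qed
  show "\<exists>h. poly_over K h \<and> degree h < p \<and> poly h a = b"
  proof -
    have "L.Span K (L.exp_base a p) = UNIV"
      using L.independent_length_eq_dimension[OF K dimL ind] len by simp
    then obtain Ks where Ks: "set Ks \<subseteq> K" "length Ks = p" "b = L.combine Ks (L.exp_base a p)"
      using L.Span_mem_iff_length_version[OF K, of "L.exp_base a p" b] len by auto
    define h where "h = Poly (rev Ks)"
    have coeff_h: "coeff h i = rev Ks ! i" if "i < p" for i
      using that Ks(2) by (simp add: h_def nth_default_def)
    have coeff_h0: "coeff h i = 0" if "i \<ge> p" for i
      using that Ks(2) by (simp add: h_def nth_default_def)
    have "map (coeff h) [0..<p] = rev Ks"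
      using coeff_h Ks(2) by (intro nth_equalityI) simp_all
    then have "map (coeff h) (rev [0..<p]) = Ks" by (simp add: rev_swap flip: rev_map)
    then have "b = (\<Sum>i<p. coeff h i * a ^ i)"
      using Ks(3) sum_list_exp_base[of "coeff h" p a] by (simp add: ambient_combine)
    moreover have dh: "degree h < p"
      using prime_gt_0_nat[OF p] coeff_h0 by (intro degree_lessI) auto
    moreover have "poly h a = (\<Sum>i<p. coeff h i * a ^ i)"
      unfolding poly_altdef using dh by (intro sum.mono_neutral_left) (auto simp: coeff_eq_0)
    moreover have "poly_over K h"
      unfolding poly_over_def
    proof
      fix i show "coeff h i \<in> K"
      proof (cases "i < p")
        case True
        then show ?thesis using coeff_h[OF True] Ks by (metis length_rev nth_mem set_rev subsetD)
      qed (use coeff_h0 subring_ambientD(1)[OF subfield_ambientD(1)[OF K]] in simp)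
    qed
    ultimately show ?thesis by metis
  qed
qed

section \<open>The Galois group\<close>

lemma galois_groupD:
  assumes "\<sigma> \<in> galois_group K"
  shows "\<sigma> (x + y) = \<sigma> x + \<sigma> y" "\<sigma> (x * y) = \<sigma> x * \<sigma> y" "\<sigma> 1 = 1" "\<sigma> 0 = 0"
    "\<sigma> (- x) = - \<sigma> x" "\<sigma> (x - y) = \<sigma> x - \<sigma> y" "bij \<sigma>" "\<sigma> x = 0 \<longleftrightarrow> x = 0"
    "x \<in> K \<Longrightarrow> \<sigma> x = x" "\<sigma> (x ^ n) = \<sigma> x ^ n" "\<sigma> (inverse x) = inverse (\<sigma> x)"
    "\<sigma> (x / y) = \<sigma> x / \<sigma> y"
proof -
  have "\<sigma> \<in> ring_hom ambient_field ambient_field" and bij: "bij \<sigma>" and fix_K: "\<And>x. x \<in> K \<Longrightarrow> \<sigma> x = x"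
    using assms by (auto simp: galois_group_def ring_iso_def)
  note hom = ring_hom_memE[OF this(1)]
  show add: "\<sigma> (x + y) = \<sigma> x + \<sigma> y" for x y using hom(3)[of x y] by simp
  show mult: "\<sigma> (x * y) = \<sigma> x * \<sigma> y" for x y using hom(2)[of x y] by simp
  show one: "\<sigma> 1 = 1" using hom(4) by simp
  show zero: "\<sigma> 0 = 0" using add[of 0 0] by (metis add_cancel_right_right add_0)
  show minus: "\<sigma> (- x) = - \<sigma> x" for x using add[of x "- x"] zero by (simp add: eq_neg_iff_add_eq_0 add.commute)
  show "\<sigma> (x - y) = \<sigma> x - \<sigma> y" using add[of x "- y"] minus by simp
  show "bij \<sigma>" by (rule bij)
  show eq0: "\<sigma> x = 0 \<longleftrightarrow> x = 0" for x using zero bij by (metis bij_is_inj injD)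
  show "x \<in> K \<Longrightarrow> \<sigma> x = x" by (rule fix_K)
  show "\<sigma> (x ^ n) = \<sigma> x ^ n" by (induction n) (simp_all add: one mult)
  show inv: "\<sigma> (inverse x) = inverse (\<sigma> x)" for x
    using mult[of x "inverse x"] one zero eq0[of x] by (cases "x = 0") (auto simp: inverse_unique)
  show "\<sigma> (x / y) = \<sigma> x / \<sigma> y" using mult[of x "inverse y"] inv by (simp add: divide_inverse)
qed

lemma galois_group_poly:
  assumes "\<sigma> \<in> galois_group K" "poly_over K h"
  shows "\<sigma> (poly h x) = poly h (\<sigma> x)"
  using assms(2)
proof (induction h)
  case (pCons c h)
  then have "c \<in> K" "poly_over K h" unfolding poly_over_def by (metis coeff_pCons_0, metis coeff_pCons_Suc)
  with pCons show ?case using assms(1) by (simp add: galois_groupD)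
qed (use assms(1) in \<open>simp add: galois_groupD\<close>)

definition galois_monoid :: "'l::field set \<Rightarrow> ('l \<Rightarrow> 'l) monoid" where
  "galois_monoid K = \<lparr>carrier = galois_group K, monoid.mult = (\<circ>), one = id\<rparr>"

lemma galois_group_inv:
  assumes "\<sigma> \<in> galois_group K"
  shows "inv_into UNIV \<sigma> \<in> galois_group K"
proof -
  interpret L: field "ambient_field :: 'a ring" by (rule field_ambient)
  have "inv_into UNIV \<sigma> \<in> ring_iso ambient_field ambient_field"
    using ring_iso_set_sym[OF L.ring_axioms, of \<sigma> ambient_field] assms by (simp add: galois_group_def)
  moreover have "inv_into UNIV \<sigma> x = x" if "x \<in> K" for x
    using galois_groupD(7,9)[OF assms] that by (metis bij_is_inj inv_f_f)
  ultimately show ?thesis by (simp add: galois_group_def)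
qed

lemma galois_group_id: "id \<in> galois_group K"
  using ring_iso_set_refl by (auto simp: galois_group_def)

lemma galois_group_comp: "\<sigma> \<in> galois_group K \<Longrightarrow> \<tau> \<in> galois_group K \<Longrightarrow> \<sigma> \<circ> \<tau> \<in> galois_group K"
  using ring_iso_set_trans by (force simp: galois_group_def)

lemma group_galois_monoid: "group (galois_monoid K)"
proof (rule groupI)
  fix \<sigma> assume "\<sigma> \<in> carrier (galois_monoid K)"
  then show "\<exists>\<tau>\<in>carrier (galois_monoid K). \<tau> \<otimes>\<^bsub>galois_monoid K\<^esub> \<sigma> = \<one>\<^bsub>galois_monoid K\<^esub>"
    using galois_group_inv[of \<sigma> K] galois_groupD(7)[of \<sigma> K]
    by (intro bexI[of _ "inv_into UNIV \<sigma>"]) (auto simp: galois_monoid_def bij_is_inj)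
qed (auto simp: galois_monoid_def galois_group_id galois_group_comp comp_assoc)

lemma map_poly_hom_prod:
  assumes "\<sigma> \<in> galois_group K"
  shows "map_poly \<sigma> (prod f S) = (\<Prod>i\<in>S. map_poly \<sigma> (f i))"
proof (induction S rule: infinite_finite_induct)
  case (insert x S)
  have sum: "\<sigma> (sum h I) = (\<Sum>i\<in>I. \<sigma> (h i))" for h and I :: "nat set"
    by (induction I rule: infinite_finite_induct) (simp_all add: galois_groupD[OF assms])
  have "map_poly \<sigma> (q * r) = map_poly \<sigma> q * map_poly \<sigma> r" for q r
    by (rule poly_eqI) (simp add: coeff_map_poly galois_groupD[OF assms] coeff_mult sum)
  then show ?case using insert by simp
qed (simp_all add: map_poly_1' galois_groupD[OF assms])

context valuation
begin

text \<open>The preimage of the valuation ring under an automorphism is another valuation ring with the same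
trace on \<open>K\<close>, so uniqueness of the extension makes it the same ring.\<close>
lemma unibranched_galois:
  assumes K: "subfield K ambient_field" and ub: "unibranched K v" and \<sigma>: "\<sigma> \<in> galois_group K"
  shows "val_ge 0 (\<sigma> x) \<longleftrightarrow> val_ge 0 x"
proof -
  note s = galois_groupD[OF \<sigma>]
  interpret L: field "ambient_field :: 'l ring" by (rule field_ambient)
  let ?V = "{x. val_ge 0 (\<sigma> x)}"
  have neg: "\<ominus>\<^bsub>ambient_field\<^esub> x = - x" for x :: 'l
    by (rule L.minus_equality) simp_all
  have "subring ?V ambient_field"
    by (intro L.subringI) (auto simp: neg s intro: val_ge_add val_ge_mult_0)
  moreover have "x \<in> ?V \<or> inverse x \<in> ?V" if "x \<noteq> 0" for x
    using that by (auto simp: s val_ge_def v_inverse)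
  ultimately have "is_valuation_ring ?V" by (simp add: is_valuation_ring_def)
  moreover have "?V \<inter> K = carrier (val_ring v K)" by (auto simp: s)
  ultimately have "?V = carrier (val_ring v UNIV)"
    using ub unfolding unibranched_def by blast
  then show ?thesis by auto
qed

text \<open>Two elements of equal value differ by a unit; comparing \<open>x\<close> with an element of \<open>K\<close> of the same value
turns invariance of the valuation ring into invariance of the valuation.\<close>
lemma unibranched_galois_value:
  assumes K: "subfield K ambient_field" and ub: "unibranched K v" and \<sigma>: "\<sigma> \<in> galois_group K"
    and k: "\<exists>k\<in>K. k \<noteq> 0 \<and> v k = v x" and x: "x \<noteq> 0"
  shows "v (\<sigma> x) = v x"
proof -
  note s = galois_groupD[OF \<sigma>]
  obtain k where k: "k \<in> K" "k \<noteq> 0" "v k = v x" using k by blast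
  have "val_ge 0 (\<sigma> (x / k))" "val_ge 0 (\<sigma> (k / x))"
    using k x by (simp_all only: unibranched_galois[OF K ub \<sigma>]) (simp_all add: val_ge_def v_divide)
  then show ?thesis using k x by (auto simp: s val_ge_def v_divide)
qed

end


section \<open>The conjugates of the generator\<close>

lemma poly_diff_factor:
  assumes A: "subring A ambient_field" and h: "poly_over A h" and xy: "x \<in> A" "y \<in> A"
  shows "\<exists>q\<in>A. poly h x - poly h y = (x - y) * q"
  using h
proof (induction h)
  case (pCons c h)
  then obtain q where q: "q \<in> A" "poly h x - poly h y = (x - y) * q"
    by (auto simp: poly_over_pCons[OF A])
  have "poly (pCons c h) x - poly (pCons c h) y = (x - y) * poly h x + y * (poly h x - poly h y)"
    by (simp add: algebra_simps)
  also have "\<dots> = (x - y) * (poly h x + y * q)"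
    unfolding q(2) by (simp add: algebra_simps)
  finally show ?case
    using q(1) xy pCons.hyps pCons.prems
    by (intro bexI[of _ "poly h x + y * q"])
       (auto simp: poly_over_pCons[OF A] intro!: subring_ambientD[OF A] poly_over_eval[OF A])
qed (auto intro: subring_ambientD[OF A])

text \<open>What remains of the hypotheses of the theorem: a Galois extension of prime degree that is immediate
and whose valuation is invariant under the Galois group, and a generator \<open>a\<close>.\<close>
locale galois_defect = valuation v
  for v :: "'l::field \<Rightarrow> 'g::linordered_ab_group_add" +
  fixes K :: "'l set" and p :: nat and a :: 'l
  assumes K_field: "subfield K ambient_field"
    and p_prime: "Factorial_Ring.prime p"
    and nat_units: "0 < n \<Longrightarrow> n < p \<Longrightarrow> of_nat n \<noteq> (0::'l) \<and> v (of_nat n) = 0"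
    and values_K: "x \<noteq> 0 \<Longrightarrow> \<exists>k\<in>K. k \<noteq> 0 \<and> v k = v x"
    and residues_K: "x \<noteq> 0 \<Longrightarrow> v x = 0 \<Longrightarrow> \<exists>k\<in>K. val_gt 0 (x - k)"
    and not_in_K: "a \<notin> K"
    and degree_a: "poly_over K h \<Longrightarrow> h \<noteq> 0 \<Longrightarrow> degree h < p \<Longrightarrow> poly h a \<noteq> 0"
    and a_generates: "\<exists>h. poly_over K h \<and> degree h < p \<and> poly h a = b"
    and fixed_field: "(\<And>\<sigma>. \<sigma> \<in> galois_group K \<Longrightarrow> \<sigma> x = x) \<Longrightarrow> x \<in> K"
    and v_galois: "\<sigma> \<in> galois_group K \<Longrightarrow> x \<noteq> 0 \<Longrightarrow> v (\<sigma> x) = v x"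
begin

abbreviation "G \<equiv> galois_group K"

lemmas K_ring = subfield_ambientD(1)[OF K_field]
lemmas Kc = subring_ambientD[OF K_ring] subfield_ambientD(2,3)[OF K_field]

lemma p_pos: "p > 0" and p_gt1: "p > 1"
  using p_prime prime_gt_0_nat prime_gt_1_nat by blast+

definition conjugates :: "'l set" where "conjugates = (\<lambda>\<sigma>. \<sigma> a) ` G"

definition g :: "'l poly" where "g = (\<Prod>b\<in>conjugates. [:- b, 1:])"

lemma determined_by_a:
  assumes "\<sigma> \<in> G" "\<tau> \<in> G" "\<sigma> a = \<tau> a"
  shows "\<sigma> = \<tau>"
proof
  fix b
  obtain h where "poly_over K h" "poly h a = b" using a_generates by blast
  then show "\<sigma> b = \<tau> b" using galois_group_poly assms by metis
qed

lemma conjugates_closed: "\<sigma> \<in> G \<Longrightarrow> b \<in> conjugates \<Longrightarrow> \<sigma> b \<in> conjugates"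
  unfolding conjugates_def using galois_group_comp[of \<sigma> K] by (auto intro!: image_eqI[of "\<sigma> (\<tau> a)" _ "\<sigma> \<circ> \<tau>" for \<tau>])

lemma a_in_conjugates: "a \<in> conjugates"
  unfolding conjugates_def using galois_group_id[of K] by (intro image_eqI[of _ _ id]) simp_all

text \<open>Subtracting from \<open>X^p\<close> a representation of \<open>a^p\<close> by a polynomial of smaller degree gives an equation
of degree \<open>p\<close> for \<open>a\<close> and hence for all its conjugates.\<close>
lemma conjugates_finite: "finite conjugates" and conjugates_card_le: "card conjugates \<le> p"
proof -
  obtain h where h: "poly_over K h" "degree h < p" "poly h a = a ^ p" using a_generates by blast
  define f where "f = Polynomial.monom 1 p - h"
  have f: "poly_over K f" unfolding f_def
    by (intro poly_over_diff[OF K_ring] poly_over_monom[OF K_ring] Kc h)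
  have "coeff f p = 1" using h(2) by (simp add: f_def coeff_eq_0)
  then have f0: "f \<noteq> 0" by auto
  have df: "degree f \<le> p" unfolding f_def
    using h(2) by (intro degree_diff_le) (auto simp: degree_monom_le)
  have fa: "poly f a = 0" using h(3) by (simp add: f_def poly_monom)
  have "poly f (\<sigma> a) = 0" if "\<sigma> \<in> G" for \<sigma>
    using galois_group_poly[OF that f, of a] fa galois_groupD(4)[OF that] by simp
  then have sub: "conjugates \<subseteq> {x. poly f x = 0}" by (auto simp: conjugates_def)
  show "finite conjugates" using finite_subset[OF sub poly_roots_finite[OF f0]] .
  have "card conjugates \<le> card {x. poly f x = 0}" by (rule card_mono[OF poly_roots_finite[OF f0] sub])
  also have "\<dots> \<le> degree f" by (rule card_poly_roots_bound[OF f0])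
  finally show "card conjugates \<le> p" using df by simp
qed

lemma g_over: "poly_over K g"
  unfolding poly_over_def
proof
  fix i
  show "coeff g i \<in> K"
  proof (rule fixed_field)
    fix \<sigma> assume s: "\<sigma> \<in> G"
    have inj: "inj_on \<sigma> conjugates" using galois_groupD(7)[OF s] by (meson bij_is_inj inj_on_subset subset_UNIV)
    have im: "\<sigma> ` conjugates = conjugates"
      using conjugates_closed[OF s] inj conjugates_finite by (intro card_subset_eq) (auto simp: card_image)
    have "map_poly \<sigma> g = (\<Prod>b\<in>conjugates. [:- \<sigma> b, 1:])"
      unfolding g_def map_poly_hom_prod[OF s] by (simp add: map_poly_pCons galois_groupD[OF s])
    also have "\<dots> = (\<Prod>b\<in>\<sigma> ` conjugates. [:- b, 1:])" using inj by (simp add: prod.reindex)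
    also have "\<dots> = g" by (simp add: im g_def)
    finally have "coeff (map_poly \<sigma> g) i = coeff g i" by simp
    then show "\<sigma> (coeff g i) = coeff g i" by (simp add: coeff_map_poly galois_groupD[OF s])
  qed
qed

lemma g_lead: "lead_coeff g = 1"
  unfolding g_def by (simp add: lead_coeff_prod)

lemma degree_g_card: "degree g = card conjugates"
  unfolding g_def by (simp add: degree_prod_eq_sum_degree)

lemma g_at_a: "poly g a = 0"
  using a_in_conjugates conjugates_finite by (auto simp: g_def poly_prod)

text \<open>The polynomial whose zeros are the conjugates is invariant under the Galois group, so it is defined
over \<open>K\<close> and cannot have degree less than \<open>p\<close>.\<close>
lemma conjugates_card: "card conjugates = p"
proof -
  have "g \<noteq> 0" using g_lead by auto
  then have "\<not> degree g < p" using degree_a[OF g_over] g_at_a by auto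
  then show ?thesis using conjugates_card_le degree_g_card by simp
qed

lemma degree_g: "degree g = p"
  using degree_g_card conjugates_card by simp

lemma v_conjugate_minus:
  assumes "c \<in> K" "b \<in> conjugates"
  shows "b \<noteq> c \<and> v (b - c) = v (a - c)"
proof -
  obtain \<sigma> where s: "\<sigma> \<in> G" "b = \<sigma> a" using assms(2) by (auto simp: conjugates_def)
  have "b - c = \<sigma> (a - c)" using s assms(1) by (simp add: galois_groupD[OF s(1)])
  moreover have "a - c \<noteq> 0" using assms(1) not_in_K by auto
  ultimately show ?thesis
    using v_galois[OF s(1)] galois_groupD(8)[OF s(1)] by (metis eq_iff_diff_eq_0)
qed

lemma g_at_K:
  assumes "c \<in> K"
  shows "poly g c \<noteq> 0 \<and> v (poly g c) = v ((a - c) ^ p)"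
proof -
  have eq: "poly g c = (\<Prod>b\<in>conjugates. c - b)" by (simp add: g_def poly_prod)
  have "c - b \<noteq> 0 \<and> v (c - b) = v (a - c)" if "b \<in> conjugates" for b
    using v_conjugate_minus[OF assms that] v_diff_commute[of c b] by auto
  moreover have "a - c \<noteq> 0" using assms not_in_K by auto
  ultimately show ?thesis
    unfolding eq using v_prod[OF conjugates_finite, of "\<lambda>b. c - b" "a - c"] conjugates_card conjugates_finite by auto
qed

end

sublocale galois_defect \<subseteq> immediate_generator v K p a g
  by (rule immediate_generator.intro[OF valuation_axioms], rule immediate_generator_axioms.intro)
    (fact K_field nat_units values_K residues_K not_in_K degree_a g_over g_lead degree_g g_at_K)+

context galois_defect
begin

lemma G_card: "finite G" "card G = p"
proof -
  have "inj_on (\<lambda>\<sigma>. \<sigma> a) G" by (auto intro!: inj_onI determined_by_a)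
  then have "bij_betw (\<lambda>\<sigma>. \<sigma> a) G conjugates" by (simp add: bij_betw_def conjugates_def)
  then show "finite G" "card G = p"
    using bij_betw_finite bij_betw_same_card conjugates_finite conjugates_card by blast+
qed

lemma moves_a: "\<sigma> \<in> G \<Longrightarrow> \<sigma> \<noteq> id \<Longrightarrow> \<sigma> a - a \<noteq> 0"
  using determined_by_a[of \<sigma> id] galois_group_id by auto

lemma galois_val_ge: "\<sigma> \<in> G \<Longrightarrow> val_ge \<gamma> (\<sigma> x) \<longleftrightarrow> val_ge \<gamma> x"
  using v_galois[of \<sigma> x] galois_groupD(8)[of \<sigma> K x] by (cases "x = 0") (simp_all add: val_ge_def)

text \<open>The automorphisms that move \<open>a\<close> no more than \<open>\<sigma>\<close> does form a subgroup. It contains \<open>\<sigma>\<close> and the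
group has prime order.\<close>
lemma shift_value_le:
  assumes s: "\<sigma> \<in> G" "\<sigma> \<noteq> id" and t: "\<tau> \<in> G"
  shows "val_ge (v (\<sigma> a - a)) (\<tau> a - a)"
proof -
  let ?M = "galois_monoid K" and ?H = "{\<tau>\<in>G. val_ge (v (\<sigma> a - a)) (\<tau> a - a)}"
  interpret group ?M by (rule group_galois_monoid)
  have comp: "\<rho> \<circ> \<tau> \<in> ?H" if "\<rho> \<in> ?H" "\<tau> \<in> ?H" for \<rho> \<tau>
  proof -
    have "val_ge (v (\<sigma> a - a)) (\<rho> (\<tau> a - a))"
      using that by (simp add: galois_val_ge)
    \<comment> \<open>This sum telescopes to \<open>(\<rho> \<circ> \<tau>) a - a\<close>.\<close>
    then have "val_ge (v (\<sigma> a - a)) (\<rho> (\<tau> a - a) + (\<rho> a - a))"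
      using that by (intro val_ge_add) auto
    then show ?thesis using that by (auto simp: galois_groupD galois_group_comp)
  qed
  have "subgroup ?H ?M"
  proof (rule subgroupI)
    show "?H \<noteq> {}" using galois_group_id by (auto intro!: exI[of _ id])
    fix \<tau> assume t: "\<tau> \<in> ?H"
    then have "inv_into UNIV \<tau> \<otimes>\<^bsub>?M\<^esub> \<tau> = \<one>\<^bsub>?M\<^esub>"
      using galois_groupD(7)[of \<tau> K] by (auto simp: galois_monoid_def bij_is_inj)
    then have inv: "inv\<^bsub>?M\<^esub> \<tau> = inv_into UNIV \<tau>"
      using t galois_group_inv[of \<tau> K] by (intro inv_equality) (auto simp: galois_monoid_def)
    have "\<tau> (inv_into UNIV \<tau> a - a) = - (\<tau> a - a)"
      using t galois_groupD(7)[of \<tau> K] by (auto simp: galois_groupD bij_is_surj surj_f_inv_f)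
    then have "val_ge (v (\<sigma> a - a)) (\<tau> (inv_into UNIV \<tau> a - a))"
      using t by (metis (no_types, lifting) mem_Collect_eq val_ge_minus)
    then have "val_ge (v (\<sigma> a - a)) (inv_into UNIV \<tau> a - a)"
      using t by (simp add: galois_val_ge)
    then show "inv\<^bsub>?M\<^esub> \<tau> \<in> ?H" using t galois_group_inv unfolding inv by blast
  qed (use comp in \<open>auto simp: galois_monoid_def\<close>)
  then have index: "card (rcosets\<^bsub>?M\<^esub> ?H) * card ?H = p"
    using lagrange_finite[of ?H] G_card by (simp add: galois_monoid_def Coset.order_def)
  have "card ?H dvd p" unfolding index[symmetric] by (rule dvd_triv_right)
  then have "card ?H = 1 \<or> card ?H = p"
    using p_prime unfolding prime_nat_iff by blast
  moreover have "card {id, \<sigma>} \<le> card ?H"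
    using s galois_group_id G_card(1) by (intro card_mono) auto
  ultimately have "card ?H = p" using s(2) by auto
  then have "?H = G" using G_card by (intro card_subset_eq) auto
  then show ?thesis using t by blast
qed

lemma G_nontrivial: "\<exists>\<sigma>\<in>G. \<sigma> \<noteq> id"
proof (rule ccontr)
  assume "\<not> ?thesis"
  then have "a \<in> K" by (intro fixed_field) fastforce
  then show False using not_in_K by simp
qed

text \<open>An element whose value is the distance by which every automorphism other than \<open>id\<close> moves \<open>a\<close>.\<close>
definition e :: 'l where "e = (SOME x. \<exists>\<sigma>\<in>G. \<sigma> \<noteq> id \<and> x = \<sigma> a - a)"

lemma e_shift: "\<exists>\<sigma>\<in>G. \<sigma> \<noteq> id \<and> e = \<sigma> a - a"
  unfolding e_def by (rule someI_ex) (use G_nontrivial in blast)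

lemma e_nz: "e \<noteq> 0"
  using e_shift moves_a by auto

lemma v_shift: "\<sigma> \<in> G \<Longrightarrow> \<sigma> \<noteq> id \<Longrightarrow> v (\<sigma> a - a) = v e"
proof -
  assume s: "\<sigma> \<in> G" "\<sigma> \<noteq> id"
  obtain \<tau> where t: "\<tau> \<in> G" "\<tau> \<noteq> id" "e = \<tau> a - a" using e_shift by blast
  show ?thesis
    using shift_value_le[OF s t(1)] shift_value_le[OF t(1,2) s(1)] moves_a[OF s] moves_a[OF t(1,2)]
    unfolding t(3) val_ge_def by (intro order.antisym) blast+
qed

text \<open>Elements of \<open>K\<close> are fixed, so \<open>\<sigma> a\<close> is as close to \<open>c\<close> as \<open>a\<close> is. This gives \<open>v (a - c) \<le> v e\<close>, and
strictness comes from applying it to an element of \<open>K\<close> closer to \<open>a\<close>.\<close>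
lemma a_c_less_e:
  assumes "c \<in> K"
  shows "v (a - c) < v e"
proof -
  obtain c' where c': "c' \<in> K" "v (a - c) < v (a - c')" using no_closest[OF assms] .
  obtain \<tau> where t: "\<tau> \<in> G" "e = \<tau> a - a" using e_shift by blast
  have "val_ge (v (a - c')) ((\<tau> a - c') - (a - c'))"
    using v_conjugate_minus[OF c'(1), of "\<tau> a"] t(1)
    by (intro val_ge_diff[of _ "\<tau> a - c'" "a - c'"]) (auto simp: conjugates_def val_ge_def)
  then show ?thesis using t(2) e_nz c'(2) by (simp add: val_ge_def)
qed

lemma v_pderiv_g: "poly (pderiv g) a \<noteq> 0" "v (poly (pderiv g) a) = v (e ^ (p - 1))"
proof -
  define h where "h = (\<Prod>b\<in>conjugates - {a}. [:- b, 1:])"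
  have "g = [:- a, 1:] * h"
    unfolding g_def h_def using conjugates_finite a_in_conjugates by (rule prod.remove)
  then have "poly (pderiv g) a = poly h a"
    by (simp only: pderiv_mult poly_add poly_mult) (simp add: pderiv_pCons)
  then have eq: "poly (pderiv g) a = (\<Prod>b\<in>conjugates - {a}. a - b)"
    by (simp add: h_def poly_prod)
  have "a - b \<noteq> 0 \<and> v (a - b) = v e" if b: "b \<in> conjugates - {a}" for b
  proof -
    obtain \<sigma> where "\<sigma> \<in> G" "b = \<sigma> a" using b by (auto simp: conjugates_def)
    moreover from this have "\<sigma> \<noteq> id" using b by auto
    ultimately show ?thesis using b v_shift[of \<sigma>] v_diff_commute[of a b] by auto
  qed
  then show "poly (pderiv g) a \<noteq> 0" "v (poly (pderiv g) a) = v (e ^ (p - 1))"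
    unfolding eq using v_prod[of "conjugates - {a}" "\<lambda>b. a - b" e] e_nz conjugates_finite conjugates_card a_in_conjugates
    by (auto simp: card_Diff_singleton)
qed

text \<open>The representation of an element of \<open>L = K[a]\<close> in the basis \<open>1, a, \<dots>, a^(p - 1)\<close>.\<close>
definition rep :: "'l \<Rightarrow> 'l poly" where
  "rep b = (SOME h. poly_over K h \<and> degree h < p \<and> poly h a = b)"

lemma rep: "poly_over K (rep b)" "degree (rep b) < p" "poly (rep b) a = b"
  using someI_ex[OF a_generates[of b]] unfolding rep_def by blast+

lemma rep_unique:
  assumes "poly_over K h" "degree h < p" "poly h a = b"
  shows "rep b = h"
proof (rule ccontr)
  assume "rep b \<noteq> h"
  then have "rep b - h \<noteq> 0" by simp
  moreover have "poly_over K (rep b - h)" by (rule poly_over_diff[OF K_ring rep(1) assms(1)])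
  moreover have "degree (rep b - h) < p" by (rule degree_diff_less[OF rep(2) assms(2)])
  moreover have "poly (rep b - h) a = 0" using rep(3) assms(3) by simp
  ultimately show False using degree_a by blast
qed

definition OK :: "'l set" where "OK = {x\<in>K. val_ge 0 x}"
definition OL :: "'l set" where "OL = {x. val_ge 0 x}"

lemma OK_ring: "subring OK ambient_field" and OL_ring: "subring OL ambient_field"
  unfolding OK_def OL_def using subring_val_ring_sub[OF K_ring] subring_val_ring by simp_all

lemma OK_le_OL: "OK \<subseteq> OL" by (auto simp: OK_def OL_def)

text \<open>A choice of \<open>c\<close> near \<open>a\<close>, with a scaling factor \<open>d\<close> that makes \<open>(a - c) / d\<close> a unit. The factor is
taken from \<open>K\<close> so that polynomials in this unit can have coefficients in \<open>\<O>_K\<close>.\<close>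
definition chart :: "'l \<Rightarrow> 'l \<Rightarrow> bool" where
  "chart c d \<longleftrightarrow> c \<in> K \<and> d \<in> K \<and> d \<noteq> 0 \<and> v d = v (a - c)"

definition coord :: "'l \<Rightarrow> 'l \<Rightarrow> 'l" where "coord c d = (a - c) / d"

lemma chart_exists: "c \<in> K \<Longrightarrow> \<exists>d. chart c d"
  using values_K[of "a - c"] by (auto simp: chart_def a_neq)

lemma coord_unit: "chart c d \<Longrightarrow> coord c d \<noteq> 0 \<and> v (coord c d) = 0"
  by (auto simp: chart_def coord_def v_divide a_neq)

lemma coord_OL: "chart c d \<Longrightarrow> coord c d \<in> OL"
  using coord_unit by (auto simp: OL_def val_ge_def)

lemma poly_chart: "chart c d \<Longrightarrow> poly (f \<circ>\<^sub>p [:c, d:]) (coord c d) = poly f a"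
  by (simp add: poly_pcompose chart_def coord_def)

text \<open>The value at \<open>a\<close> of such a polynomial is a polynomial over \<open>\<O>_K\<close> in the unit \<open>coord c d\<close>.\<close>
definition integral_in :: "'l \<Rightarrow> 'l \<Rightarrow> 'l poly \<Rightarrow> bool" where
  "integral_in c d f \<longleftrightarrow> poly_over OK (f \<circ>\<^sub>p [:c, d:])"

text \<open>This says that \<open>\<O>_L\<close> is the directed union of the rings \<open>\<O>_K[coord c d]\<close>. The coefficients of
\<open>rep b\<close>, rewritten in the coordinate, are up to units its Taylor terms at \<open>c\<close>, and by stability
none of them has smaller value than \<open>b\<close>.\<close>
lemma eventually_integral:
  assumes b: "b \<in> OL"
  shows "eventually (\<lambda>c. \<forall>d. chart c d \<longrightarrow> integral_in c d (rep b)) near_a"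
proof (cases "rep b = 0")
  case True
  then show ?thesis by (simp add: integral_in_def poly_over_0[OF OK_ring])
next
  case False
  let ?f = "rep b"
  have b0: "b \<noteq> 0" using degree_a[OF rep(1) False rep(2)] rep(3) by metis
  have "stable ?f" by (rule stable_if_small_degree[OF rep(1) False rep(2)])
  then show ?thesis unfolding stable_def rep(3)
  proof eventually_elim
    case (elim c)
    show ?case
    proof (intro allI impI)
      fix d assume cd: "chart c d"
      have "?f \<circ>\<^sub>p [:c, d:] = (?f \<circ>\<^sub>p [:c, 1:]) \<circ>\<^sub>p [:0, d:]"
        by (simp add: pcompose_pCons flip: pcompose_assoc)
      then have co: "coeff (?f \<circ>\<^sub>p [:c, d:]) i = d ^ i * coeff (?f \<circ>\<^sub>p [:c, 1:]) i" for i
        by (simp add: coeff_pcompose_linear)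
      have "poly_over K (?f \<circ>\<^sub>p [:c, d:])"
        using cd by (intro poly_over_pcompose[OF K_ring rep(1)])
          (auto simp: chart_def poly_over_pCons[OF K_ring] poly_over_0[OF K_ring])
      moreover have "val_ge 0 (coeff (?f \<circ>\<^sub>p [:c, d:]) i)" for i
      proof (cases "i = 0")
        case True
        have "coeff (?f \<circ>\<^sub>p [:c, 1:]) 0 = poly ?f c"
          using poly_pcompose[of ?f "[:c, 1:]" 0] by (simp add: poly_0_coeff_0)
        then show ?thesis using True elim b b0 by (auto simp: co OL_def val_ge_def)
      next
        case False
        then have "val_gt (v b) (coeff (?f \<circ>\<^sub>p [:c, 1:]) i * (a - c) ^ i)" using elim by auto
        moreover have "v ((a - c) ^ i) = v (d ^ i)"
          using cd by (intro v_power_cong) (auto simp: chart_def a_neq)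
        moreover have "0 \<le> v b" using b b0 by (simp add: OL_def val_ge_def)
        ultimately show ?thesis
          using cd by (cases "coeff (?f \<circ>\<^sub>p [:c, 1:]) i = 0")
            (auto simp: co val_gt_def val_ge_def v_mult chart_def a_neq add.commute)
      qed
      ultimately show "integral_in c d ?f"
        by (simp add: integral_in_def OK_def poly_over_def)
    qed
  qed
qed

text \<open>Multiplying \<open>b\<close> by an element of \<open>K\<close> does not change the quotient, so \<open>b\<close> may be taken to be a unit.
It is then an integral polynomial in \<open>coord c d\<close>, and \<open>\<sigma> b - b\<close> is divisible by
\<open>\<sigma> (coord c d) - coord c d = (\<sigma> a - a) / d\<close>.\<close>
lemma relative_shift_ge:
  assumes b: "b \<noteq> 0" and s: "\<sigma> \<in> G"
  shows "\<exists>c\<in>K. val_ge (v e - v (a - c)) ((\<sigma> b - b) / b)"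
proof -
  obtain k where k: "k \<in> K" "k \<noteq> 0" "v k = v b" using values_K[OF b] by blast
  define u where "u = b / k"
  have u: "u \<noteq> 0" "v u = 0" "u \<in> OL" using k b by (simp_all add: u_def v_divide OL_def val_ge_def)
  have "\<exists>c. c \<in> K \<and> (\<forall>d. chart c d \<longrightarrow> integral_in c d (rep u))"
    using eventually_happens'[OF near_a_not_bot eventually_conj[OF eventually_in_K eventually_integral[OF u(3)]]] .
  then obtain c d where cd: "c \<in> K" "chart c d" "integral_in c d (rep u)" using chart_exists by blast
  let ?h = "rep u \<circ>\<^sub>p [:c, d:]" and ?\<alpha> = "coord c d"
  have hK: "poly_over K ?h" and hL: "poly_over OL ?h"
    using cd(3) OK_le_OL by (auto simp: integral_in_def poly_over_def OK_def)
  have hu: "poly ?h ?\<alpha> = u" using poly_chart[OF cd(2)] rep(3) by simp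
  have "\<sigma> ?\<alpha> \<in> OL"
    using coord_unit[OF cd(2)] v_galois[OF s, of ?\<alpha>] by (auto simp: OL_def val_ge_def)
  then obtain q where q: "q \<in> OL" "poly ?h (\<sigma> ?\<alpha>) - poly ?h ?\<alpha> = (\<sigma> ?\<alpha> - ?\<alpha>) * q"
    using poly_diff_factor[OF OL_ring hL] coord_OL[OF cd(2)] by blast
  have "\<sigma> ?\<alpha> - ?\<alpha> = (\<sigma> a - a) / d"
    using cd(2) by (simp add: coord_def chart_def galois_groupD[OF s] diff_divide_distrib)
  moreover have "val_ge (v e) (\<sigma> a - a)"
    using v_shift[OF s] by (cases "\<sigma> = id") (auto simp: val_ge_def)
  ultimately have "val_ge (v e - v (a - c)) (\<sigma> ?\<alpha> - ?\<alpha>)"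
    using cd(2) by (cases "\<sigma> a = a") (auto simp: chart_def val_ge_def v_divide)
  then have "val_ge (v e - v (a - c)) (\<sigma> u - u)"
    using val_ge_mult[of "v e - v (a - c)" "\<sigma> ?\<alpha> - ?\<alpha>" 0 q] q galois_group_poly[OF s hK, of ?\<alpha>] hu
    by (simp add: OL_def)
  moreover have "(\<sigma> b - b) / b = (\<sigma> u - u) / u"
    using k b by (simp add: u_def galois_groupD[OF s] field_simps)
  ultimately show ?thesis
    using u cd(1) by (intro bexI[of _ c]; cases "\<sigma> u = u") (auto simp: val_ge_def v_divide)
qed

end


section \<open>The ramification ideal\<close>

context galois_defect
begin

text \<open>The union over all \<open>c\<close> of the fractional ideals generated by \<open>(e / (a - c))^n\<close>. For \<open>n = 1\<close> this is
the ramification ideal, and in general it is its \<open>n\<close>-th power.\<close>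
definition shift_ideal :: "nat \<Rightarrow> 'l set" where
  "shift_ideal n = {x. \<exists>c\<in>K. val_ge (v (e ^ n)) (x * (a - c) ^ n)}"

abbreviation R :: "'l ring" where "R \<equiv> val_ring v UNIV"

text \<open>The condition on \<open>c\<close> is preserved when \<open>c\<close> moves closer to \<open>a\<close>, so the union is directed.\<close>
lemma shift_ideal_iff:
  "x \<in> shift_ideal n \<longleftrightarrow> eventually (\<lambda>c. val_ge (v (e ^ n)) (x * (a - c) ^ n)) near_a"
proof
  assume "x \<in> shift_ideal n"
  then obtain c0 where c0: "c0 \<in> K" "val_ge (v (e ^ n)) (x * (a - c0) ^ n)" by (auto simp: shift_ideal_def)
  have "val_ge (v (e ^ n)) (x * (a - c) ^ n)" if c: "c \<in> K" "v (a - c0) \<le> v (a - c)" for c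
  proof (cases "x = 0")
    case False
    have "v ((a - c0) ^ n) \<le> v ((a - c) ^ n)"
      using c c0 by (intro v_power_mono) (auto simp: a_neq)
    then have "v (x * (a - c0) ^ n) \<le> v (x * (a - c) ^ n)"
      using False c c0 by (simp add: v_mult a_neq)
    then show ?thesis
      using c0 False by (auto simp: val_ge_def a_neq intro: order_trans)
  qed simp
  then show "eventually (\<lambda>c. val_ge (v (e ^ n)) (x * (a - c) ^ n)) near_a"
    unfolding eventually_near_a using c0(1) by blast
next
  assume "eventually (\<lambda>c. val_ge (v (e ^ n)) (x * (a - c) ^ n)) near_a"
  from eventually_happens'[OF near_a_not_bot eventually_conj[OF eventually_in_K this]]
  show "x \<in> shift_ideal n" by (auto simp: shift_ideal_def)
qed

lemma shift_ideal_0 [simp]: "0 \<in> shift_ideal n"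
  using Kc(1) by (auto simp: shift_ideal_def)

lemma shift_ideal_add: "x \<in> shift_ideal n \<Longrightarrow> y \<in> shift_ideal n \<Longrightarrow> x + y \<in> shift_ideal n"
  unfolding shift_ideal_iff
  by (erule (1) eventually_elim2) (auto simp: distrib_right intro: val_ge_add)

lemma shift_ideal_minus: "x \<in> shift_ideal n \<Longrightarrow> - x \<in> shift_ideal n"
  by (simp add: shift_ideal_def)

lemma shift_ideal_mult:
  assumes "x \<in> OL" "y \<in> shift_ideal n"
  shows "x * y \<in> shift_ideal n"
proof -
  obtain c where c: "c \<in> K" "val_ge (v (e ^ n)) (y * (a - c) ^ n)" using assms(2) by (auto simp: shift_ideal_def)
  have "val_ge (0 + v (e ^ n)) (x * (y * (a - c) ^ n))"
    using assms(1) c(2) by (intro val_ge_mult) (auto simp: OL_def)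
  then show ?thesis using c(1) by (auto simp: shift_ideal_def mult.assoc)
qed

lemma shift_ideal_OL: "shift_ideal n \<subseteq> OL"
proof
  fix x assume "x \<in> shift_ideal n"
  then obtain c where c: "c \<in> K" "val_ge (v (e ^ n)) (x * (a - c) ^ n)" by (auto simp: shift_ideal_def)
  have "v ((a - c) ^ n) \<le> v (e ^ n)"
    using c(1) a_c_less_e[OF c(1)] e_nz by (intro v_power_mono) (auto simp: a_neq)
  then have "val_ge (0 + v ((a - c) ^ n)) (x * (a - c) ^ n)" using c(2) by (auto intro: val_ge_trans)
  then show "x \<in> OL" using c(1) val_ge_cancel[of "(a - c) ^ n" 0 x] by (simp add: OL_def a_neq)
qed

lemma R_carrier: "carrier R = OL"
  by (simp add: OL_def)

lemma cring_R: "cring R"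
  by (rule cring_val_ring[OF subfield_UNIV])

lemma R_minus: "x \<in> OL \<Longrightarrow> \<ominus>\<^bsub>R\<^esub> x = - x"
  using val_ring_minus[OF subfield_UNIV] by (simp add: OL_def)

lemma shift_ideal_ideal: "ideal (shift_ideal n) R"
proof (rule idealI)
  interpret cring R by (rule cring_R)
  show "ring R" by (rule ring_axioms)
  show "subgroup (shift_ideal n) (add_monoid R)"
  proof (rule subgroup.intro)
    fix x assume x: "x \<in> shift_ideal n"
    then have "x \<in> OL" using shift_ideal_OL by blast
    then have "inv\<^bsub>add_monoid R\<^esub> x = - x" using R_minus by (simp add: a_inv_def)
    then show "inv\<^bsub>add_monoid R\<^esub> x \<in> shift_ideal n" using x shift_ideal_minus by simp
  qed (use shift_ideal_OL[of n] in \<open>auto simp: OL_def shift_ideal_add\<close>)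
  fix y x assume "y \<in> shift_ideal n" "x \<in> carrier R"
  then have "x * y \<in> shift_ideal n" using shift_ideal_mult by (simp add: OL_def)
  then show "x \<otimes>\<^bsub>R\<^esub> y \<in> shift_ideal n" "y \<otimes>\<^bsub>R\<^esub> x \<in> shift_ideal n" by (simp_all add: mult.commute)
qed

lemma shift_ideal_zero_power: "shift_ideal 0 = OL"
  using Kc(1) by (auto simp: shift_ideal_def OL_def)

text \<open>Directedness reduces products and sums to a single \<open>c\<close>. Conversely, an element \<open>x\<close> for \<open>c\<close> splits off
the factor \<open>(e / (a - c))^n\<close>.\<close>
lemma shift_ideal_prod: "ideal_prod R (shift_ideal n) (shift_ideal 1) = shift_ideal (Suc n)"
proof
  show "ideal_prod R (shift_ideal n) (shift_ideal 1) \<subseteq> shift_ideal (Suc n)"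
  proof
    fix x assume "x \<in> ideal_prod R (shift_ideal n) (shift_ideal 1)"
    then show "x \<in> shift_ideal (Suc n)"
    proof (induction rule: ideal_prod.induct)
      case (prod x y)
      then have "eventually (\<lambda>c. val_ge (v (e ^ n)) (x * (a - c) ^ n)) near_a"
        "eventually (\<lambda>c. val_ge (v (e ^ 1)) (y * (a - c) ^ 1)) near_a"
        by (simp_all only: shift_ideal_iff)
      then have "eventually (\<lambda>c. val_ge (v (e ^ Suc n)) (x * y * (a - c) ^ Suc n)) near_a"
      proof eventually_elim
        case (elim c)
        have "val_ge (v (e ^ n) + v (e ^ 1)) ((x * (a - c) ^ n) * (y * (a - c) ^ 1))"
          using elim by (rule val_ge_mult)
        then show ?case using e_nz by (simp add: v_mult mult_ac add_ac)
      qed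
      then show ?case by (simp add: shift_ideal_iff)
    qed (simp add: shift_ideal_add)
  qed
  show "shift_ideal (Suc n) \<subseteq> ideal_prod R (shift_ideal n) (shift_ideal 1)"
  proof
    fix x assume "x \<in> shift_ideal (Suc n)"
    then obtain c where c: "c \<in> K" "val_ge (v (e ^ Suc n)) (x * (a - c) ^ Suc n)" by (auto simp: shift_ideal_def)
    define y z where "y = e ^ n / (a - c) ^ n" and "z = x * (a - c) ^ n / e ^ n"
    have nz: "a - c \<noteq> 0" using c(1) by (simp add: a_neq)
    have "y \<in> shift_ideal n"
      unfolding shift_ideal_def using c(1) nz by (auto simp: y_def intro!: bexI[of _ c])
    moreover have eq: "z * (a - c) * e ^ n = x * (a - c) ^ Suc n"
      using e_nz by (simp add: z_def)
    have "val_ge (v e + v (e ^ n)) (z * (a - c) * e ^ n)"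
      unfolding eq using c(2) e_nz by (simp add: v_mult)
    then have "val_ge (v e) (z * (a - c))" using e_nz val_ge_cancel[of "e ^ n" "v e" "z * (a - c)"] by simp
    then have "z \<in> shift_ideal 1" using c(1) by (auto simp: shift_ideal_def)
    ultimately have "y \<otimes>\<^bsub>R\<^esub> z \<in> ideal_prod R (shift_ideal n) (shift_ideal 1)"
      by (rule ideal_prod.prod)
    moreover have "y * z = x" using nz e_nz by (simp add: y_def z_def)
    ultimately show "x \<in> ideal_prod R (shift_ideal n) (shift_ideal 1)" by simp
  qed
qed

lemma shift_ideal_power: "shift_ideal 1 [^]\<^bsub>ideals_set R\<^esub> n = shift_ideal n"
proof (induction n)
  case 0
  then show ?case using shift_ideal_zero_power R_carrier by (simp add: nat_pow_def ideals_set_def)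
next
  case (Suc n)
  then show ?case using shift_ideal_prod[of n] by (simp add: nat_pow_def ideals_set_def)
qed

definition jump :: "'g set" where
  "jump = {\<gamma> \<in> value_set v UNIV. \<exists>c\<in>K. v e - v (a - c) \<le> \<gamma>}"

lemma final_segment_jump: "final_segment v jump"
proof -
  have "0 < \<gamma>" if "c \<in> K" "v e - v (a - c) \<le> \<gamma>" for \<gamma> c
  proof -
    have "0 < v e - v (a - c)" using a_c_less_e[OF that(1)] by simp
    then show ?thesis using that(2) by (rule order.strict_trans2)
  qed
  moreover have "\<delta> \<in> jump" if "\<gamma> \<in> jump" "\<delta> \<in> value_set v UNIV" "\<gamma> \<le> \<delta>" for \<gamma> \<delta>
    using that order.trans[OF _ that(3)] unfolding jump_def by blast
  ultimately show ?thesis unfolding final_segment_def by (auto simp: jump_def)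
qed

lemma segment_ideal_jump: "segment_ideal v jump = shift_ideal 1"
proof -
  have "v x \<in> jump \<longleftrightarrow> x \<in> shift_ideal 1" if "x \<noteq> 0" for x
  proof -
    have "v e - v (a - c) \<le> v x \<longleftrightarrow> val_ge (v e) (x * (a - c))" if "c \<in> K" for c
      using \<open>x \<noteq> 0\<close> that by (simp add: val_ge_def a_neq v_mult diff_le_eq)
    then show ?thesis using that by (auto simp: jump_def shift_ideal_def value_set_def)
  qed
  then show ?thesis by (auto simp: segment_ideal_def)
qed

lemma ramification_subgroup_full:
  assumes "jump \<subseteq> S"
  shows "ramification_subgroup K v S = G"
proof -
  have "v ((\<sigma> b - b) / b) \<in> S" if "\<sigma> \<in> G" "b \<noteq> 0" "\<sigma> b - b \<noteq> 0" for \<sigma> b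
  proof -
    have nz: "(\<sigma> b - b) / b \<noteq> 0" using that by simp
    then have "v ((\<sigma> b - b) / b) \<in> value_set v UNIV" unfolding value_set_def by (intro imageI) simp
    then have "v ((\<sigma> b - b) / b) \<in> jump"
      using relative_shift_ge[OF that(2,1)] nz unfolding jump_def val_ge_def by blast
    then show ?thesis using assms by blast
  qed
  then show ?thesis unfolding ramification_subgroup_def by blast
qed

text \<open>For \<open>b = a - c\<close> and \<open>\<sigma> \<noteq> id\<close> the quotient \<open>(\<sigma> b - b) / b\<close> has value exactly \<open>v e - v (a - c)\<close>, so a
final segment whose subgroup contains \<open>\<sigma>\<close> contains all generators of \<open>jump\<close>.\<close>
lemma ramification_subgroup_trivial:
  assumes S: "final_segment v S" and "\<not> jump \<subseteq> S"
  shows "ramification_subgroup K v S = {id}"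
proof -
  have "\<sigma> = id" if s: "\<sigma> \<in> ramification_subgroup K v S" for \<sigma>
  proof (rule ccontr)
    assume nid: "\<sigma> \<noteq> id"
    have sG: "\<sigma> \<in> G" using s by (simp add: ramification_subgroup_def)
    have "v e - v (a - c) \<in> S" if c: "c \<in> K" for c
    proof -
      have nz: "a - c \<noteq> 0" using c by (simp add: a_neq)
      have eq: "\<sigma> (a - c) - (a - c) = \<sigma> a - a" using c sG by (simp add: galois_groupD[OF sG])
      have "\<forall>b. b \<noteq> 0 \<longrightarrow> \<sigma> b - b = 0 \<or> v ((\<sigma> b - b) / b) \<in> S"
        using s unfolding ramification_subgroup_def by blast
      from this[rule_format, OF nz] have "v ((\<sigma> a - a) / (a - c)) \<in> S"
        unfolding eq using moves_a[OF sG nid] by blast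
      then show ?thesis using moves_a[OF sG nid] v_shift[OF sG nid] c by (simp add: v_divide a_neq)
    qed
    then have "jump \<subseteq> S" using S unfolding jump_def final_segment_def by blast
    then show False using assms(2) by blast
  qed
  then show ?thesis using galois_group_id by (auto simp: ramification_subgroup_def)
qed

text \<open>The subgroup of a final segment is the whole group if the segment contains \<open>jump\<close> and trivial
otherwise. So \<open>jump\<close> is the only final segment at which the subgroup changes.\<close>
lemma ramification_jump_iff: "ramification_jump K v S \<longleftrightarrow> S = jump"
proof
  have ne: "jump \<noteq> {}"
  proof -
    have "a \<noteq> 0" using a_neq[OF Kc(1)] by simp
    have "v (e / a) \<in> value_set v UNIV"
      unfolding value_set_def using e_nz \<open>a \<noteq> 0\<close> by (intro imageI) simp
    moreover have "v (e / a) = v e - v (a - 0)"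
      using e_nz \<open>a \<noteq> 0\<close> by (simp add: v_divide)
    ultimately have "v (e / a) \<in> jump" using Kc(1) unfolding jump_def by (auto intro!: bexI[of _ 0])
    then show ?thesis by blast
  qed
  have proper: "{id} \<subset> G" using G_nontrivial galois_group_id by auto
  show "ramification_jump K v S" if "S = jump"
    unfolding that ramification_jump_def
    using final_segment_jump ne proper ramification_subgroup_full[of jump] ramification_subgroup_trivial
    by auto
  assume S: "ramification_jump K v S"
  then have final: "final_segment v S" by (simp add: ramification_jump_def)
  show "S = jump"
  proof (cases "jump \<subseteq> S")
    case True
    then show ?thesis
      using S final_segment_jump ramification_subgroup_full[of jump] ramification_subgroup_full[OF True]
      unfolding ramification_jump_def by (cases "jump = S") auto
  next
    case False
    have "final_segment v {}" by (simp add: final_segment_def)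
    moreover have "{} \<subset> S" using S by (auto simp: ramification_jump_def)
    ultimately have "ramification_subgroup K v {} \<subset> ramification_subgroup K v S"
      using S by (simp add: ramification_jump_def)
    moreover have "ramification_subgroup K v {} = {id}"
      using ne by (intro ramification_subgroup_trivial) (auto simp: final_segment_def)
    ultimately show ?thesis using ramification_subgroup_trivial[OF final False] by simp
  qed
qed

lemma ramification_ideal_iff: "ramification_ideal K v I \<longleftrightarrow> I = shift_ideal 1"
  unfolding ramification_ideal_def ramification_jump_iff using segment_ideal_jump by auto

lemma shift_ideal_nonzero: "shift_ideal 1 \<noteq> {0}"
proof -
  have "e / a \<in> shift_ideal 1"
    using Kc(1) a_neq[OF Kc(1)] by (auto simp: shift_ideal_def intro!: bexI[of _ 0])
  moreover have "e / a \<noteq> 0" using e_nz a_neq[OF Kc(1)] by simp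
  ultimately show ?thesis by blast
qed

end


section \<open>Quotients of modules\<close>

context module
begin

lemma submodule_abelian_subgroup: "submodule N R M \<Longrightarrow> abelian_subgroup N M"
  by (intro abelian_subgroupI3 additive_subgroup.intro submodule.axioms(1) M.abelian_group_axioms)

lemma coset_eq_iff:
  assumes N: "submodule N R M" and xy: "x \<in> carrier M" "y \<in> carrier M"
  shows "N +>\<^bsub>M\<^esub> y = N +>\<^bsub>M\<^esub> x \<longleftrightarrow> y \<ominus>\<^bsub>M\<^esub> x \<in> N"
proof -
  interpret N: abelian_subgroup N M by (rule submodule_abelian_subgroup[OF N])
  have "N +>\<^bsub>M\<^esub> y = N +>\<^bsub>M\<^esub> x \<longleftrightarrow> y \<in> N +>\<^bsub>M\<^esub> x"
    using N.a_rcos_self[OF xy(2)] M.a_repr_independence[OF _ xy(1) N.a_subgroup, of y] by blast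
  also have "\<dots> \<longleftrightarrow> y \<ominus>\<^bsub>M\<^esub> x \<in> N"
    using N.a_rcos_module_imp[OF xy(1), of y] N.a_rcos_module_rev[OF xy(1,2)] by (auto simp: a_minus_def)
  finally show ?thesis .
qed

lemma coset_smult:
  assumes N: "submodule N R M" and r: "r \<in> carrier R" and x: "x \<in> carrier M"
  shows "(\<Union>y\<in>N +>\<^bsub>M\<^esub> x. N +>\<^bsub>M\<^esub> (r \<odot>\<^bsub>M\<^esub> y)) = N +>\<^bsub>M\<^esub> (r \<odot>\<^bsub>M\<^esub> x)"
proof -
  interpret N: abelian_subgroup N M by (rule submodule_abelian_subgroup[OF N])
  have "N +>\<^bsub>M\<^esub> (r \<odot>\<^bsub>M\<^esub> y) = N +>\<^bsub>M\<^esub> (r \<odot>\<^bsub>M\<^esub> x)" if y: "y \<in> N +>\<^bsub>M\<^esub> x" for y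
  proof -
    have yM: "y \<in> carrier M" using y x by (meson N.a_subset M.a_r_coset_subset_G subsetD)
    have "y \<ominus>\<^bsub>M\<^esub> x \<in> N" using N.a_rcos_module_imp[OF x y] by (simp add: a_minus_def)
    then have "r \<odot>\<^bsub>M\<^esub> (y \<ominus>\<^bsub>M\<^esub> x) \<in> N" using submoduleE(4)[OF N] r by blast
    moreover have "r \<odot>\<^bsub>M\<^esub> (y \<ominus>\<^bsub>M\<^esub> x) = r \<odot>\<^bsub>M\<^esub> y \<ominus>\<^bsub>M\<^esub> r \<odot>\<^bsub>M\<^esub> x"
      using r x yM by (simp add: a_minus_def smult_r_distr smult_r_minus)
    ultimately show ?thesis using coset_eq_iff[OF N] r x yM by simp
  qed
  then show ?thesis using N.a_rcos_self[OF x] by blast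
qed

end

text \<open>The induced map on cosets. As a map of sets it sends a coset \<open>C\<close> to the union of the cosets of the
images of its elements, which all coincide.\<close>
lemma quotient_module_isomorphic:
  assumes M: "module R M" and N: "submodule N R M" and M': "module R M'" and N': "submodule N' R M'"
    and closed: "\<And>x. x \<in> carrier M \<Longrightarrow> \<Phi> x \<in> carrier M'"
    and add: "\<And>x y. x \<in> carrier M \<Longrightarrow> y \<in> carrier M \<Longrightarrow> \<Phi> (x \<oplus>\<^bsub>M\<^esub> y) = \<Phi> x \<oplus>\<^bsub>M'\<^esub> \<Phi> y"
    and smult: "\<And>r x. r \<in> carrier R \<Longrightarrow> x \<in> carrier M \<Longrightarrow> \<Phi> (r \<odot>\<^bsub>M\<^esub> x) = r \<odot>\<^bsub>M'\<^esub> \<Phi> x"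
    and surj: "\<And>y. y \<in> carrier M' \<Longrightarrow> \<exists>x\<in>carrier M. \<Phi> x = y"
    and kernel: "\<And>x. x \<in> carrier M \<Longrightarrow> \<Phi> x \<in> N' \<longleftrightarrow> x \<in> N"
  shows "module_isomorphic R (quotient_module M N) (quotient_module M' N')"
proof -
  interpret M: module R M by (rule M)
  interpret M': module R M' by (rule M')
  interpret N: abelian_subgroup N M by (rule M.submodule_abelian_subgroup[OF N])
  interpret N': abelian_subgroup N' M' by (rule M'.submodule_abelian_subgroup[OF N'])
  define h where "h C = (\<Union>x\<in>C. N' +>\<^bsub>M'\<^esub> \<Phi> x)" for C
  have minus: "\<Phi> (x \<ominus>\<^bsub>M\<^esub> y) = \<Phi> x \<ominus>\<^bsub>M'\<^esub> \<Phi> y" if "x \<in> carrier M" "y \<in> carrier M" for x y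
  proof -
    have "\<Phi> (x \<ominus>\<^bsub>M\<^esub> y) \<oplus>\<^bsub>M'\<^esub> \<Phi> y = \<Phi> x"
      using that add[of "x \<ominus>\<^bsub>M\<^esub> y" y] by (simp add: a_minus_def M.M.a_assoc M.M.l_neg)
    then show ?thesis
      using that closed by (metis M'.M.add.inv_solve_right' M'.M.minus_eq M.M.minus_closed)
  qed
  have eq_iff: "N' +>\<^bsub>M'\<^esub> \<Phi> x = N' +>\<^bsub>M'\<^esub> \<Phi> y \<longleftrightarrow> N +>\<^bsub>M\<^esub> x = N +>\<^bsub>M\<^esub> y"
    if "x \<in> carrier M" "y \<in> carrier M" for x y
    using that minus[of x y] kernel[of "x \<ominus>\<^bsub>M\<^esub> y"] M.coset_eq_iff[OF N that(2,1)]
      M'.coset_eq_iff[OF N' closed[OF that(2)] closed[OF that(1)]] by simp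
  have h: "h (N +>\<^bsub>M\<^esub> x) = N' +>\<^bsub>M'\<^esub> \<Phi> x" if x: "x \<in> carrier M" for x
  proof -
    have "N' +>\<^bsub>M'\<^esub> \<Phi> y = N' +>\<^bsub>M'\<^esub> \<Phi> x" if y: "y \<in> N +>\<^bsub>M\<^esub> x" for y
    proof -
      have "y \<in> carrier M" using y x by (meson N.a_subset M.M.a_r_coset_subset_G subsetD)
      moreover have "N +>\<^bsub>M\<^esub> y = N +>\<^bsub>M\<^esub> x" using M.M.a_repr_independence[OF y x N.a_subgroup] by simp
      ultimately show ?thesis using eq_iff x by blast
    qed
    then show ?thesis unfolding h_def using N.a_rcos_self[OF x] by blast
  qed
  have cosets: "a_rcosets\<^bsub>M\<^esub> N = (\<lambda>x. N +>\<^bsub>M\<^esub> x) ` carrier M" "a_rcosets\<^bsub>M'\<^esub> N' = (\<lambda>x. N' +>\<^bsub>M'\<^esub> x) ` carrier M'"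
    by (auto simp: A_RCOSETS_def')
  have "bij_betw h (a_rcosets\<^bsub>M\<^esub> N) (a_rcosets\<^bsub>M'\<^esub> N')"
  proof (rule bij_betw_imageI)
    show "inj_on h (a_rcosets\<^bsub>M\<^esub> N)" unfolding cosets using eq_iff h by (auto intro!: inj_onI)
    have "h ` (a_rcosets\<^bsub>M\<^esub> N) = (\<lambda>x. N' +>\<^bsub>M'\<^esub> \<Phi> x) ` carrier M"
      unfolding cosets image_image using h by simp
    also have "\<dots> = a_rcosets\<^bsub>M'\<^esub> N'" unfolding cosets using surj closed by blast
    finally show "h ` (a_rcosets\<^bsub>M\<^esub> N) = a_rcosets\<^bsub>M'\<^esub> N'" .
  qed
  moreover have "h (C <+>\<^bsub>M\<^esub> C') = h C <+>\<^bsub>M'\<^esub> h C'" if "C \<in> a_rcosets\<^bsub>M\<^esub> N" "C' \<in> a_rcosets\<^bsub>M\<^esub> N" for C C'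
    using that unfolding cosets by (auto simp: h add closed N.a_rcos_sum N'.a_rcos_sum)
  moreover have "h (\<Union>x\<in>C. N +>\<^bsub>M\<^esub> (r \<odot>\<^bsub>M\<^esub> x)) = (\<Union>y\<in>h C. N' +>\<^bsub>M'\<^esub> (r \<odot>\<^bsub>M'\<^esub> y))"
    if r: "r \<in> carrier R" and C: "C \<in> a_rcosets\<^bsub>M\<^esub> N" for r C
  proof -
    obtain x where x: "x \<in> carrier M" "C = N +>\<^bsub>M\<^esub> x" using C unfolding cosets by blast
    show ?thesis
      unfolding x(2) h[OF x(1)] M.coset_smult[OF N r x(1)]
        M'.coset_smult[OF N' r closed[OF x(1)]] h[OF M.smult_closed[OF r x(1)]]
        smult[OF r x(1)] by (rule refl)
  qed
  ultimately show ?thesis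
    unfolding module_isomorphic_def quotient_module_def by (intro exI[of _ h]) simp
qed

lemma free_module_carrier:
  "carrier (free_module R S) = {f. (\<forall>s. f s \<in> carrier R) \<and> finite {s. f s \<noteq> \<zero>\<^bsub>R\<^esub>} \<and> (\<forall>s. s \<notin> S \<longrightarrow> f s = \<zero>\<^bsub>R\<^esub>)}"
  by (simp add: free_module_def)

lemma free_module_simps [simp]:
  "x \<oplus>\<^bsub>free_module R S\<^esub> y = (\<lambda>s. x s \<oplus>\<^bsub>R\<^esub> y s)"
  "\<zero>\<^bsub>free_module R S\<^esub> = (\<lambda>s. \<zero>\<^bsub>R\<^esub>)"
  "r \<odot>\<^bsub>free_module R S\<^esub> x = (\<lambda>s. r \<otimes>\<^bsub>R\<^esub> x s)"
  by (simp_all add: free_module_def)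

lemma ideal_module_simps [simp]:
  "carrier (ideal_module R I) = I" "x \<oplus>\<^bsub>ideal_module R I\<^esub> y = x \<oplus>\<^bsub>R\<^esub> y"
  "\<zero>\<^bsub>ideal_module R I\<^esub> = \<zero>\<^bsub>R\<^esub>" "r \<odot>\<^bsub>ideal_module R I\<^esub> x = r \<otimes>\<^bsub>R\<^esub> x"
  by (simp_all add: ideal_module_def)

lemma (in cring) module_free_module: "module R (free_module R S)"
proof (rule moduleI)
  show "cring R" by (rule is_cring)
  show "abelian_group (free_module R S)"
  proof (rule abelian_groupI)
    show "x \<oplus>\<^bsub>free_module R S\<^esub> y \<in> carrier (free_module R S)"
      if "x \<in> carrier (free_module R S)" "y \<in> carrier (free_module R S)" for x y
    proof -
      have "{s. x s \<oplus> y s \<noteq> \<zero>} \<subseteq> {s. x s \<noteq> \<zero>} \<union> {s. y s \<noteq> \<zero>}" by auto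
      then show ?thesis using that by (auto simp: free_module_carrier intro: finite_subset)
    qed
    show "\<exists>y\<in>carrier (free_module R S). y \<oplus>\<^bsub>free_module R S\<^esub> x = \<zero>\<^bsub>free_module R S\<^esub>"
      if "x \<in> carrier (free_module R S)" for x
    proof (intro bexI[of _ "\<lambda>s. \<ominus> x s"])
      have "{s. \<ominus> x s \<noteq> \<zero>} \<subseteq> {s. x s \<noteq> \<zero>}" by auto
      then show "(\<lambda>s. \<ominus> x s) \<in> carrier (free_module R S)" using that by (auto simp: free_module_carrier intro: finite_subset)
    qed (use that in \<open>simp add: free_module_carrier l_neg\<close>)
  qed (auto simp: free_module_carrier a_ac fun_eq_iff)
  show "r \<odot>\<^bsub>free_module R S\<^esub> x \<in> carrier (free_module R S)"
    if "r \<in> carrier R" "x \<in> carrier (free_module R S)" for r x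
  proof -
    have "{s. r \<otimes> x s \<noteq> \<zero>} \<subseteq> {s. x s \<noteq> \<zero>}" using that by (auto simp: free_module_carrier)
    then show ?thesis using that by (auto simp: free_module_carrier intro: finite_subset)
  qed
qed (auto simp: free_module_carrier l_distr r_distr m_assoc)

lemma (in cring) free_gen_closed: "s \<in> S \<Longrightarrow> free_gen R s \<in> carrier (free_module R S)"
  by (auto simp: free_module_carrier free_gen_def)

lemma (in cring) module_ideal_module:
  assumes "ideal I R"
  shows "module R (ideal_module R I)"
proof -
  interpret I: ideal I R by (rule assms)
  show ?thesis
  proof (rule moduleI)
    show "abelian_group (ideal_module R I)"
      by (rule abelian_groupI)
        (auto simp: a_ac I.Icarr r_neg intro!: bexI[of _ "\<ominus> _"])
  qed (auto simp: is_cring I.I_l_closed l_distr r_distr m_assoc I.Icarr)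
qed

lemma (in cring) ideal_submodule:
  assumes I: "ideal I R" and J: "ideal J R" "J \<subseteq> I"
  shows "submodule J R (ideal_module R I)"
proof -
  interpret I: ideal I R by (rule I)
  interpret J: ideal J R by (rule J(1))
  interpret M: module R "ideal_module R I" by (rule module_ideal_module[OF I])
  show ?thesis
  proof (rule M.submoduleI)
    fix x assume x: "x \<in> J"
    have "\<ominus>\<^bsub>ideal_module R I\<^esub> x = \<ominus> x"
      using x J(2) by (intro M.M.minus_equality) (auto simp: l_neg J.Icarr)
    then show "\<ominus>\<^bsub>ideal_module R I\<^esub> x \<in> J" using x by simp
  qed (use J(2) in \<open>auto simp: J.I_l_closed\<close>)
qed

lemma (in module) generated_submodule_submodule:
  assumes "submodule N0 R M" "G \<subseteq> N0"
  shows "submodule (generated_submodule R M G) R M" "G \<subseteq> generated_submodule R M G"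
    "generated_submodule R M G \<subseteq> N0"
proof -
  show sub: "generated_submodule R M G \<subseteq> N0" and "G \<subseteq> generated_submodule R M G"
    using assms by (auto simp: generated_submodule_def)
  show "submodule (generated_submodule R M G) R M"
  proof (rule submoduleI)
    show "generated_submodule R M G \<subseteq> carrier M" using sub submoduleE(1)[OF assms(1)] by blast
    show "\<zero>\<^bsub>M\<^esub> \<in> generated_submodule R M G"
      using submodule.axioms(1) subgroup.one_closed by (fastforce simp: generated_submodule_def)
  qed (auto simp: generated_submodule_def submoduleE)
qed


section \<open>Differentials\<close>

text \<open>The basis vectors of the free module, as functions on the whole field.\<close>
definition single :: "'a::field \<Rightarrow> 'a \<Rightarrow> 'a" where "single b = (\<lambda>t. if t = b then 1 else 0)"

text \<open>A submodule of functions that contains the relations of the module of differentials of \<open>B\<close> over \<open>A\<close>.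
Membership of \<open>x - y\<close> means that \<open>x\<close> and \<open>y\<close> represent the same differential.\<close>
locale differential_relations =
  fixes A B :: "'l::field set" and N :: "('l \<Rightarrow> 'l) set"
  assumes A: "subring A ambient_field" and B: "subring B ambient_field" and AB: "A \<subseteq> B"
    and zero: "(\<lambda>t. 0) \<in> N"
    and add: "x \<in> N \<Longrightarrow> y \<in> N \<Longrightarrow> (\<lambda>t. x t + y t) \<in> N"
    and smult: "r \<in> B \<Longrightarrow> x \<in> N \<Longrightarrow> (\<lambda>t. r * x t) \<in> N"
    and d_add: "b \<in> B \<Longrightarrow> c \<in> B \<Longrightarrow> (\<lambda>t. single (b + c) t - (single b t + single c t)) \<in> N"
    and d_mult: "b \<in> B \<Longrightarrow> c \<in> B \<Longrightarrow> (\<lambda>t. single (b * c) t - (b * single c t + c * single b t)) \<in> N"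
    and d_const: "b \<in> A \<Longrightarrow> single b \<in> N"
begin

lemma sum_closed: "(\<And>i. i \<in> I \<Longrightarrow> x i \<in> N) \<Longrightarrow> (\<lambda>t. \<Sum>i\<in>I. x i t) \<in> N"
proof (induction I rule: infinite_finite_induct)
  case (insert i I)
  then show ?case using add[of "x i" "\<lambda>t. \<Sum>i\<in>I. x i t"] by simp
qed (simp_all add: zero)

text \<open>The chain rule \<open>d (h \<alpha>) = h' \<alpha> d\<alpha>\<close>, valid as the coefficients of \<open>h\<close> are constants.\<close>
lemma d_poly:
  assumes h: "poly_over A h" and \<alpha>: "\<alpha> \<in> B"
  shows "(\<lambda>t. single (poly h \<alpha>) t - poly (pderiv h) \<alpha> * single \<alpha> t) \<in> N"
  using h
proof (induction h)
  case 0
  have "single 0 \<in> N" using d_const subring_ambientD(1)[OF A] by blast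
  then show ?case by simp
next
  case (pCons c h)
  let ?u = "poly h \<alpha>" and ?u' = "poly (pderiv h) \<alpha>"
  have c: "c \<in> A" "poly_over A h" using pCons.prems by (simp_all add: poly_over_pCons[OF A])
  have "poly_over B h" using c(2) AB by (auto simp: poly_over_def)
  then have u: "?u \<in> B" by (rule poly_over_eval[OF B _ \<alpha>])
  note Bc = subring_ambientD[OF B]
  have 1: "(\<lambda>t. single (c + \<alpha> * ?u) t - (single c t + single (\<alpha> * ?u) t)) \<in> N"
    using c AB u \<alpha> by (intro d_add Bc) auto
  have 2: "(\<lambda>t. single (\<alpha> * ?u) t - (\<alpha> * single ?u t + ?u * single \<alpha> t)) \<in> N"
    using u \<alpha> by (intro d_mult)
  have 3: "(\<lambda>t. \<alpha> * (single ?u t - ?u' * single \<alpha> t)) \<in> N"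
    using smult[OF \<alpha> pCons.IH[OF c(2)]] .
  have 4: "single c \<in> N" by (rule d_const[OF c(1)])
  have "(\<lambda>t. single (poly (pCons c h) \<alpha>) t - poly (pderiv (pCons c h)) \<alpha> * single \<alpha> t) =
    (\<lambda>t. ((single (c + \<alpha> * ?u) t - (single c t + single (\<alpha> * ?u) t)) +
       (single (\<alpha> * ?u) t - (\<alpha> * single ?u t + ?u * single \<alpha> t))) +
       (\<alpha> * (single ?u t - ?u' * single \<alpha> t) + single c t))"
    by (rule ext) (simp add: pderiv_pCons algebra_simps)
  also have "\<dots> \<in> N" using add[OF add[OF 1 2] add[OF 3 4]] by simp
  finally show ?case .
qed

text \<open>If all symbols that occur in \<open>x\<close> stand for polynomials in one element \<open>\<alpha>\<close>, then \<open>x\<close> represents a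
multiple of \<open>d\<alpha>\<close>, with the sum in the last hypothesis as its coefficient. An equation \<open>q \<alpha> = 0\<close> gives
\<open>q' \<alpha> d\<alpha> = 0\<close>, so the differential vanishes if \<open>q' \<alpha>\<close> divides the coefficient.\<close>
lemma d_collapse:
  assumes S: "finite S" "\<And>b. b \<in> S \<Longrightarrow> x b \<in> B" "\<And>b. b \<notin> S \<Longrightarrow> x b = 0"
    and h: "\<And>b. b \<in> S \<Longrightarrow> poly_over A (h b) \<and> poly (h b) \<alpha> = b" and \<alpha>: "\<alpha> \<in> B"
    and q: "poly_over A q" "poly q \<alpha> = 0"
    and dvd: "\<exists>r\<in>B. (\<Sum>b\<in>S. x b * poly (pderiv (h b)) \<alpha>) = r * poly (pderiv q) \<alpha>"
  shows "x \<in> N"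
proof -
  let ?c = "\<Sum>b\<in>S. x b * poly (pderiv (h b)) \<alpha>"
  obtain r where r: "r \<in> B" "?c = r * poly (pderiv q) \<alpha>" using dvd by blast
  have "(\<lambda>t. \<Sum>b\<in>S. x b * (single b t - poly (pderiv (h b)) \<alpha> * single \<alpha> t)) \<in> N"
    using S(2) h d_poly[OF _ \<alpha>] by (intro sum_closed smult) force+
  moreover have "(\<Sum>b\<in>S. x b * single b t) = x t" for t
  proof -
    have "x b * single b t = (if t = b then x b else 0)" for b by (simp add: single_def)
    then show ?thesis using S(1) S(3)[of t] by (simp add: sum.delta)
  qed
  then have "(\<Sum>b\<in>S. x b * (single b t - poly (pderiv (h b)) \<alpha> * single \<alpha> t)) = x t - ?c * single \<alpha> t" for t
    by (simp add: right_diff_distrib sum_subtractf sum_distrib_right mult.assoc)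
  ultimately have 1: "(\<lambda>t. x t - ?c * single \<alpha> t) \<in> N" by simp
  have 2: "(\<lambda>t. - r * (single (poly q \<alpha>) t - poly (pderiv q) \<alpha> * single \<alpha> t)) \<in> N"
    by (rule smult[OF subring_ambientD(5)[OF B r(1)] d_poly[OF q(1) \<alpha>]])
  have 3: "(\<lambda>t. r * single 0 t) \<in> N"
    using r(1) d_const[OF subring_ambientD(1)[OF A]] by (rule smult)
  have "x = (\<lambda>t. (x t - ?c * single \<alpha> t) + (- r * (single (poly q \<alpha>) t - poly (pderiv q) \<alpha> * single \<alpha> t) + r * single 0 t))"
    unfolding r(2) by (rule ext) (simp add: q(2) algebra_simps)
  then show "x \<in> N" using add[OF 1 add[OF 2 3]] by simp
qed

end

context galois_defect
begin

text \<open>Differentiation with respect to \<open>a\<close>, scaled by \<open>e\<close>. It is not quite a derivation, because products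
have to be reduced modulo the minimal polynomial of \<open>a\<close>.\<close>
definition D :: "'l \<Rightarrow> 'l" where "D b = e * poly (pderiv (rep b)) a"

lemma integral_inD:
  assumes cd: "chart c d" and f: "integral_in c d f"
  shows "poly_over OK (f \<circ>\<^sub>p [:c, d:])" "poly (f \<circ>\<^sub>p [:c, d:]) (coord c d) = poly f a"
    "poly (pderiv (f \<circ>\<^sub>p [:c, d:])) (coord c d) = d * poly (pderiv f) a"
  using f poly_chart[OF cd] poly_chart[OF cd, of "pderiv f"]
  by (simp_all add: integral_in_def pderiv_pcompose pderiv_pCons)

text \<open>The minimal polynomial of \<open>coord c d\<close>.\<close>
definition g_chart :: "'l \<Rightarrow> 'l \<Rightarrow> 'l poly" where
  "g_chart c d = smult (inverse (d ^ p)) (g \<circ>\<^sub>p [:c, d:])"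

lemma g_chart:
  assumes cd: "chart c d"
  shows "lead_coeff (g_chart c d) = 1" "degree (g_chart c d) = p" "poly_over OK (g_chart c d)"
    "g \<circ>\<^sub>p [:c, d:] = smult (d ^ p) (g_chart c d)" "poly (g_chart c d) (coord c d) = 0"
    "d ^ (p - 1) * poly (pderiv (g_chart c d)) (coord c d) = poly (pderiv g) a"
proof -
  have d: "d \<noteq> 0" "d \<in> K" "c \<in> K" "v d = v (a - c)" using cd by (auto simp: chart_def)
  have "[:- b, 1:] \<circ>\<^sub>p [:c, d:] = smult d [:(c - b) / d, 1:]" for b
    using d by (simp add: pcompose_pCons)
  then have "g \<circ>\<^sub>p [:c, d:] = (\<Prod>b\<in>conjugates. smult d [:(c - b) / d, 1:])"
    by (simp add: g_def pcompose_prod)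
  also have "\<dots> = smult (d ^ p) (\<Prod>b\<in>conjugates. [:(c - b) / d, 1:])"
    by (simp only: prod_smult prod_constant conjugates_card)
  finally have prod: "g_chart c d = (\<Prod>b\<in>conjugates. [:(c - b) / d, 1:])"
    using d by (simp add: g_chart_def)
  show "lead_coeff (g_chart c d) = 1" unfolding prod by (simp add: lead_coeff_prod)
  show "degree (g_chart c d) = p" unfolding prod by (simp add: degree_prod_eq_sum_degree conjugates_card)
  show eq: "g \<circ>\<^sub>p [:c, d:] = smult (d ^ p) (g_chart c d)" using d by (simp add: g_chart_def)
  have "(c - b) / d \<in> OL" if "b \<in> conjugates" for b
    using v_conjugate_minus[OF d(3) that] d v_diff_commute[of c b] by (auto simp: OL_def val_ge_def v_divide)
  then have "poly_over OL (g_chart c d)"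
    unfolding prod by (intro poly_over_prod[OF OL_ring])
      (auto simp: poly_over_pCons[OF OL_ring] poly_over_0[OF OL_ring] subring_ambientD[OF OL_ring])
  moreover have "poly_over K (g_chart c d)"
    unfolding g_chart_def using d
    by (intro poly_over_smult[OF K_ring] poly_over_pcompose[OF K_ring g_over] Kc subring_power[OF K_ring])
      (auto simp: poly_over_pCons[OF K_ring] poly_over_0[OF K_ring])
  ultimately show "poly_over OK (g_chart c d)" by (auto simp: poly_over_def OK_def OL_def)
  show "poly (g_chart c d) (coord c d) = 0"
    using poly_chart[OF cd, of g] g_at_a by (simp add: g_chart_def)
  have "poly (pderiv (g_chart c d)) (coord c d) = inverse (d ^ p) * (d * poly (pderiv g) a)"
    using poly_chart[OF cd, of "pderiv g"]
    by (simp add: g_chart_def pderiv_smult pderiv_pcompose pderiv_pCons)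
  then show "d ^ (p - 1) * poly (pderiv (g_chart c d)) (coord c d) = poly (pderiv g) a"
    using d p_pos by (cases p) (simp_all add: field_simps)
qed

text \<open>Reducing \<open>f\<close> modulo \<open>g\<close> changes the derivative at \<open>a\<close> by \<open>q a * g' a\<close>, where \<open>q\<close> is the quotient. In the
coordinate \<open>coord c d\<close> this is a division by a monic polynomial over \<open>\<O>_K\<close>, so \<open>d^p * q a\<close> is
integral, while \<open>e * g' a\<close> has the value of \<open>e^p\<close>. The error therefore lies in the ideal generated
by \<open>(e / d)^p\<close>.\<close>
lemma D_eq_mod:
  assumes cd: "chart c d" and f: "poly_over K f" "integral_in c d f"
  shows "e * poly (pderiv f) a - D (poly f a) \<in> shift_ideal p"
proof -
  have d: "d \<noteq> 0" "c \<in> K" "v d = v (a - c)" using cd by (auto simp: chart_def)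
  define q r where "q = f div g" and "r = f mod g"
  have g0: "g \<noteq> 0" using g_lead by auto
  have fqr: "f = q * g + r" by (simp only: q_def r_def div_mult_mod_eq)
  have "poly_over K r"
    unfolding r_def using poly_over_div_mod(2)[OF K_ring g_over g0 _ f(1)] g_lead Kc(2) by simp
  moreover have dr: "degree r < p"
    using degree_mod_less[OF g0, of f] degree_g p_pos by (auto simp: r_def)
  moreover have "poly r a = poly f a" using g_at_a by (simp add: fqr)
  ultimately have "rep (poly f a) = r" by (intro rep_unique)
  then have diff: "e * poly (pderiv f) a - D (poly f a) = e * poly q a * poly (pderiv g) a"
    using g_at_a by (simp add: D_def fqr pderiv_add pderiv_mult algebra_simps)
  let ?q = "smult (d ^ p) (q \<circ>\<^sub>p [:c, d:])" and ?g = "g_chart c d"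
  have gc0: "?g \<noteq> 0" using g_chart(1)[OF cd] by auto
  have "f \<circ>\<^sub>p [:c, d:] = ?q * ?g + r \<circ>\<^sub>p [:c, d:]"
    unfolding fqr pcompose_add pcompose_mult g_chart(4)[OF cd] by simp
  moreover have "(r \<circ>\<^sub>p [:c, d:]) div ?g = 0"
    using dr d g_chart(2)[OF cd] by (intro div_poly_less) (simp add: degree_pcompose)
  ultimately have "(f \<circ>\<^sub>p [:c, d:]) div ?g = ?q"
    using div_mult_self3[OF gc0, of ?q "r \<circ>\<^sub>p [:c, d:]"] by simp
  moreover have "poly_over OK ((f \<circ>\<^sub>p [:c, d:]) div ?g)"
    using f(2) g_chart(1,3)[OF cd] gc0 subring_ambientD(2)[OF OK_ring]
    by (intro poly_over_div_mod(1)[OF OK_ring]) (auto simp: integral_in_def)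
  ultimately have "poly_over OL ?q" using OK_le_OL by (auto simp: poly_over_def)
  from poly_over_eval[OF OL_ring this coord_OL[OF cd]] have "val_ge 0 (d ^ p * poly q a)"
    using poly_chart[OF cd, of q] by (simp add: OL_def)
  then have "val_ge (0 + v (e * poly (pderiv g) a)) (d ^ p * poly q a * (e * poly (pderiv g) a))"
    by (rule val_ge_mult) simp
  moreover have "v (e * poly (pderiv g) a) = v (e ^ p)"
    using v_pderiv_g e_nz p_pos by (simp add: v_mult power_eq_if[of e p])
  ultimately have "val_ge (v (e ^ p)) ((e * poly q a * poly (pderiv g) a) * d ^ p)" by (simp add: mult_ac)
  moreover have "v (d ^ p) = v ((a - c) ^ p)"
    using d by (intro v_power_cong) (auto simp: a_neq)
  ultimately have "val_ge (v (e ^ p)) ((e * poly q a * poly (pderiv g) a) * (a - c) ^ p)"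
    using d by (cases "e * poly q a * poly (pderiv g) a = 0") (auto simp: val_ge_def v_mult a_neq)
  then show ?thesis unfolding diff using d(2) by (auto simp: shift_ideal_def)
qed

lemma D_const: "k \<in> K \<Longrightarrow> D k = 0"
proof -
  assume "k \<in> K"
  then have "rep k = [:k:]"
    using p_pos by (intro rep_unique) (simp_all add: poly_over_pCons[OF K_ring] poly_over_0[OF K_ring])
  then show "D k = 0" by (simp add: D_def pderiv_pCons)
qed

lemma D_add: "D (b + c) = D b + D c"
proof -
  have "rep (b + c) = rep b + rep c"
    using rep[of b] rep[of c] by (intro rep_unique poly_over_add[OF K_ring] degree_add_less) auto
  then show ?thesis by (simp add: D_def pderiv_add algebra_simps)
qed

lemma common_chart:
  assumes "finite S" "S \<subseteq> OL" "eventually P near_a"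
  obtains c d where "chart c d" "P c" "\<And>b. b \<in> S \<Longrightarrow> integral_in c d (rep b)"
proof -
  have "eventually (\<lambda>c. \<forall>b\<in>S. \<forall>d. chart c d \<longrightarrow> integral_in c d (rep b)) near_a"
    using assms eventually_integral by (auto simp: eventually_ball_finite_distrib)
  from eventually_happens'[OF near_a_not_bot eventually_conj[OF eventually_in_K eventually_conj[OF this assms(3)]]]
  obtain c where c: "c \<in> K" "\<forall>b\<in>S. \<forall>d. chart c d \<longrightarrow> integral_in c d (rep b)" "P c" by blast
  obtain d where "chart c d" using chart_exists[OF c(1)] by blast
  then show thesis using that c by blast
qed

text \<open>The product of two representations is integral in a common chart and has the derivative that the
product rule demands; \<open>D_eq_mod\<close> compares it with the representation of the product.\<close>
lemma D_mult:
  assumes "b \<in> OL" "c \<in> OL"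
  shows "D (b * c) - (b * D c + c * D b) \<in> shift_ideal p"
proof -
  obtain c0 d where cd: "chart c0 d" "\<And>x. x \<in> {b, c} \<Longrightarrow> integral_in c0 d (rep x)"
    using common_chart[of "{b, c}" "\<lambda>_. True"] assms by auto
  have "integral_in c0 d (rep b * rep c)"
    using cd(2)[of b] cd(2)[of c] by (simp add: integral_in_def pcompose_mult poly_over_mult[OF OK_ring])
  from D_eq_mod[OF cd(1) poly_over_mult[OF K_ring rep(1) rep(1)] this]
  have "e * poly (pderiv (rep b * rep c)) a - D (b * c) \<in> shift_ideal p" by (simp add: rep(3))
  moreover have "e * poly (pderiv (rep b * rep c)) a = b * D c + c * D b"
    by (simp add: pderiv_mult D_def rep(3) algebra_simps)
  ultimately show ?thesis using shift_ideal_minus[of "b * D c + c * D b - D (b * c)" p] by simp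
qed

lemma D_chart:
  assumes cd: "chart c d" and b: "integral_in c d (rep b)"
  shows "D b = e / d * poly (pderiv (rep b \<circ>\<^sub>p [:c, d:])) (coord c d)"
  using integral_inD(3)[OF cd b] cd by (simp add: D_def chart_def)

text \<open>In a suitable chart, \<open>D b\<close> is \<open>e / d\<close> times the derivative of an integral polynomial.\<close>
lemma D_in_shift_ideal:
  assumes b: "b \<in> OL"
  shows "D b \<in> shift_ideal 1"
proof -
  obtain c d where cd: "chart c d" "integral_in c d (rep b)"
    using common_chart[of "{b}" "\<lambda>_. True"] b by auto
  let ?y = "poly (pderiv (rep b \<circ>\<^sub>p [:c, d:])) (coord c d)"
  have "poly_over OL (rep b \<circ>\<^sub>p [:c, d:])"
    using integral_inD(1)[OF cd] OK_le_OL by (auto simp: poly_over_def)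
  then have y: "?y \<in> OL"
    by (intro poly_over_eval[OF OL_ring] poly_over_pderiv[OF OL_ring] coord_OL[OF cd(1)])
  have "e / d \<in> shift_ideal 1"
    using cd(1) e_nz by (auto simp: shift_ideal_def chart_def val_ge_def v_mult v_divide a_neq intro!: bexI[of _ c])
  from shift_ideal_mult[OF y this] show ?thesis unfolding D_chart[OF cd] by (simp add: mult.commute)
qed

lemma D_coord:
  assumes cd: "chart c d"
  shows "D (coord c d) = e / d"
proof -
  have d: "d \<noteq> 0" "d \<in> K" "c \<in> K" using cd by (auto simp: chart_def)
  have "rep (coord c d) = [:- c / d, 1 / d:]"
  proof (rule rep_unique)
    show "poly_over K [:- c / d, 1 / d:]"
      using d by (auto simp: poly_over_pCons[OF K_ring] poly_over_0[OF K_ring] intro: Kc)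
    show "poly [:- c / d, 1 / d:] a = coord c d" by (simp add: coord_def diff_divide_distrib)
  qed (use p_gt1 d in simp)
  then show ?thesis by (simp add: D_def pderiv_pCons)
qed

end


section \<open>The isomorphism\<close>

context galois_defect
begin

abbreviation F :: "('l, 'l \<Rightarrow> 'l) module" where "F \<equiv> free_module R OL"

lemma F_carrier: "x \<in> carrier F \<longleftrightarrow> (\<forall>b. x b \<in> OL) \<and> finite {b. x b \<noteq> 0} \<and> (\<forall>b. x b \<noteq> 0 \<longrightarrow> b \<in> OL)"
  by (auto simp: free_module_carrier R_carrier[symmetric] simp del: val_ring_simps(5))

lemma module_F: "module R F"
  by (rule cring.module_free_module[OF cring_R])

lemma free_gen_R: "free_gen R b = single b"
  by (rule ext) (simp add: free_gen_def single_def)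

lemma single_in_F: "b \<in> OL \<Longrightarrow> single b \<in> carrier F"
  using cring.free_gen_closed[OF cring_R, of b OL] free_gen_R by simp

lemma F_add: "x \<in> carrier F \<Longrightarrow> y \<in> carrier F \<Longrightarrow> (\<lambda>t. x t + y t) \<in> carrier F"
proof -
  interpret module R F by (rule module_F)
  show "x \<in> carrier F \<Longrightarrow> y \<in> carrier F \<Longrightarrow> (\<lambda>t. x t + y t) \<in> carrier F"
    using M.a_closed[of x y] by simp
qed

lemma F_smult: "r \<in> OL \<Longrightarrow> x \<in> carrier F \<Longrightarrow> (\<lambda>t. r * x t) \<in> carrier F"
  using module.smult_closed[OF module_F, of r x] R_carrier by (simp add: OL_def)

lemma F_minus:
  assumes "x \<in> carrier F" "y \<in> carrier F"
  shows "x \<ominus>\<^bsub>F\<^esub> y = (\<lambda>t. x t - y t)"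
proof -
  interpret module R F by (rule module_F)
  have "(\<lambda>t. - y t) \<in> carrier F"
    using assms(2) unfolding F_carrier by (auto simp: OL_def)
  then have "\<ominus>\<^bsub>F\<^esub> y = (\<lambda>t. - y t)"
    using assms(2) by (intro M.minus_equality) simp_all
  then show ?thesis by (simp add: a_minus_def)
qed

text \<open>The linear map that sends the basis vector of \<open>b\<close> to \<open>D b\<close>.\<close>
definition \<Phi> :: "('l \<Rightarrow> 'l) \<Rightarrow> 'l" where "\<Phi> x = (\<Sum>b | x b \<noteq> 0. x b * D b)"

lemma \<Phi>_eq: "finite S \<Longrightarrow> {b. x b \<noteq> 0} \<subseteq> S \<Longrightarrow> \<Phi> x = (\<Sum>b\<in>S. x b * D b)"
  unfolding \<Phi>_def by (intro sum.mono_neutral_left) auto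

lemma \<Phi>_add:
  assumes "x \<in> carrier F" "y \<in> carrier F"
  shows "\<Phi> (\<lambda>b. x b + y b) = \<Phi> x + \<Phi> y"
proof -
  let ?S = "{b. x b \<noteq> 0} \<union> {b. y b \<noteq> 0}"
  have fin: "finite ?S" using assms by (simp add: F_carrier)
  have "\<Phi> (\<lambda>b. x b + y b) = (\<Sum>b\<in>?S. (x b + y b) * D b)" by (rule \<Phi>_eq[OF fin]) auto
  also have "\<dots> = (\<Sum>b\<in>?S. x b * D b) + (\<Sum>b\<in>?S. y b * D b)" by (simp add: distrib_right sum.distrib)
  also have "\<dots> = \<Phi> x + \<Phi> y" using \<Phi>_eq[OF fin, of x] \<Phi>_eq[OF fin, of y] by auto
  finally show ?thesis .
qed

lemma \<Phi>_smult:
  assumes "x \<in> carrier F"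
  shows "\<Phi> (\<lambda>b. r * x b) = r * \<Phi> x"
proof -
  have fin: "finite {b. x b \<noteq> 0}" using assms by (simp add: F_carrier)
  have "\<Phi> (\<lambda>b. r * x b) = (\<Sum>b | x b \<noteq> 0. r * x b * D b)" by (rule \<Phi>_eq[OF fin]) auto
  then show ?thesis by (simp add: \<Phi>_def sum_distrib_left mult.assoc)
qed

lemma \<Phi>_single: "\<Phi> (single b) = D b"
  using \<Phi>_eq[of "{b}" "single b"] by (auto simp: single_def)

lemma \<Phi>_diff:
  assumes "x \<in> carrier F" "y \<in> carrier F"
  shows "\<Phi> (\<lambda>b. x b - y b) = \<Phi> x - \<Phi> y"
proof -
  have "(\<lambda>b. - y b) \<in> carrier F" using assms(2) unfolding F_carrier by (auto simp: OL_def)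
  then show ?thesis
    using \<Phi>_add[OF assms(1), of "\<lambda>b. - y b"] \<Phi>_smult[OF assms(2), of "- 1"] by simp
qed

lemma shift_ideal_sum: "(\<And>i. i \<in> S \<Longrightarrow> f i \<in> shift_ideal n) \<Longrightarrow> sum f S \<in> shift_ideal n"
  by (induction S rule: infinite_finite_induct) (simp_all add: shift_ideal_add)

lemma \<Phi>_in_shift_ideal:
  assumes "x \<in> carrier F"
  shows "\<Phi> x \<in> shift_ideal 1"
  unfolding \<Phi>_def
proof (rule shift_ideal_sum)
  fix b assume "b \<in> {b. x b \<noteq> 0}"
  then have "x b \<in> OL" "b \<in> OL" using assms unfolding F_carrier by blast+
  then show "x b * D b \<in> shift_ideal 1" using shift_ideal_mult D_in_shift_ideal by blast
qed

text \<open>An element of the ideal is an integral multiple of \<open>e / d = D (coord c d)\<close> for some chart.\<close>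
lemma \<Phi>_surj:
  assumes "y \<in> shift_ideal 1"
  shows "\<exists>x\<in>carrier F. \<Phi> x = y"
proof -
  interpret module R F by (rule module_F)
  obtain c where c: "c \<in> K" "val_ge (v e) (y * (a - c))" using assms by (auto simp: shift_ideal_def)
  obtain d where cd: "chart c d" using chart_exists[OF c(1)] by blast
  let ?r = "y * d / e" and ?s = "single (coord c d)"
  have s: "?s \<in> carrier F" by (rule single_in_F[OF coord_OL[OF cd]])
  have r: "?r \<in> OL"
    using c cd e_nz by (cases "y = 0") (auto simp: OL_def val_ge_def v_mult v_divide chart_def a_neq)
  have "(\<lambda>b. ?r * ?s b) \<in> carrier F" by (rule F_smult[OF r s])
  moreover have "\<Phi> (\<lambda>b. ?r * ?s b) = ?r * (e / d)"
    unfolding \<Phi>_smult[OF s] \<Phi>_single D_coord[OF cd] ..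
  then have "\<Phi> (\<lambda>b. ?r * ?s b) = y" using cd e_nz by (simp add: chart_def)
  ultimately show ?thesis by blast
qed

abbreviation rels :: "('l \<Rightarrow> 'l) set" where "rels \<equiv> kaehler_relations R (carrier (val_ring v K))"

lemma rels_eq:
  "rels = {(\<lambda>t. single (b + c) t - (single b t + single c t)) | b c. b \<in> OL \<and> c \<in> OL} \<union>
     {(\<lambda>t. single (b * c) t - (b * single c t + c * single b t)) | b c. b \<in> OL \<and> c \<in> OL} \<union>
     single ` OK"
proof -
  interpret module R F by (rule module_F)
  note OLc = subring_ambientD[OF OL_ring]
  have sum: "single b \<oplus>\<^bsub>F\<^esub> single c \<in> carrier F" if "b \<in> OL" "c \<in> OL" for b c
    using that by (intro M.a_closed single_in_F)
  have smult: "b \<odot>\<^bsub>F\<^esub> single c \<oplus>\<^bsub>F\<^esub> c \<odot>\<^bsub>F\<^esub> single b \<in> carrier F" if "b \<in> OL" "c \<in> OL" for b c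
    using that R_carrier by (intro M.a_closed smult_closed single_in_F) auto
  have 1: "single (b + c) \<ominus>\<^bsub>F\<^esub> (single b \<oplus>\<^bsub>F\<^esub> single c) = (\<lambda>t. single (b + c) t - (single b t + single c t))"
    if "b \<in> OL" "c \<in> OL" for b c
    using F_minus[OF single_in_F sum[OF that]] that OLc by simp
  have 2: "single (b * c) \<ominus>\<^bsub>F\<^esub> (b \<odot>\<^bsub>F\<^esub> single c \<oplus>\<^bsub>F\<^esub> c \<odot>\<^bsub>F\<^esub> single b) =
      (\<lambda>t. single (b * c) t - (b * single c t + c * single b t))" if "b \<in> OL" "c \<in> OL" for b c
    using F_minus[OF single_in_F smult[OF that]] that OLc by simp
  have OK: "carrier (val_ring v K) = OK" by (simp add: OK_def)
  show ?thesis
    unfolding kaehler_relations_def Let_def free_gen_R OK R_carrier val_ring_simps(1,2)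
    using 1 2 unfolding R_carrier by (intro arg_cong2[of _ _ _ _ "(\<union>)"] refl) (metis (no_types, lifting))+
qed

definition \<Phi>_kernel :: "('l \<Rightarrow> 'l) set" where
  "\<Phi>_kernel = {x \<in> carrier F. \<Phi> x \<in> shift_ideal p}"

lemma \<Phi>_kernel_submodule: "submodule \<Phi>_kernel R F"
proof -
  interpret module R F by (rule module_F)
  show ?thesis
  proof (rule submoduleI)
    show "\<Phi>_kernel \<subseteq> carrier F" by (auto simp: \<Phi>_kernel_def)
    have "\<Phi> (\<lambda>s. 0) = 0" by (simp add: \<Phi>_def)
    then show "\<zero>\<^bsub>F\<^esub> \<in> \<Phi>_kernel" using M.zero_closed by (simp add: \<Phi>_kernel_def)
    fix x assume x: "x \<in> \<Phi>_kernel"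
    have "\<ominus>\<^bsub>F\<^esub> x = \<zero>\<^bsub>F\<^esub> \<ominus>\<^bsub>F\<^esub> x"
      using x by (simp add: \<Phi>_kernel_def a_minus_def del: free_module_simps)
    also have "\<dots> = (\<lambda>b. 0 - x b)"
      using F_minus[OF M.zero_closed, of x] x by (simp add: \<Phi>_kernel_def)
    finally have "\<ominus>\<^bsub>F\<^esub> x = (\<lambda>b. - 1 * x b)" by simp
    then have "\<Phi> (\<ominus>\<^bsub>F\<^esub> x) = - 1 * \<Phi> x"
      using \<Phi>_smult[of x "- 1"] x by (simp only: \<Phi>_kernel_def mem_Collect_eq)
    moreover have "\<ominus>\<^bsub>F\<^esub> x \<in> carrier F" using x by (intro M.a_inv_closed) (simp only: \<Phi>_kernel_def mem_Collect_eq)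
    ultimately show "\<ominus>\<^bsub>F\<^esub> x \<in> \<Phi>_kernel"
      using x shift_ideal_minus[of "\<Phi> x" p] by (simp add: \<Phi>_kernel_def)
  next
    fix x y assume xy: "x \<in> \<Phi>_kernel" "y \<in> \<Phi>_kernel"
    then have "x \<oplus>\<^bsub>F\<^esub> y \<in> carrier F" by (intro M.a_closed) (simp_all only: \<Phi>_kernel_def mem_Collect_eq)
    then show "x \<oplus>\<^bsub>F\<^esub> y \<in> \<Phi>_kernel"
      using xy \<Phi>_add[of x y] shift_ideal_add by (simp add: \<Phi>_kernel_def)
  next
    fix r x assume rx: "r \<in> carrier R" "x \<in> \<Phi>_kernel"
    then have "r \<odot>\<^bsub>F\<^esub> x \<in> carrier F" by (intro smult_closed) (simp_all only: \<Phi>_kernel_def mem_Collect_eq)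
    moreover have "r \<in> OL" using rx(1) R_carrier by blast
    ultimately show "r \<odot>\<^bsub>F\<^esub> x \<in> \<Phi>_kernel"
      using rx(2) \<Phi>_smult[of x r] shift_ideal_mult by (simp add: \<Phi>_kernel_def)
  qed
qed

lemma rels_in_kernel: "rels \<subseteq> \<Phi>_kernel"
proof -
  interpret module R F by (rule module_F)
  note OLc = subring_ambientD[OF OL_ring]
  note s = single_in_F
  have "(\<lambda>t. single (b + c) t - (single b t + single c t)) \<in> \<Phi>_kernel" if bc: "b \<in> OL" "c \<in> OL" for b c
  proof -
    have sum: "(\<lambda>t. single b t + single c t) \<in> carrier F"
      by (rule F_add[OF s[OF bc(1)] s[OF bc(2)]])
    have bc': "single (b + c) \<in> carrier F" using bc by (intro s OLc)
    have "(\<lambda>t. single (b + c) t - (single b t + single c t)) \<in> carrier F"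
      using M.minus_closed[OF bc' sum] F_minus[OF bc' sum] by simp
    moreover have "\<Phi> (\<lambda>t. single (b + c) t - (single b t + single c t)) = 0"
      using \<Phi>_diff[OF bc' sum] \<Phi>_add[OF s[OF bc(1)] s[OF bc(2)]] by (simp add: \<Phi>_single D_add)
    ultimately show ?thesis by (simp add: \<Phi>_kernel_def)
  qed
  moreover have "(\<lambda>t. single (b * c) t - (b * single c t + c * single b t)) \<in> \<Phi>_kernel"
    if bc: "b \<in> OL" "c \<in> OL" for b c
  proof -
    have 1: "(\<lambda>t. b * single c t) \<in> carrier F"
      using bc by (intro F_smult s)
    have 2: "(\<lambda>t. c * single b t) \<in> carrier F"
      using bc by (intro F_smult s)
    have sum: "(\<lambda>t. b * single c t + c * single b t) \<in> carrier F"
      by (rule F_add[OF 1 2])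
    have bc': "single (b * c) \<in> carrier F" using bc by (intro s OLc)
    have "(\<lambda>t. single (b * c) t - (b * single c t + c * single b t)) \<in> carrier F"
      using M.minus_closed[OF bc' sum] F_minus[OF bc' sum] by simp
    moreover have "\<Phi> (\<lambda>t. single (b * c) t - (b * single c t + c * single b t)) = D (b * c) - (b * D c + c * D b)"
      using \<Phi>_diff[OF bc' sum] \<Phi>_add[OF 1 2] \<Phi>_smult[OF s[OF bc(1)], of c] \<Phi>_smult[OF s[OF bc(2)], of b]
      by (simp add: \<Phi>_single)
    ultimately show ?thesis
      using D_mult[OF bc] by (simp add: \<Phi>_kernel_def)
  qed
  moreover have "single k \<in> \<Phi>_kernel" if "k \<in> OK" for k
    using that s[of k] OK_le_OL D_const[of k]
    by (auto simp: \<Phi>_kernel_def \<Phi>_single OK_def)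
  ultimately show ?thesis unfolding rels_eq by blast
qed

abbreviation relation_module :: "('l \<Rightarrow> 'l) set" where
  "relation_module \<equiv> generated_submodule R F rels"

text \<open>Choose a chart in which all elements that occur in \<open>x\<close> are integral and which witnesses that \<open>\<Phi> x\<close>
lies in the ideal. Then \<open>x\<close> represents \<open>B d\<alpha>\<close> with \<open>\<alpha> = coord c d\<close> and \<open>\<Phi> x = B (e / d)\<close>. That
\<open>(e / d)^p\<close> divides the latter means that \<open>(e / d)^(p - 1)\<close>, and hence the derivative at \<open>\<alpha>\<close> of the
minimal polynomial of \<open>\<alpha>\<close>, divides \<open>B\<close>.\<close>
lemma kernel_in_relations:
  assumes x: "x \<in> \<Phi>_kernel"
  shows "x \<in> relation_module"
proof -
  interpret M: module R F by (rule module_F)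
  note N = M.generated_submodule_submodule[OF \<Phi>_kernel_submodule rels_in_kernel]
  note NE = M.submoduleE[OF N(1)]
  interpret differential_relations OK OL relation_module
  proof (rule differential_relations.intro)
    show "subring OK ambient_field" "subring OL ambient_field" "OK \<subseteq> OL"
      by (fact OK_ring OL_ring OK_le_OL)+
    show "(\<lambda>t. 0) \<in> relation_module"
      using subgroup.one_closed[OF submodule.axioms(1)[OF N(1)]] by simp
    show "(\<lambda>t. x t + y t) \<in> relation_module" if "x \<in> relation_module" "y \<in> relation_module" for x y
      using NE(5)[OF that] by simp
    show "(\<lambda>t. r * x t) \<in> relation_module" if "r \<in> OL" "x \<in> relation_module" for r x
      using NE(4)[of r x] that by (simp add: OL_def)
  qed (use N(2) in \<open>unfold rels_eq, blast+\<close>)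
  have xF: "x \<in> carrier F" and "\<Phi> x \<in> shift_ideal p" using x unfolding \<Phi>_kernel_def by blast+
  define S where "S = {b. x b \<noteq> 0}"
  have S: "finite S" "S \<subseteq> OL" "\<And>b. x b \<in> OL" using xF unfolding F_carrier S_def by blast+
  obtain c d where cd: "chart c d" "val_ge (v (e ^ p)) (\<Phi> x * (a - c) ^ p)"
    "\<And>b. b \<in> S \<Longrightarrow> integral_in c d (rep b)"
    using common_chart[OF S(1,2)] \<open>\<Phi> x \<in> shift_ideal p\<close>[unfolded shift_ideal_iff] by blast
  have d: "d \<noteq> 0" "c \<in> K" "v d = v (a - c)" using cd(1) by (auto simp: chart_def)
  let ?\<alpha> = "coord c d" and ?h = "\<lambda>b. rep b \<circ>\<^sub>p [:c, d:]"
  define B where "B = (\<Sum>b\<in>S. x b * poly (pderiv (?h b)) ?\<alpha>)"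
  define w where "w = poly (pderiv (g_chart c d)) ?\<alpha>"
  have "\<Phi> x = (\<Sum>b\<in>S. x b * (e / d * poly (pderiv (?h b)) ?\<alpha>))"
    unfolding \<Phi>_def S_def[symmetric] using D_chart[OF cd(1) cd(3)] by (intro sum.cong) auto
  also have "\<dots> = e / d * B" unfolding B_def sum_distrib_left by (intro sum.cong) (auto simp: mult_ac)
  finally have \<Phi>x: "\<Phi> x = e / d * B" .
  have w: "d ^ (p - 1) * w = poly (pderiv g) a" unfolding w_def by (rule g_chart(6)[OF cd(1)])
  then have w0: "w \<noteq> 0" using v_pderiv_g(1) by auto
  have "v ((a - c) ^ p) = v (d ^ p)" using d by (intro v_power_cong) (auto simp: a_neq)
  then have "val_ge (v (e ^ p)) (\<Phi> x * d ^ p)"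
    using cd(2) d by (cases "\<Phi> x = 0") (auto simp: val_ge_def v_mult a_neq)
  moreover have "\<Phi> x * d ^ p = B * d ^ (p - 1) * e"
  proof -
    have "d ^ p = d * d ^ (p - 1)" using p_pos by (cases p) simp_all
    then show ?thesis using d(1) by (simp add: \<Phi>x)
  qed
  moreover have "v (e ^ p) = v (e ^ (p - 1)) + v e"
    using e_nz p_pos by (cases p) (simp_all add: v_mult add.commute)
  ultimately have "val_ge (v (e ^ (p - 1))) (B * d ^ (p - 1))" using val_ge_cancel[OF e_nz] by simp
  moreover have "v (e ^ (p - 1)) = v w + v (d ^ (p - 1))"
    using v_pderiv_g(2) w w0 d(1) by (metis v_mult add.commute power_not_zero)
  ultimately have "val_ge (0 + v w) (B / w * w)"
    using val_ge_cancel[of "d ^ (p - 1)" "v w" B] d(1) w0 by simp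
  then have "B / w \<in> OL" using val_ge_cancel[OF w0, of 0 "B / w"] by (simp add: OL_def)
  then have dvd: "\<exists>r\<in>OL. B = r * w" using w0 by (intro bexI[of _ "B / w"]) simp_all
  show ?thesis
  proof (rule d_collapse[OF S(1)])
    show "poly_over OK (?h b) \<and> poly (?h b) ?\<alpha> = b" if "b \<in> S" for b
      using integral_inD(1,2)[OF cd(1) cd(3)[OF that]] rep(3) by simp
    show "\<exists>r\<in>OL. (\<Sum>b\<in>S. x b * poly (pderiv (?h b)) ?\<alpha>) = r * poly (pderiv (g_chart c d)) ?\<alpha>"
      using dvd unfolding B_def w_def .
  qed (use S(3) coord_OL[OF cd(1)] g_chart(3,5)[OF cd(1)] in \<open>auto simp: S_def\<close>)
qed

theorem kaehler_isomorphic: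
  "module_isomorphic R (kaehler_differentials R (carrier (val_ring v K)))
     (quotient_module (ideal_module R (shift_ideal 1)) (shift_ideal p))"
proof -
  interpret R: cring R by (rule cring_R)
  interpret M: module R F by (rule module_F)
  note N = M.generated_submodule_submodule[OF \<Phi>_kernel_submodule rels_in_kernel]
  have "shift_ideal p \<subseteq> shift_ideal 1"
  proof -
    have "shift_ideal (Suc n) \<subseteq> shift_ideal 1" for n
      using R.ideal_prod_inter[OF shift_ideal_ideal[of n] shift_ideal_ideal[of 1]] shift_ideal_prod[of n] by blast
    then show ?thesis using p_pos by (metis gr0_implies_Suc)
  qed
  note J = R.ideal_submodule[OF shift_ideal_ideal shift_ideal_ideal this]
  have "module_isomorphic R (quotient_module F relation_module)
      (quotient_module (ideal_module R (shift_ideal 1)) (shift_ideal p))"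
  proof (rule quotient_module_isomorphic[OF module_F N(1) R.module_ideal_module[OF shift_ideal_ideal] J])
    fix x assume x: "x \<in> carrier F"
    show "\<Phi> x \<in> carrier (ideal_module R (shift_ideal 1))" using \<Phi>_in_shift_ideal[OF x] by simp
    show "\<Phi> x \<in> shift_ideal p \<longleftrightarrow> x \<in> relation_module"
      using kernel_in_relations[of x] N(3) x unfolding \<Phi>_kernel_def by blast
    show "\<Phi> (r \<odot>\<^bsub>F\<^esub> x) = r \<odot>\<^bsub>ideal_module R (shift_ideal 1)\<^esub> \<Phi> x" for r
      using \<Phi>_smult[OF x] by simp
    show "\<Phi> (x \<oplus>\<^bsub>F\<^esub> y) = \<Phi> x \<oplus>\<^bsub>ideal_module R (shift_ideal 1)\<^esub> \<Phi> y" if "y \<in> carrier F" for y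
      using \<Phi>_add[OF x that] by simp
  qed (use \<Phi>_surj in simp)
  then show ?thesis unfolding kaehler_differentials_def Let_def R_carrier .
qed

end

theorem theorem1p2:
  fixes K :: "'l::field set"
    and v :: "'l \<Rightarrow> 'g::linordered_ab_group_add"
    and p :: nat
  assumes "subfield K ambient_field"
    and "krull_valuation v"
    and "Factorial_Ring.prime p"
    and "field_degree (ambient_field :: 'l ring) K = p"
    and "galois_extension K"
    and "defect_extension K v"
    and "CHAR('l) = 0 \<Longrightarrow> \<forall>z :: 'l alg_closure. z ^ p = 1 \<longrightarrow> z \<in> to_ac ` K"
  shows "\<exists>I. ramification_ideal K v I \<and> (\<forall>J. ramification_ideal K v J \<longrightarrow> J = I) \<and> I \<noteq> {0} \<and>
    module_isomorphic (val_ring v UNIV)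
      (kaehler_differentials (val_ring v UNIV) (carrier (val_ring v K)))
      (quotient_module (ideal_module (val_ring v UNIV) I) (I [^]\<^bsub>ideals_set (val_ring v UNIV)\<^esub> p))"
proof -
  note K = assms(1) and p = assms(3) and deg = assms(4)
  note defect = defect_prime_degree[OF assms(6) p deg]
  note Kc = subring_ambientD[OF subfield_ambientD(1)[OF K]]
  interpret valuation v by (rule valuation.intro[OF assms(2)])
  interpret L: field "ambient_field :: 'l ring" by (rule field_ambient)
  have "K \<noteq> UNIV"
  proof
    assume "K = UNIV"
    then have "(L.dim over K) UNIV = 1" using L.dimI[OF K L.dimension_one[OF K]] by simp
    then show False using deg prime_gt_1_nat[OF p] by (simp add: field_degree_def over_def)
  qed
  then obtain a where a: "a \<notin> K" by blast
  have vals: "\<exists>k\<in>K. k \<noteq> 0 \<and> v k = v x" if "x \<noteq> 0" for x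
    using ramification_index_1_values[OF defect(4) that Kc(2)] .
  interpret galois_defect v K p a
  proof (intro galois_defect.intro galois_defect_axioms.intro valuation_axioms)
    fix n assume n: "0 < n" "n < p"
    show "of_nat n \<noteq> (0::'l) \<and> v (of_nat n) = 0" by (rule residue_char_unit[OF K defect(3) n])
  next
    show "\<exists>k\<in>K. val_gt 0 (x - k)" if "x \<noteq> 0" "v x = 0" for x
      using inertia_degree_1_residues[OF K defect(1,5), of x] that by (auto simp: val_ge_def)
  next
    show "x \<in> K" if "\<And>\<sigma>. \<sigma> \<in> galois_group K \<Longrightarrow> \<sigma> x = x" for x
      using assms(5) that unfolding galois_extension_def by blast
  next
    show "v (\<sigma> x) = v x" if "\<sigma> \<in> galois_group K" "x \<noteq> 0" for \<sigma> x
      using unibranched_galois_value[OF K defect(2) that(1) vals[OF that(2)] that(2)] .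
  next
    show "poly h a \<noteq> 0" if "poly_over K h" "h \<noteq> 0" "degree h < p" for h
      using prime_degree_generator(1)[OF K defect(1) p deg a that] .
    show "\<exists>h. poly_over K h \<and> degree h < p \<and> poly h a = b" for b
      using prime_degree_generator(2)[OF K defect(1) p deg a] .
  qed (fact K p vals a)+
  show ?thesis
    using ramification_ideal_iff shift_ideal_nonzero kaehler_isomorphic shift_ideal_power[of p]
    by (intro exI[of _ "shift_ideal 1"]) simp
qed

end
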